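(* Let $(A,\mathfrak a)$ be a good pair over $\Bbbk$ with $(A,\mathfrak a)$-basis $B$, let $n\ge1$, $d\ge0$, and let $e\in\mathfrak a$ be an idempotent. Suppose that $B$ is $e$-admissible, i.e. for every $b\in B$ either $ebe=b$ or $ebe=0$. Set $\bar A:=eAe$ and $\bar{\mathfrak a}:=e\mathfrak ae$, and regard $S^{\bar A}(n,d)$ and $T^{\bar A}_{\bar{\mathfrak a}}(n,d)$ as subalgebras of $S^A(n,d)$. Then: (i) $S^{\bar A}(n,d)=\xi^eS^A(n,d)\xi^e$; (ii) $T^{\bar A}_{\bar{\mathfrak a}}(n,d)=\xi^eT^A_{\mathfrak a}(n,d)\xi^e$.
   Context: $\Bbbk$ is a commutative domain of characteristic $0$. Superalgebras are $\mathbb Z/2$-graded associative (not necessarily unital) $\Bbbk$-algebras $A=A_{\bar 0}\oplus A_{\bar 1}$; $\bar a$ denotes the parity of a homogeneous element $a$; tensor products of superalgebras carry the product $(x\otimes y)(z\otimes w)=(-1)^{\bar y\bar z}xz\otimes yw$. A good pair $(A,\mathfrak a)$ consists of a superalgebra $A$ with $A_{\bar 0},A_{\bar 1}$ free over $\Bbbk$ and a subalgebra $\mathfrak a\subseteq A_{\bar 0}$ such that $\mathfrak a$ and $A/\mathfrak a$ are free $\Bbbk$-modules. An $(A,\mathfrak a)$-basis is a $\Bbbk$-basis $B=B_{\mathfrak a}\sqcup B_{\mathfrak c}\sqcup B_{\bar 1}$ of $A$, where $B_{\mathfrak a}$, $B_{\mathfrak c}$, $B_{\bar 1}$ are bases of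 $\mathfrak a$, of a chosen $\Bbbk$-module complement $\mathfrak c$ of $\mathfrak a$ in $A_{\bar 0}$, and of $A_{\bar 1}$, respectively. For $a\in A$ put $\xi^a_{r,s}:=aE_{r,s}\in M_n(A)$ ($E_{r,s}$ the matrix units; $M_n(A)$ is a superalgebra via parities of entries). Write $[1,n]=\{1,\dots,n\}$. The symmetric group $\mathfrak S_d$ acts on the right on words by $(x_1\cdots x_d)\sigma=x_{\sigma 1}\cdots x_{\sigma d}$, diagonally on tuples of words, and on $M_n(A)^{\otimes d}$ by superalgebra automorphisms $(\xi^{a_1}_{r_1,s_1}\otimes\cdots\otimes\xi^{a_d}_{r_d,s_d})^\sigma=(-1)^{\langle\sigma;\boldsymbol a\rangle}\xi^{a_{\sigma1}}_{r_{\sigma1},s_{\sigma1}}\otimes\cdots\otimes\xi^{a_{\sigma d}}_{r_{\sigma d},s_{\sigma d}}$ for homogeneous $a_i$, where $\langle\sigma;\boldsymbol a\rangle=\#\{(k,l): k<l,\ \sigma^{-1}k>\sigma^{-1}l,\ a_k,a_l \text{ odd}\}$. Define $S^A(n,d):=(M_n(A)^{\otimes d})^{\mathfrak S_d}$. $\mathrm{Tri}^B(n,d)$ is the set of triples $(\boldsymbol b,\boldsymbol r,\boldsymbol s)\in B^d\times[1,n]^d\times[1,n]^d$ such that for $k\ne l$ the equality $(b_k,r_k,s_k)=(b_l,r_l,s_l)$ holds only if $b_k$ is even. For such a triple let $\xi^{\boldsymbol b}_{\boldsymbol r,\boldsymbol s}:=\sum_\sigma(\xi^{b_1}_{r_1,s_1}\otimes\cdots\otimes\xi^{b_d}_{r_d,s_d})^\sigma\in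 S^A(n,d)$, with $\sigma$ over representatives of the cosets $\mathfrak S_{\boldsymbol b,\boldsymbol r,\boldsymbol s}\backslash\mathfrak S_d$, where $\mathfrak S_{\boldsymbol b,\boldsymbol r,\boldsymbol s}$ is the stabilizer of the triple. Let $[\boldsymbol b,\boldsymbol r,\boldsymbol s]^b_{r,s}:=\#\{k: (b_k,r_k,s_k)=(b,r,s)\}$, $[\boldsymbol b,\boldsymbol r,\boldsymbol s]^!_{\mathfrak c}:=\prod_{b\in B_{\mathfrak c},\,r,s\in[1,n]}[\boldsymbol b,\boldsymbol r,\boldsymbol s]^b_{r,s}!$, and $\eta^{\boldsymbol b}_{\boldsymbol r,\boldsymbol s}:=[\boldsymbol b,\boldsymbol r,\boldsymbol s]^!_{\mathfrak c}\,\xi^{\boldsymbol b}_{\boldsymbol r,\boldsymbol s}$. $T^A_{\mathfrak a}(n,d)$ is the $\Bbbk$-span of all $\eta^{\boldsymbol b}_{\boldsymbol r,\boldsymbol s}$ with $(\boldsymbol b,\boldsymbol r,\boldsymbol s)\in\mathrm{Tri}^B(n,d)$; it is a subalgebra of $S^A(n,d)$ that does not depend on the choice of $(A,\mathfrak a)$-basis. The same definitions are applied to the pair $(\bar A,\bar{\mathfrak a})$, which (under the admissibility assumption) is a good pair. For an idempotent $e\in\mathfrak a$: $E^e:=\sum_{r=1}^n\xi^e_{r,r}\in M_n(A)$ and $\xi^e:=E^e\otimes\cdots\otimes E^e$ ($d$ factors), an idempotent in $T^A_{\mathfrak a}(n,d)$. *)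

theory Defs
  imports
    Jordan_Normal_Form.Matrix
    "HOL-Library.Poly_Mapping"
    "HOL-Library.Z2"
    "HOL-Combinatorics.Permutations"
begin

section \<open>Superalgebras and good pairs\<close>

text \<open>
  A superalgebra is given by its two homogeneous parts \<open>A 0\<close> and \<open>A 1\<close>, which are submodules of
  an ambient associative, not necessarily unital algebra (the type \<open>'a\<close> with scalar
  multiplication \<open>scale\<close>). Working with carriers allows \<open>A\<close> and \<open>e A e\<close> to be treated by the same
  definitions.
\<close>

locale superalgebra = Modules.module scale
  for scale :: "'k::comm_ring_1 \<Rightarrow> 'a::ring \<Rightarrow> 'a" +
  fixes A :: "bit \<Rightarrow> 'a set"
  assumes scale_mult_left: "scale c x * y = scale c (x * y)"
    and scale_mult_right: "x * scale c y = scale c (x * y)"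
    and subspace_part: "Modules.module.subspace scale (A i)"
    and parts_Int: "A 0 \<inter> A 1 = {0}"
    and mult_part: "x \<in> A i \<Longrightarrow> y \<in> A j \<Longrightarrow> x * y \<in> A (i + j)"

definition super_carrier :: "(bit \<Rightarrow> 'a::ring set) \<Rightarrow> 'a set" where
  "super_carrier A = {x + y | x y. x \<in> A 0 \<and> y \<in> A 1}"

definition hom_part :: "(bit \<Rightarrow> 'a::ring set) \<Rightarrow> bit \<Rightarrow> 'a \<Rightarrow> 'a" where
  "hom_part A i x = (THE y. y \<in> A i \<and> x - y \<in> A (i + 1))"

definition basis_of :: "('k::comm_ring_1 \<Rightarrow> 'a::ab_group_add \<Rightarrow> 'a) \<Rightarrow> 'a set \<Rightarrow> 'a set \<Rightarrow> bool" where
  "basis_of scale V B \<longleftrightarrow> \<not> Modules.module.dependent scale B \<and> Modules.module.span scale B = V"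

definition free_module :: "('k::comm_ring_1 \<Rightarrow> 'a::ab_group_add \<Rightarrow> 'a) \<Rightarrow> 'a set \<Rightarrow> bool" where
  "free_module scale V \<longleftrightarrow> (\<exists>B. basis_of scale V B)"

text \<open>
  Freeness of the quotient \<open>V / U\<close>: \<open>C\<close> is a set of representatives of a basis of the quotient,
  that is, modulo \<open>U\<close> every element of \<open>V\<close> is a linear combination of \<open>C\<close> with uniquely
  determined coefficients.
\<close>

definition free_quotient ::
  "('k::comm_ring_1 \<Rightarrow> 'a::ab_group_add \<Rightarrow> 'a) \<Rightarrow> 'a set \<Rightarrow> 'a set \<Rightarrow> bool" where
  "free_quotient scale V U \<longleftrightarrow>
    (\<exists>C\<subseteq>V. \<forall>x\<in>V. \<exists>!f :: 'a \<Rightarrow>\<^sub>0 'k. Poly_Mapping.keys f \<subseteq> C \<and> x - (\<Sum>c\<in>Poly_Mapping.keys f. scale (Poly_Mapping.lookup f c) c) \<in> U)"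

definition good_pair ::
  "('k::comm_ring_1 \<Rightarrow> 'a::ring \<Rightarrow> 'a) \<Rightarrow> (bit \<Rightarrow> 'a set) \<Rightarrow> 'a set \<Rightarrow> bool" where
  "good_pair scale A \<aa> \<longleftrightarrow>
    superalgebra scale A \<and> free_module scale (A 0) \<and> free_module scale (A 1) \<and>
    \<aa> \<subseteq> A 0 \<and> Modules.module.subspace scale \<aa> \<and> (\<forall>x\<in>\<aa>. \<forall>y\<in>\<aa>. x * y \<in> \<aa>) \<and>
    free_module scale \<aa> \<and> free_quotient scale (super_carrier A) \<aa>"

definition pair_basis ::
  "('k::comm_ring_1 \<Rightarrow> 'a::ring \<Rightarrow> 'a) \<Rightarrow> (bit \<Rightarrow> 'a set) \<Rightarrow> 'a set \<Rightarrow>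
    'a set \<Rightarrow> 'a set \<Rightarrow> 'a set \<Rightarrow> bool" where
  "pair_basis scale A \<aa> Ba Bc B1 \<longleftrightarrow>
    basis_of scale \<aa> Ba \<and>
    (\<exists>\<cc>. Modules.module.subspace scale \<cc> \<and> \<aa> \<inter> \<cc> = {0} \<and> {x + y | x y. x \<in> \<aa> \<and> y \<in> \<cc>} = A 0 \<and>
      basis_of scale \<cc> Bc) \<and>
    basis_of scale (A 1) B1"

definition corner :: "'a::ring \<Rightarrow> 'a set \<Rightarrow> 'a set" where
  "corner e X = (\<lambda>x. e * x * e) ` X"

section \<open>Tensor powers of the matrix superalgebra\<close>

text \<open>
  The tensor power \<open>M_n(A)^(\<otimes> d)\<close> is the free module on words of length \<open>d\<close> with letters in
  \<open>M_n(A)\<close> modulo the submodule expressing multilinearity. Matrix indices and tensor positions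
  are counted from \<open>0\<close>.
\<close>

definition fscale :: "'k::comm_ring_1 \<Rightarrow> ('b \<Rightarrow>\<^sub>0 'k) \<Rightarrow> ('b \<Rightarrow>\<^sub>0 'k)" where
  "fscale c f = Poly_Mapping.map ((*) c) f"

lemma lookup_fscale: "Poly_Mapping.lookup (fscale c f) w = c * Poly_Mapping.lookup f w"
  by (simp add: fscale_def Poly_Mapping.map.rep_eq when_def)

lemma module_fscale: "Modules.module (fscale :: 'k::comm_ring_1 \<Rightarrow> ('b \<Rightarrow>\<^sub>0 'k) \<Rightarrow> ('b \<Rightarrow>\<^sub>0 'k))"
  by unfold_locales
    (auto intro!: poly_mapping_eqI simp: lookup_fscale lookup_add algebra_simps)

definition lin_ext ::
  "('b \<Rightarrow> ('c \<Rightarrow>\<^sub>0 'k::comm_ring_1)) \<Rightarrow> ('b \<Rightarrow>\<^sub>0 'k) \<Rightarrow> ('c \<Rightarrow>\<^sub>0 'k)" where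
  "lin_ext \<phi> f = (\<Sum>w\<in>Poly_Mapping.keys f. fscale (Poly_Mapping.lookup f w) (\<phi> w))"

definition super_mats :: "(bit \<Rightarrow> 'a::ring set) \<Rightarrow> nat \<Rightarrow> 'a mat set" where
  "super_mats A n = {X \<in> carrier_mat n n. elements_mat X \<subseteq> super_carrier A}"

definition words :: "(bit \<Rightarrow> 'a::ring set) \<Rightarrow> nat \<Rightarrow> nat \<Rightarrow> 'a mat list set" where
  "words A n d = {w. length w = d \<and> set w \<subseteq> super_mats A n}"

definition word_module ::
  "(bit \<Rightarrow> 'a::ring set) \<Rightarrow> nat \<Rightarrow> nat \<Rightarrow> ('a mat list \<Rightarrow>\<^sub>0 'k::comm_ring_1) set" where
  "word_module A n d = {f. Poly_Mapping.keys f \<subseteq> words A n d}"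

definition multilin_rels ::
  "('k::comm_ring_1 \<Rightarrow> 'a::ring \<Rightarrow> 'a) \<Rightarrow> (bit \<Rightarrow> 'a set) \<Rightarrow> nat \<Rightarrow> nat \<Rightarrow>
    ('a mat list \<Rightarrow>\<^sub>0 'k) set" where
  "multilin_rels scale A n d = Modules.module.span fscale
    ({Poly_Mapping.single (u @ (X + Y) # v) 1 - Poly_Mapping.single (u @ X # v) 1
        - Poly_Mapping.single (u @ Y # v) 1 | u v X Y.
        u @ X # v \<in> words A n d \<and> u @ Y # v \<in> words A n d} \<union>
     {Poly_Mapping.single (u @ map_mat (scale c) X # v) 1 - Poly_Mapping.single (u @ X # v) c | u v X c.
        u @ X # v \<in> words A n d})"

definition tensor_rel ::
  "('k::comm_ring_1 \<Rightarrow> 'a::ring \<Rightarrow> 'a) \<Rightarrow> (bit \<Rightarrow> 'a set) \<Rightarrow> nat \<Rightarrow> nat \<Rightarrow>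
    (('a mat list \<Rightarrow>\<^sub>0 'k) \<times> ('a mat list \<Rightarrow>\<^sub>0 'k)) set" where
  "tensor_rel scale A n d = {(f, g). f \<in> word_module A n d \<and> g \<in> word_module A n d \<and>
    f - g \<in> multilin_rels scale A n d}"

definition tensor_power ::
  "('k::comm_ring_1 \<Rightarrow> 'a::ring \<Rightarrow> 'a) \<Rightarrow> (bit \<Rightarrow> 'a set) \<Rightarrow> nat \<Rightarrow> nat \<Rightarrow>
    ('a mat list \<Rightarrow>\<^sub>0 'k) set set" where
  "tensor_power scale A n d = word_module A n d // tensor_rel scale A n d"

definition tensor_class ::
  "('k::comm_ring_1 \<Rightarrow> 'a::ring \<Rightarrow> 'a) \<Rightarrow> (bit \<Rightarrow> 'a set) \<Rightarrow> nat \<Rightarrow> nat \<Rightarrow>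
    ('a mat list \<Rightarrow>\<^sub>0 'k) \<Rightarrow> ('a mat list \<Rightarrow>\<^sub>0 'k) set" where
  "tensor_class scale A n d f = tensor_rel scale A n d `` {f}"

text \<open>
  Operations involving signs are prescribed on tensors of homogeneous matrices. On an arbitrary
  word they are obtained by summing over all choices \<open>p\<close> of a parity for each letter, replacing
  each letter by its homogeneous component of the chosen parity.
\<close>

definition parities :: "nat \<Rightarrow> bit list set" where
  "parities d = {p. length p = d}"

definition word_part :: "(bit \<Rightarrow> 'a::ring set) \<Rightarrow> bit list \<Rightarrow> 'a mat list \<Rightarrow> 'a mat list" where
  "word_part A p w = map2 (\<lambda>i X. map_mat (hom_part A i) X) p w"

text \<open>
  Iterating the rule \<open>(x \<otimes> y)(z \<otimes> w) = (-1)^(|y||z|) xz \<otimes> yw\<close>, a sign arises for every odd right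
  factor in position \<open>j\<close> that passes an odd left factor in a later position \<open>k\<close>.
\<close>

definition word_mult ::
  "(bit \<Rightarrow> 'a::ring set) \<Rightarrow> nat \<Rightarrow> 'a mat list \<Rightarrow> 'a mat list \<Rightarrow> ('a mat list \<Rightarrow>\<^sub>0 'k::comm_ring_1)"
  where
  "word_mult A d x y = (\<Sum>p\<in>parities d. \<Sum>q\<in>parities d.
    Poly_Mapping.single (map2 (*) (word_part A p x) (word_part A q y))
      ((- 1) ^ card {(j, k). j < k \<and> k < d \<and> p ! k = 1 \<and> q ! j = 1}))"

definition tensor_mult ::
  "('k::comm_ring_1 \<Rightarrow> 'a::ring \<Rightarrow> 'a) \<Rightarrow> (bit \<Rightarrow> 'a set) \<Rightarrow> nat \<Rightarrow> nat \<Rightarrow>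
    ('a mat list \<Rightarrow>\<^sub>0 'k) set \<Rightarrow> ('a mat list \<Rightarrow>\<^sub>0 'k) set \<Rightarrow> ('a mat list \<Rightarrow>\<^sub>0 'k) set" where
  "tensor_mult scale A n d t u = (\<Union>f\<in>t. \<Union>g\<in>u.
    tensor_class scale A n d (lin_ext (\<lambda>x. lin_ext (word_mult A d x) g) f))"

definition perm_sign_exp :: "nat \<Rightarrow> (nat \<Rightarrow> nat) \<Rightarrow> bit list \<Rightarrow> nat" where
  "perm_sign_exp d \<sigma> p =
    card {(k, l). k < l \<and> l < d \<and> inv_into UNIV \<sigma> k > inv_into UNIV \<sigma> l \<and> p ! k = 1 \<and> p ! l = 1}"

definition word_act ::
  "(bit \<Rightarrow> 'a::ring set) \<Rightarrow> nat \<Rightarrow> (nat \<Rightarrow> nat) \<Rightarrow> 'a mat list \<Rightarrow> ('a mat list \<Rightarrow>\<^sub>0 'k::comm_ring_1)"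
  where
  "word_act A d \<sigma> w = (\<Sum>p\<in>parities d.
    Poly_Mapping.single (permute_list \<sigma> (word_part A p w)) ((- 1) ^ perm_sign_exp d \<sigma> p))"

definition tensor_act ::
  "('k::comm_ring_1 \<Rightarrow> 'a::ring \<Rightarrow> 'a) \<Rightarrow> (bit \<Rightarrow> 'a set) \<Rightarrow> nat \<Rightarrow> nat \<Rightarrow>
    (nat \<Rightarrow> nat) \<Rightarrow> ('a mat list \<Rightarrow>\<^sub>0 'k) set \<Rightarrow> ('a mat list \<Rightarrow>\<^sub>0 'k) set" where
  "tensor_act scale A n d \<sigma> t = (\<Union>f\<in>t. tensor_class scale A n d (lin_ext (word_act A d \<sigma>) f))"

definition invariant_algebra ::
  "('k::comm_ring_1 \<Rightarrow> 'a::ring \<Rightarrow> 'a) \<Rightarrow> (bit \<Rightarrow> 'a set) \<Rightarrow> nat \<Rightarrow> nat \<Rightarrow>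
    ('a mat list \<Rightarrow>\<^sub>0 'k) set set" where
  "invariant_algebra scale A n d =
    {t \<in> tensor_power scale A n d. \<forall>\<sigma>. \<sigma> permutes {..<d} \<longrightarrow> tensor_act scale A n d \<sigma> t = t}"

text \<open>The map \<open>M_n(A')^(\<otimes> d) \<rightarrow> M_n(A)^(\<otimes> d)\<close> induced by an inclusion \<open>A' \<subseteq> A\<close> of superalgebras.\<close>

definition tensor_incl ::
  "('k::comm_ring_1 \<Rightarrow> 'a::ring \<Rightarrow> 'a) \<Rightarrow> (bit \<Rightarrow> 'a set) \<Rightarrow> nat \<Rightarrow> nat \<Rightarrow>
    ('a mat list \<Rightarrow>\<^sub>0 'k) set \<Rightarrow> ('a mat list \<Rightarrow>\<^sub>0 'k) set" where
  "tensor_incl scale A n d t = (\<Union>f\<in>t. tensor_class scale A n d f)"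

section \<open>Generalized Schur algebras\<close>

definition elem_mat :: "nat \<Rightarrow> 'a::ring \<Rightarrow> nat \<Rightarrow> nat \<Rightarrow> 'a mat" where
  "elem_mat n x r s = mat n n (\<lambda>(i, j). if i = r \<and> j = s then x else 0)"

definition Tri ::
  "(bit \<Rightarrow> 'a set) \<Rightarrow> 'a set \<Rightarrow> nat \<Rightarrow> nat \<Rightarrow> ('a list \<times> nat list \<times> nat list) set" where
  "Tri A B n d = {(bs, rs, ss).
    length bs = d \<and> length rs = d \<and> length ss = d \<and>
    set bs \<subseteq> B \<and> set rs \<subseteq> {..<n} \<and> set ss \<subseteq> {..<n} \<and>
    (\<forall>k<d. \<forall>l<d. k \<noteq> l \<and> bs ! k = bs ! l \<and> rs ! k = rs ! l \<and> ss ! k = ss ! l \<longrightarrow> bs ! k \<in> A 0)}"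

definition tri_word :: "nat \<Rightarrow> nat \<Rightarrow> 'a::ring list \<Rightarrow> nat list \<Rightarrow> nat list \<Rightarrow> 'a mat list" where
  "tri_word n d bs rs ss = map (\<lambda>k. elem_mat n (bs ! k) (rs ! k) (ss ! k)) [0..<d]"

definition tri_stab :: "nat \<Rightarrow> 'a list \<Rightarrow> nat list \<Rightarrow> nat list \<Rightarrow> (nat \<Rightarrow> nat) set" where
  "tri_stab d bs rs ss = {\<sigma>. \<sigma> permutes {..<d} \<and>
    permute_list \<sigma> bs = bs \<and> permute_list \<sigma> rs = rs \<and> permute_list \<sigma> ss = ss}"

definition tri_cosets :: "nat \<Rightarrow> 'a list \<Rightarrow> nat list \<Rightarrow> nat list \<Rightarrow> (nat \<Rightarrow> nat) set set" where
  "tri_cosets d bs rs ss = {(\<lambda>\<rho>. \<rho> \<circ> \<sigma>) ` tri_stab d bs rs ss | \<sigma>. \<sigma> permutes {..<d}}"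

definition xi_rep ::
  "(bit \<Rightarrow> 'a::ring set) \<Rightarrow> nat \<Rightarrow> nat \<Rightarrow> 'a list \<Rightarrow> nat list \<Rightarrow> nat list \<Rightarrow>
    ('a mat list \<Rightarrow>\<^sub>0 'k::comm_ring_1)" where
  "xi_rep A n d bs rs ss =
    (\<Sum>C\<in>tri_cosets d bs rs ss. word_act A d (SOME \<sigma>. \<sigma> \<in> C) (tri_word n d bs rs ss))"

definition tri_count :: "nat \<Rightarrow> 'a list \<Rightarrow> nat list \<Rightarrow> nat list \<Rightarrow> 'a \<Rightarrow> nat \<Rightarrow> nat \<Rightarrow> nat" where
  "tri_count d bs rs ss b r s = card {k. k < d \<and> bs ! k = b \<and> rs ! k = r \<and> ss ! k = s}"

text \<open>
  The product over \<open>Bc\<close>, which may be infinite, is restricted to the elements occurring in \<open>bs\<close>;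
  all other factors are \<open>0! = 1\<close>.
\<close>

definition tri_fact :: "'a set \<Rightarrow> nat \<Rightarrow> nat \<Rightarrow> 'a list \<Rightarrow> nat list \<Rightarrow> nat list \<Rightarrow> nat" where
  "tri_fact Bc n d bs rs ss =
    (\<Prod>b\<in>Bc \<inter> set bs. \<Prod>r<n. \<Prod>s<n. fact (tri_count d bs rs ss b r s))"

definition eta_rep ::
  "(bit \<Rightarrow> 'a::ring set) \<Rightarrow> 'a set \<Rightarrow> nat \<Rightarrow> nat \<Rightarrow> 'a list \<Rightarrow> nat list \<Rightarrow> nat list \<Rightarrow>
    ('a mat list \<Rightarrow>\<^sub>0 'k::comm_ring_1)" where
  "eta_rep A Bc n d bs rs ss = fscale (of_nat (tri_fact Bc n d bs rs ss)) (xi_rep A n d bs rs ss)"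

text \<open>
  The span of the classes of the elements \<open>eta_rep\<close> is formed as the image, in the quotient, of
  the span of these elements.
\<close>

definition gen_schur ::
  "('k::comm_ring_1 \<Rightarrow> 'a::ring \<Rightarrow> 'a) \<Rightarrow> (bit \<Rightarrow> 'a set) \<Rightarrow> 'a set \<Rightarrow> 'a set \<Rightarrow> 'a set \<Rightarrow>
    nat \<Rightarrow> nat \<Rightarrow> ('a mat list \<Rightarrow>\<^sub>0 'k) set set" where
  "gen_schur scale A Ba Bc B1 n d = tensor_class scale A n d `
    Modules.module.span fscale {eta_rep A Bc n d bs rs ss | bs rs ss.
      (bs, rs, ss) \<in> Tri A (Ba \<union> Bc \<union> B1) n d}"

definition xi_idem ::
  "('k::comm_ring_1 \<Rightarrow> 'a::ring \<Rightarrow> 'a) \<Rightarrow> (bit \<Rightarrow> 'a set) \<Rightarrow> nat \<Rightarrow> nat \<Rightarrow> 'a \<Rightarrow>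
    ('a mat list \<Rightarrow>\<^sub>0 'k) set" where
  "xi_idem scale A n d e = tensor_class scale A n d
    (Poly_Mapping.single (replicate d (mat n n (\<lambda>(i, j). if i = j then e else 0))) 1)"

definition xi_corner ::
  "('k::comm_ring_1 \<Rightarrow> 'a::ring \<Rightarrow> 'a) \<Rightarrow> (bit \<Rightarrow> 'a set) \<Rightarrow> nat \<Rightarrow> nat \<Rightarrow> 'a \<Rightarrow>
    ('a mat list \<Rightarrow>\<^sub>0 'k) set set \<Rightarrow> ('a mat list \<Rightarrow>\<^sub>0 'k) set set" where
  "xi_corner scale A n d e X =
    (\<lambda>t. tensor_mult scale A n d
      (tensor_mult scale A n d (xi_idem scale A n d e) t) (xi_idem scale A n d e)) ` X"

end

theory Submission
  imports Defs
begin

text \<open>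
  Tensors are determined by their coordinates with respect to the words in the matrices \<open>b E\<^sub>r\<^sub>,\<^sub>s\<close>
  with \<open>b\<close> in a homogeneous basis, and all operations become explicit on coordinates. Invariance says
  that permuting a triple list multiplies the coordinate by a sign, and an invariant tensor lies in
  \<open>T\<close> iff its coordinate at every triple list is divisible by the corresponding product of
  factorials over the letters from \<open>\<cc>\<close>. This divisibility does not depend on the basis: a coordinate in another
  basis is a sum over triple lists that is invariant under a group whose order is the required
  product of factorials, and the order of each stabilizer divides the summand, so the order of the
  group divides the sum. Finally, if the basis is \<open>e\<close>-admissible, then \<open>t \<mapsto> \<xi>\<^sup>e t \<xi>\<^sup>e\<close> merely
  restricts coordinates to the triple lists with all \<open>b\<close> in \<open>e A e\<close>, which preserves both
  conditions.
\<close>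

section \<open>Signs and counting of permutations\<close>

text \<open>The final statement allows every pair basis of the corner, while only the one cut out of
  \<open>B\<close> by \<open>e\<close> is adapted to the projection. Comparing the two is the
  obstacle. Passing to another basis may also change the complement \<open>\<cc>\<close>, so
  elements of \<open>Bc\<close> can acquire components in \<open>Ba'\<close>; but elements of
  \<open>Ba\<close> have none in \<open>Bc'\<close>, because both bases span the same
  \<open>\<aa>\<close>. Hence where the new list carries a letter from \<open>Bc'\<close>, the old
  list must carry one from \<open>Bc\<close>, and such letters are even. This one-sided
  triangularity saves the factorials and makes all signs in the comparison trivial.

  Factorials turn into divisibility because \<open>\<xi>\<close> has coordinates 1 or -1 on one
  orbit of triple lists and 0 elsewhere, so the integer factor in \<open>\<eta>\<close> is exactly a
  divisor required on that orbit.

  Tensors are classes of formal combinations of words, and each operation is a union over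
  representatives. Formulas are therefore proved for representatives, in coordinates that vanish on
  the multilinearity relations; signs are controlled by a cocycle identity for inversions between
  odd positions.\<close>

lemma minus_one_power_card_sym_diff:
  assumes "finite X" "finite Y"
  shows "(- 1 :: 'k::comm_ring_1) ^ card ((X - Y) \<union> (Y - X)) = (- 1) ^ card X * (- 1) ^ card Y"
proof -
  have "card ((X - Y) \<union> (Y - X)) = card (X - Y) + card (Y - X)"
    using assms by (intro card_Un_disjoint) auto
  moreover have "card X = card (X - Y) + card (X \<inter> Y)" "card Y = card (Y - X) + card (X \<inter> Y)"
    using assms by (metis Int_commute card_Diff_subset_Int card_mono finite_Int inf_le1
        le_add_diff_inverse2)+
  ultimately show ?thesis
    by (simp add: power_add flip: power_mult_distrib) (simp add: power_mult_distrib mult.assoc mult.left_commute)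
qed

text \<open>Inversions between odd positions, kept as two-element sets: a permutation maps such sets
  to such sets, whereas it need not map increasing pairs to increasing pairs.\<close>

definition flips :: "nat \<Rightarrow> (nat \<Rightarrow> nat) \<Rightarrow> bit list \<Rightarrow> nat set set" where
  "flips d \<sigma> p = {S. \<exists>x y. S = {x, y} \<and> x < d \<and> y < d \<and> p ! x = 1 \<and> p ! y = 1 \<and>
    (x < y) \<noteq> (inv_into UNIV \<sigma> x < inv_into UNIV \<sigma> y)}"

lemma finite_flips: "finite (flips d \<sigma> p)"
proof (rule finite_subset)
  show "flips d \<sigma> p \<subseteq> Pow {..<d}" by (auto simp: flips_def)
qed simp

lemma card_flips:
  assumes "\<sigma> permutes {..<d}"
  shows "card (flips d \<sigma> p) = perm_sign_exp d \<sigma> p"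
proof -
  let ?P = "{(k, l). k < l \<and> l < d \<and> inv_into UNIV \<sigma> k > inv_into UNIV \<sigma> l \<and> p ! k = 1 \<and> p ! l = 1}"
  have inj: "inv_into UNIV \<sigma> x = inv_into UNIV \<sigma> y \<longleftrightarrow> x = y" for x y
    using assms by (metis permutes_inverses(1))
  have "flips d \<sigma> p = (\<lambda>(k, l). {k, l}) ` ?P"
  proof (rule antisym)
    show "flips d \<sigma> p \<subseteq> (\<lambda>(k, l). {k, l}) ` ?P"
    proof
      fix S assume "S \<in> flips d \<sigma> p"
      then obtain x y where S: "S = {x, y}" "x < d" "y < d" "p ! x = 1" "p ! y = 1"
        "(x < y) \<noteq> (inv_into UNIV \<sigma> x < inv_into UNIV \<sigma> y)" by (auto simp: flips_def)
      consider "x < y" "inv_into UNIV \<sigma> y < inv_into UNIV \<sigma> x" | "y < x" "inv_into UNIV \<sigma> x < inv_into UNIV \<sigma> y"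
        using S(6) inj[of x y] by (metis nat_neq_iff)
      then show "S \<in> (\<lambda>(k, l). {k, l}) ` ?P"
      proof cases
        case 1 then show ?thesis using S by (intro image_eqI[of _ _ "(x, y)"]) auto
      next
        case 2 then show ?thesis using S by (intro image_eqI[of _ _ "(y, x)"]) auto
      qed
    qed
  qed (auto simp: flips_def; metis order.strict_trans less_not_sym)
  moreover have "inj_on (\<lambda>(k, l). {k, l}) ?P"
    by (auto simp: inj_on_def doubleton_eq_iff)
  ultimately show ?thesis by (simp add: card_image perm_sign_exp_def)
qed

text \<open>The inverse of \<open>\<sigma> \<circ> \<rho>\<close> applies the inverse of
  \<open>\<sigma>\<close> and afterwards that of \<open>\<rho>\<close>, so it reverses a pair iff
  exactly one of the two stages does. The second stage sees the rearranged positions, whence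
  \<open>permute_list \<sigma> p\<close> and the image under \<open>\<sigma>\<close>.\<close>

lemma flips_comp:
  assumes s: "\<sigma> permutes {..<d}" and r: "\<rho> permutes {..<d}" and p: "length p = d"
  shows "flips d (\<sigma> \<circ> \<rho>) p =
    (flips d \<sigma> p - (`) \<sigma> ` flips d \<rho> (permute_list \<sigma> p)) \<union>
    ((`) \<sigma> ` flips d \<rho> (permute_list \<sigma> p) - flips d \<sigma> p)"
proof -
  \<comment> \<open>All pairs of distinct odd positions. Both sides of the claim consist of such
    pairs, so membership has to be compared on \<open>O2\<close> only.\<close>
  define O2 where "O2 = {S. \<exists>x y. S = {x, y} \<and> x < d \<and> y < d \<and> p ! x = 1 \<and> p ! y = 1 \<and> x \<noteq> y}"
  have inv_comp: "inv_into UNIV (\<sigma> \<circ> \<rho>) z = inv_into UNIV \<rho> (inv_into UNIV \<sigma> z)" for z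
    using s r by (simp add: o_inv_distrib permutes_bij)
  have inv_lt: "inv_into UNIV \<sigma> z < d \<longleftrightarrow> z < d" for z
    using permutes_in_image[OF permutes_inv[OF s], of z] by simp
  have lt: "\<sigma> z < d \<longleftrightarrow> z < d" for z
    using permutes_in_image[OF s, of z] by simp
  have inj: "inv_into UNIV \<sigma> x = inv_into UNIV \<sigma> y \<longleftrightarrow> x = y" for x y
    using s by (metis permutes_inverses(1))
  have injr: "inv_into UNIV \<rho> x = inv_into UNIV \<rho> y \<longleftrightarrow> x = y" for x y
    using r by (metis permutes_inverses(1))
  have sub: "flips d \<tau> p \<subseteq> O2" for \<tau>
    unfolding flips_def O2_def by blast
  have pl: "permute_list \<sigma> p ! z = p ! \<sigma> z" if "z < d" for z
    using that s p by (simp add: permute_list_nth)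
  have sub': "(`) \<sigma> ` flips d \<rho> (permute_list \<sigma> p) \<subseteq> O2"
  proof
    fix S assume "S \<in> (`) \<sigma> ` flips d \<rho> (permute_list \<sigma> p)"
    then obtain x y where *: "S = \<sigma> ` {x, y}" "x < d" "y < d" "permute_list \<sigma> p ! x = 1"
      "permute_list \<sigma> p ! y = 1" "(x < y) \<noteq> (inv_into UNIV \<rho> x < inv_into UNIV \<rho> y)"
      unfolding flips_def by blast
    have "\<sigma> x \<noteq> \<sigma> y" using *(6) inj_eq[OF permutes_inj[OF s], of x y] by auto
    then show "S \<in> O2" unfolding O2_def using * pl[of x] pl[of y] lt by (intro CollectI exI[of _ "\<sigma> x"] exI[of _ "\<sigma> y"]) simp
  qed
  have mem: "{x, y} \<in> flips d \<tau> p \<longleftrightarrow> (x < y) \<noteq> (inv_into UNIV \<tau> x < inv_into UNIV \<tau> y)"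
    if "x < d" "y < d" "p ! x = 1" "p ! y = 1" "x \<noteq> y" "\<tau> permutes {..<d}" for \<tau> x y
  proof
    assume "{x, y} \<in> flips d \<tau> p"
    then obtain x' y' where *: "{x, y} = {x', y'}" "(x' < y') \<noteq> (inv_into UNIV \<tau> x' < inv_into UNIV \<tau> y')"
      unfolding flips_def by blast
    have "inv_into UNIV \<tau> x' \<noteq> inv_into UNIV \<tau> y'" using that(5,6) *(1)
      by (metis doubleton_eq_iff permutes_inverses(1))
    moreover have "x' \<noteq> y'" using *(1) that(5) by auto
    ultimately show "(x < y) \<noteq> (inv_into UNIV \<tau> x < inv_into UNIV \<tau> y)"
      using * by (auto simp: doubleton_eq_iff)
  next
    assume "(x < y) \<noteq> (inv_into UNIV \<tau> x < inv_into UNIV \<tau> y)"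
    then show "{x, y} \<in> flips d \<tau> p" unfolding flips_def using that by blast
  qed
  have mem': "{x, y} \<in> (`) \<sigma> ` flips d \<rho> (permute_list \<sigma> p) \<longleftrightarrow>
      (inv_into UNIV \<sigma> x < inv_into UNIV \<sigma> y) \<noteq> (inv_into UNIV \<rho> (inv_into UNIV \<sigma> x) < inv_into UNIV \<rho> (inv_into UNIV \<sigma> y))"
    if xy: "x < d" "y < d" "p ! x = 1" "p ! y = 1" "x \<noteq> y" for x y
  proof
    assume "{x, y} \<in> (`) \<sigma> ` flips d \<rho> (permute_list \<sigma> p)"
    then obtain x' y' where *: "{x, y} = {\<sigma> x', \<sigma> y'}" "(x' < y') \<noteq> (inv_into UNIV \<rho> x' < inv_into UNIV \<rho> y')"
      unfolding flips_def by auto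
    have ne: "x' \<noteq> y'" using *(1) that(5) by auto
    then have "inv_into UNIV \<rho> x' \<noteq> inv_into UNIV \<rho> y'" using injr by simp
    moreover have "(inv_into UNIV \<sigma> x = x' \<and> inv_into UNIV \<sigma> y = y') \<or> (inv_into UNIV \<sigma> x = y' \<and> inv_into UNIV \<sigma> y = x')"
      using *(1) s by (auto simp: doubleton_eq_iff permutes_inverses)
    ultimately show "(inv_into UNIV \<sigma> x < inv_into UNIV \<sigma> y) \<noteq> (inv_into UNIV \<rho> (inv_into UNIV \<sigma> x) < inv_into UNIV \<rho> (inv_into UNIV \<sigma> y))"
      using * ne by auto
  next
    assume *: "(inv_into UNIV \<sigma> x < inv_into UNIV \<sigma> y) \<noteq> (inv_into UNIV \<rho> (inv_into UNIV \<sigma> x) < inv_into UNIV \<rho> (inv_into UNIV \<sigma> y))"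
    have "{inv_into UNIV \<sigma> x, inv_into UNIV \<sigma> y} \<in> flips d \<rho> (permute_list \<sigma> p)"
      unfolding flips_def using * xy inv_lt pl[of "inv_into UNIV \<sigma> x"] pl[of "inv_into UNIV \<sigma> y"] s
      by (intro CollectI exI[of _ "inv_into UNIV \<sigma> x"] exI[of _ "inv_into UNIV \<sigma> y"])
        (simp add: permutes_inverses)
    moreover have "{x, y} = \<sigma> ` {inv_into UNIV \<sigma> x, inv_into UNIV \<sigma> y}"
      using s by (simp add: permutes_inverses)
    ultimately show "{x, y} \<in> (`) \<sigma> ` flips d \<rho> (permute_list \<sigma> p)" by blast
  qed
  have "S \<in> flips d (\<sigma> \<circ> \<rho>) p \<longleftrightarrow> (S \<in> flips d \<sigma> p) \<noteq> (S \<in> (`) \<sigma> ` flips d \<rho> (permute_list \<sigma> p))"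
    if "S \<in> O2" for S
  proof -
    from that obtain x y where S: "S = {x, y}" and xy: "x < d" "y < d" "p ! x = 1" "p ! y = 1" "x \<noteq> y"
      unfolding O2_def by blast
    show ?thesis
      using mem[OF xy permutes_compose[OF r s]] mem[OF xy s] mem'[OF xy] inv_comp S by auto
  qed
  then show ?thesis using sub sub' by blast
qed

text \<open>The sign is a cocycle for the right action on parity lists, because modulo 2 the
  cardinality of a symmetric difference is the sum of the cardinalities.\<close>

lemma perm_sign_comp:
  assumes s: "\<sigma> permutes {..<d}" and r: "\<rho> permutes {..<d}" and p: "length p = d"
  shows "(- 1 :: 'k::comm_ring_1) ^ perm_sign_exp d (\<sigma> \<circ> \<rho>) p =
    (- 1) ^ perm_sign_exp d \<sigma> p * (- 1) ^ perm_sign_exp d \<rho> (permute_list \<sigma> p)"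
proof -
  have "inj_on ((`) \<sigma>) (flips d \<rho> (permute_list \<sigma> p))"
    using permutes_inj[OF s] by (auto simp: inj_on_def inj_image_eq_iff)
  then have "card ((`) \<sigma> ` flips d \<rho> (permute_list \<sigma> p)) = perm_sign_exp d \<rho> (permute_list \<sigma> p)"
    by (simp add: card_image card_flips[OF r])
  then show ?thesis
    using minus_one_power_card_sym_diff[OF finite_flips[of d \<sigma> p]
        finite_imageI[OF finite_flips[of d \<rho> "permute_list \<sigma> p"], of "(`) \<sigma>"]]
    by (simp add: flips_comp[OF assms] card_flips s flip: card_flips[OF permutes_compose[OF r s], of p])
qed

text \<open>A pair of fixed positions cannot be inverted. This is how signs disappear for
  permutations that move even letters only.\<close>

lemma perm_sign_exp_eq_0:
  assumes "\<sigma> permutes {..<d}" and "\<And>k. k < d \<Longrightarrow> p ! k = 1 \<Longrightarrow> \<sigma> k = k"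
  shows "perm_sign_exp d \<sigma> p = 0"
proof -
  have "inv_into UNIV \<sigma> k = k" if "k < d" "p ! k = 1" for k
    using assms that by (metis permutes_inverses(2))
  then have "{(k, l). k < l \<and> l < d \<and> inv_into UNIV \<sigma> k > inv_into UNIV \<sigma> l \<and> p ! k = 1 \<and> p ! l = 1} = {}"
    by (intro equals0I) (force dest: less_trans)
  then show ?thesis unfolding perm_sign_exp_def by (simp only: card.empty)
qed

text \<open>The inversions are the pair \<open>(k, l)\<close> itself and, for each odd position
  \<open>m\<close> strictly in between, the two pairs \<open>(k, m)\<close> and
  \<open>(m, l)\<close>.\<close>

lemma odd_perm_sign_exp_transpose:
  assumes "k < l" "l < d" "p ! k = 1" "p ! l = 1"
  shows "odd (perm_sign_exp d (transpose k l) p)"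
proof -
  define M where "M = {m. k < m \<and> m < l \<and> p ! m = 1}"
  have fM: "finite M" unfolding M_def by simp
  have eq: "{(i, j). i < j \<and> j < d \<and> inv_into UNIV (transpose k l) i > inv_into UNIV (transpose k l) j \<and> p ! i = 1 \<and> p ! j = 1}
      = insert (k, l) (Pair k ` M \<union> (\<lambda>m. (m, l)) ` M)"
    using assms by (auto simp: M_def transpose_def image_iff split: if_splits)
  have "card (Pair k ` M \<union> (\<lambda>m. (m, l)) ` M) = card (Pair k ` M) + card ((\<lambda>m. (m, l)) ` M)"
    using fM by (intro card_Un_disjoint) (auto simp: M_def)
  also have "\<dots> = 2 * card M"
    by (simp add: card_image inj_on_def)
  finally have "card (insert (k, l) (Pair k ` M \<union> (\<lambda>m. (m, l)) ` M)) = Suc (2 * card M)"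
    using fM by (subst card_insert_disjoint) (auto simp: M_def)
  then show ?thesis unfolding perm_sign_exp_def eq by simp
qed

text \<open>
  Over one orbit the sum equals \<open>|orbit| h(x)\<close>, and \<open>|orbit| |stabilizer| = |G|\<close>.
\<close>

lemma card_group_dvd_sum:
  fixes G :: "('i \<Rightarrow> 'i) set" and act :: "('i \<Rightarrow> 'i) \<Rightarrow> 'x \<Rightarrow> 'x" and h :: "'x \<Rightarrow> 'k::comm_ring_1"
  assumes G: "finite G" "id \<in> G" "\<And>\<sigma> \<tau>. \<sigma> \<in> G \<Longrightarrow> \<tau> \<in> G \<Longrightarrow> \<sigma> \<circ> \<tau> \<in> G"
      "\<And>\<sigma>. \<sigma> \<in> G \<Longrightarrow> \<exists>\<tau>\<in>G. \<sigma> \<circ> \<tau> = id \<and> \<tau> \<circ> \<sigma> = id"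
    and "finite X"
    and act: "\<And>\<sigma> x. \<sigma> \<in> G \<Longrightarrow> x \<in> X \<Longrightarrow> act \<sigma> x \<in> X" "\<And>x. x \<in> X \<Longrightarrow> act id x = x"
      "\<And>\<sigma> \<tau> x. \<sigma> \<in> G \<Longrightarrow> \<tau> \<in> G \<Longrightarrow> x \<in> X \<Longrightarrow> act (\<sigma> \<circ> \<tau>) x = act \<tau> (act \<sigma> x)"
    and h: "\<And>\<sigma> x. \<sigma> \<in> G \<Longrightarrow> x \<in> X \<Longrightarrow> h (act \<sigma> x) = h x"
      "\<And>x. x \<in> X \<Longrightarrow> of_nat (card {\<sigma> \<in> G. act \<sigma> x = x}) dvd h x"
  shows "of_nat (card G) dvd sum h X"
  using \<open>finite X\<close> act h
proof (induction X rule: finite_psubset_induct)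
  case (psubset X)
  show ?case
  proof (cases "X = {}")
    case False
    then obtain x where x: "x \<in> X" by blast
    define Orb where "Orb = (\<lambda>\<sigma>. act \<sigma> x) ` G"
    have OX: "Orb \<subseteq> X" using psubset.prems(1) x by (auto simp: Orb_def)
    have xO: "x \<in> Orb" unfolding Orb_def using psubset.prems(2)[OF x] G(2) by (metis imageI)
    have fO: "finite Orb" using G(1) by (simp add: Orb_def)
    \<comment> \<open>The complement of an orbit is stable under \<open>G\<close>, as the induction
      hypothesis for \<open>X - Orb\<close> demands.\<close>
    have orb_back: "y \<in> Orb" if y: "y \<in> X" "\<sigma> \<in> G" "act \<sigma> y \<in> Orb" for y \<sigma>
    proof -
      obtain \<tau> where \<tau>: "\<tau> \<in> G" "\<sigma> \<circ> \<tau> = id" using G(4)[OF y(2)] by blast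
      obtain \<rho> where \<rho>: "\<rho> \<in> G" "act \<sigma> y = act \<rho> x" using y(3) by (auto simp: Orb_def)
      have "y = act \<tau> (act \<sigma> y)" using psubset.prems(2,3) y \<tau> by metis
      also have "\<dots> = act (\<rho> \<circ> \<tau>) x" using psubset.prems(3) \<tau> \<rho> x by metis
      finally show ?thesis using G(3) \<rho> \<tau> by (auto simp: Orb_def)
    qed
    have IH: "of_nat (card G) dvd sum h (X - Orb)"
    proof (rule psubset.IH)
      show "X - Orb \<subset> X" using x xO by blast
    qed (use psubset.prems orb_back in auto)
    \<comment> \<open>Composition with an element carrying \<open>x\<close> to \<open>y\<close>
      turns the stabilizer of \<open>x\<close> into the coset of all elements carrying
      \<open>x\<close> to \<open>y\<close>.\<close>
    have fiber: "card {\<sigma> \<in> G. act \<sigma> x = y} = card {\<sigma> \<in> G. act \<sigma> x = x}" if "y \<in> Orb" for y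
    proof -
      obtain \<tau> where \<tau>: "\<tau> \<in> G" "y = act \<tau> x" using \<open>y \<in> Orb\<close> by (auto simp: Orb_def)
      obtain \<tau>' where \<tau>': "\<tau>' \<in> G" "\<tau> \<circ> \<tau>' = id" "\<tau>' \<circ> \<tau> = id" using G(4) \<tau> by blast
      have "bij_betw (\<lambda>\<rho>. \<rho> \<circ> \<tau>) {\<sigma> \<in> G. act \<sigma> x = x} {\<sigma> \<in> G. act \<sigma> x = y}"
      proof (rule bij_betw_byWitness[where f' = "\<lambda>\<rho>. \<rho> \<circ> \<tau>'"])
        show "(\<lambda>\<rho>. \<rho> \<circ> \<tau>') ` {\<sigma> \<in> G. act \<sigma> x = y} \<subseteq> {\<sigma> \<in> G. act \<sigma> x = x}"
        proof
          fix \<mu> assume "\<mu> \<in> (\<lambda>\<rho>. \<rho> \<circ> \<tau>') ` {\<sigma> \<in> G. act \<sigma> x = y}"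
          then obtain \<sigma> where s: "\<sigma> \<in> G" "act \<sigma> x = y" "\<mu> = \<sigma> \<circ> \<tau>'" by blast
          have "act \<mu> x = act \<tau>' (act \<tau> x)"
            using psubset.prems(3)[OF s(1) \<tau>'(1) x] s \<tau> by metis
          also have "\<dots> = act (\<tau> \<circ> \<tau>') x"
            using psubset.prems(3)[OF \<tau>(1) \<tau>'(1) x] by metis
          also have "\<dots> = x" using psubset.prems(2)[OF x] \<tau>' by metis
          finally show "\<mu> \<in> {\<sigma> \<in> G. act \<sigma> x = x}" using s \<tau>' G(3) by auto
        qed
        show "(\<lambda>\<rho>. \<rho> \<circ> \<tau>) ` {\<sigma> \<in> G. act \<sigma> x = x} \<subseteq> {\<sigma> \<in> G. act \<sigma> x = y}"
        proof
          fix \<mu> assume "\<mu> \<in> (\<lambda>\<rho>. \<rho> \<circ> \<tau>) ` {\<sigma> \<in> G. act \<sigma> x = x}"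
          then obtain \<sigma> where s: "\<sigma> \<in> G" "act \<sigma> x = x" "\<mu> = \<sigma> \<circ> \<tau>" by blast
          have "act \<mu> x = y" using psubset.prems(3)[OF s(1) \<tau>(1) x] s \<tau> by metis
          then show "\<mu> \<in> {\<sigma> \<in> G. act \<sigma> x = y}" using s \<tau> G(3) by auto
        qed
      qed (simp_all add: comp_assoc \<tau>')
      then show ?thesis by (rule bij_betw_same_card[symmetric])
    qed
    have "card G = (\<Sum>y\<in>Orb. card {\<sigma> \<in> G. act \<sigma> x = y})"
      using sum.image_gen[OF G(1), of "\<lambda>_. 1::nat" "\<lambda>\<sigma>. act \<sigma> x"] by (simp add: Orb_def)
    also have "\<dots> = card Orb * card {\<sigma> \<in> G. act \<sigma> x = x}"
      using fiber by simp
    finally have cG: "card G = card Orb * card {\<sigma> \<in> G. act \<sigma> x = x}" .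
    have "h y = h x" if "y \<in> Orb" for y
      using that psubset.prems(4) x by (auto simp: Orb_def)
    then have "sum h Orb = of_nat (card Orb) * h x" by simp
    then have "of_nat (card G) dvd sum h Orb"
      using psubset.prems(5)[OF x] by (simp add: cG mult_dvd_mono)
    moreover have "sum h X = sum h Orb + sum h (X - Orb)"
      using OX psubset.hyps by (metis sum.subset_diff add.commute)
    ultimately show ?thesis using IH by simp
  qed simp
qed

text \<open>Lagrange's theorem, as the case of \<open>card_group_dvd_sum\<close> in which
  \<open>H\<close> acts on \<open>G\<close> by right composition and the summand is constantly 1.
  The action is free, so all stabilizers are trivial.\<close>

lemma card_subgroup_dvd:
  assumes "finite G" "finite H" "H \<subseteq> G" "id \<in> H"
    and G: "\<And>\<sigma> \<tau>. \<sigma> \<in> G \<Longrightarrow> \<tau> \<in> G \<Longrightarrow> \<sigma> \<circ> \<tau> \<in> G" "\<And>\<sigma>. \<sigma> \<in> G \<Longrightarrow> bij \<sigma>"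
    and H: "\<And>\<sigma> \<tau>. \<sigma> \<in> H \<Longrightarrow> \<tau> \<in> H \<Longrightarrow> \<sigma> \<circ> \<tau> \<in> H" "\<And>\<sigma>. \<sigma> \<in> H \<Longrightarrow> inv_into UNIV \<sigma> \<in> H"
  shows "card H dvd card G"
proof -
  have "(of_nat (card H) :: int) dvd (\<Sum>\<sigma>\<in>G. 1)"
  proof (rule card_group_dvd_sum[where act = "\<lambda>\<tau> \<sigma>. \<sigma> \<circ> \<tau>"])
    show "\<exists>\<tau>\<in>H. \<sigma> \<circ> \<tau> = id \<and> \<tau> \<circ> \<sigma> = id" if "\<sigma> \<in> H" for \<sigma>
      using H(2)[OF that] G(2) that assms(3) by (intro bexI[of _ "inv_into UNIV \<sigma>"])
        (auto simp: bij_is_surj bij_is_inj surj_iff[symmetric] inj_iff[symmetric] subset_iff)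
    show "of_nat (card {\<tau> \<in> H. \<sigma> \<circ> \<tau> = \<sigma>}) dvd (1 :: int)" if "\<sigma> \<in> G" for \<sigma>
    proof -
      have "\<tau> = id" if "\<sigma> \<circ> \<tau> = \<sigma>" for \<tau>
        using G(2)[OF \<open>\<sigma> \<in> G\<close>] that by (metis bij_is_inj comp_assoc comp_id id_comp inv_o_cancel)
      then have "{\<tau> \<in> H. \<sigma> \<circ> \<tau> = \<sigma>} = {id}" using assms(4) by auto
      then show ?thesis by simp
    qed
  qed (use assms in \<open>auto simp: comp_assoc\<close>)
  then show ?thesis by simp
qed

text \<open>The group is the product of the symmetric groups of the fibers over \<open>V\<close>;
  the induction splits off the fiber over one value.\<close>

lemma card_fiber_preserving_permutations:
  fixes f :: "'i \<Rightarrow> 'v"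
  assumes "finite S" "finite V"
  shows "card {\<sigma>. \<sigma> permutes {k \<in> S. f k \<in> V} \<and> (\<forall>k\<in>S. f (\<sigma> k) = f k)} =
    (\<Prod>v\<in>V. fact (card {k \<in> S. f k = v}))"
  using assms(2)
proof (induction V rule: finite_induct)
  case empty
  have "{\<sigma>. \<sigma> permutes {} \<and> (\<forall>k\<in>S. f (\<sigma> k) = f k)} = {id}"
    by (auto simp: permutes_empty)
  then show ?case by simp
next
  case (insert v V)
  define Q where "Q W = {\<sigma>. \<sigma> permutes {k \<in> S. f k \<in> W} \<and> (\<forall>k\<in>S. f (\<sigma> k) = f k)}" for W
  define K where "K = {k \<in> S. f k = v}"
  \<comment> \<open>Restriction to the fibers over \<open>W\<close>, extended by the identity. It is
    again a permutation since \<open>\<sigma>\<close> maps each fiber to itself.\<close>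
  define res where "res W \<sigma> k = (if k \<in> S \<and> f k \<in> W then \<sigma> k else k)" for W and \<sigma> :: "'i \<Rightarrow> 'i" and k
  have resQ: "res W \<sigma> \<in> Q W" if W: "W \<subseteq> insert v V" and s: "\<sigma> \<in> Q (insert v V)" for W \<sigma>
  proof -
    have perm: "\<sigma> permutes {k \<in> S. f k \<in> insert v V}" and pres: "\<And>k. k \<in> S \<Longrightarrow> f (\<sigma> k) = f k"
      using s by (auto simp: Q_def)
    have inS: "\<sigma> k \<in> S" if "k \<in> S" "f k \<in> W" for k
      using permutes_in_image[OF perm, of k] that W by auto
    have "res W \<sigma> permutes {k \<in> S. f k \<in> W}"
    proof (rule inj_imp_permutes)
      show "inj_on (res W \<sigma>) {k \<in> S. f k \<in> W}"
        using permutes_inj[OF perm] by (auto simp: inj_on_def res_def)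
    qed (use inS pres assms(1) in \<open>auto simp: res_def\<close>)
    then show ?thesis using pres by (auto simp: Q_def res_def)
  qed
  have K_eq: "{k \<in> S. f k \<in> {v}} = K" by (auto simp: K_def)
  have Qv: "Q {v} = {\<sigma>. \<sigma> permutes K}"
  proof -
    have "f (\<sigma> k) = f k" if "\<sigma> permutes K" "k \<in> S" for \<sigma> k
      using permutes_in_image[OF that(1), of k] permutes_not_in[OF that(1), of k]
      by (cases "k \<in> K") (auto simp: K_def)
    then show ?thesis unfolding Q_def K_eq by auto
  qed
  have "bij_betw (\<lambda>\<sigma>. (res {v} \<sigma>, res V \<sigma>)) (Q (insert v V)) (Q {v} \<times> Q V)"
  proof (rule bij_betw_byWitness[where f' = "\<lambda>(\<alpha>, \<beta>). \<alpha> \<circ> \<beta>"])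
    show "\<forall>\<sigma>\<in>Q (insert v V). (\<lambda>(\<alpha>, \<beta>). \<alpha> \<circ> \<beta>) (res {v} \<sigma>, res V \<sigma>) = \<sigma>"
    proof
      fix \<sigma> assume s: "\<sigma> \<in> Q (insert v V)"
      have perm: "\<sigma> permutes {k \<in> S. f k \<in> insert v V}" and pres: "\<And>k. k \<in> S \<Longrightarrow> f (\<sigma> k) = f k"
        using s by (auto simp: Q_def)
      show "(\<lambda>(\<alpha>, \<beta>). \<alpha> \<circ> \<beta>) (res {v} \<sigma>, res V \<sigma>) = \<sigma>"
      proof (rule ext)
        fix k show "(\<lambda>(\<alpha>, \<beta>). \<alpha> \<circ> \<beta>) (res {v} \<sigma>, res V \<sigma>) k = \<sigma> k"
          using pres[of k] insert.hyps(2) permutes_not_in[OF perm, of k] by (auto simp: res_def)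
      qed
    qed
    show "\<forall>\<alpha>\<beta>\<in>Q {v} \<times> Q V. (\<lambda>\<sigma>. (res {v} \<sigma>, res V \<sigma>)) ((\<lambda>(\<alpha>, \<beta>). \<alpha> \<circ> \<beta>) \<alpha>\<beta>) = \<alpha>\<beta>"
    proof
      fix \<alpha>\<beta> assume "\<alpha>\<beta> \<in> Q {v} \<times> Q V"
      then obtain \<alpha> \<beta> where ab: "\<alpha>\<beta> = (\<alpha>, \<beta>)" "\<alpha> permutes K" "\<beta> permutes {k \<in> S. f k \<in> V}"
        by (auto simp: Qv) (auto simp: Q_def)
      have "res {v} (\<alpha> \<circ> \<beta>) = \<alpha>"
      proof (rule ext)
        fix k show "res {v} (\<alpha> \<circ> \<beta>) k = \<alpha> k"
          using insert.hyps(2) permutes_not_in[OF ab(2), of k] permutes_not_in[OF ab(3), of k]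
          by (auto simp: res_def K_def)
      qed
      moreover have "res V (\<alpha> \<circ> \<beta>) = \<beta>"
      proof (rule ext)
        fix k show "res V (\<alpha> \<circ> \<beta>) k = \<beta> k"
          using insert.hyps(2) permutes_not_in[OF ab(2), of "\<beta> k"] permutes_not_in[OF ab(3), of k]
            permutes_in_image[OF ab(3), of k]
          by (auto simp: res_def K_def)
      qed
      ultimately show "(\<lambda>\<sigma>. (res {v} \<sigma>, res V \<sigma>)) ((\<lambda>(\<alpha>, \<beta>). \<alpha> \<circ> \<beta>) \<alpha>\<beta>) = \<alpha>\<beta>"
        using ab by simp
    qed
    show "(\<lambda>\<sigma>. (res {v} \<sigma>, res V \<sigma>)) ` Q (insert v V) \<subseteq> Q {v} \<times> Q V"
      using resQ by blast
    show "(\<lambda>(\<alpha>, \<beta>). \<alpha> \<circ> \<beta>) ` (Q {v} \<times> Q V) \<subseteq> Q (insert v V)"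
    proof
      fix \<sigma> assume "\<sigma> \<in> (\<lambda>(\<alpha>, \<beta>). \<alpha> \<circ> \<beta>) ` (Q {v} \<times> Q V)"
      then obtain \<alpha> \<beta> where s: "\<sigma> = \<alpha> \<circ> \<beta>" and a: "\<alpha> \<in> Q {v}" and b: "\<beta> \<in> Q V" by auto
      have "\<alpha> permutes {k \<in> S. f k \<in> insert v V}" "\<beta> permutes {k \<in> S. f k \<in> insert v V}"
        using a b unfolding Q_def by (auto elim!: permutes_subset)
      moreover have "\<beta> k \<in> S" if "k \<in> S" for k
        using b that permutes_in_image[of \<beta> "{k \<in> S. f k \<in> V}" k] permutes_not_in[of \<beta> "{k \<in> S. f k \<in> V}" k]
        unfolding Q_def by (cases "k \<in> {k \<in> S. f k \<in> V}") auto
      ultimately show "\<sigma> \<in> Q (insert v V)"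
        using a b s permutes_compose by (auto simp: Q_def)
    qed
  qed
  then have "card (Q (insert v V)) = card (Q {v} \<times> Q V)" by (rule bij_betw_same_card)
  also have "\<dots> = fact (card K) * card (Q V)"
    using card_permutations[of K "card K"] assms(1)
    by (simp add: card_cartesian_product Qv) (simp add: K_def)
  also have "\<dots> = fact (card {k \<in> S. f k = v}) * (\<Prod>v\<in>V. fact (card {k \<in> S. f k = v}))"
    using insert.IH unfolding Q_def K_def by simp
  finally show ?case using insert.hyps unfolding Q_def by simp
qed

section \<open>Linear extensions and words\<close>

interpretation fs: Modules.module "fscale :: 'k::comm_ring_1 \<Rightarrow> ('b \<Rightarrow>\<^sub>0 'k) \<Rightarrow> ('b \<Rightarrow>\<^sub>0 'k)"
  by (rule module_fscale)

text \<open>The linear functional on the free module with prescribed values on words;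
  \<open>lin_ext\<close> is its counterpart for maps into another free module. Coordinates are
  functionals of this kind.\<close>

definition sext :: "('b \<Rightarrow> 'k::comm_ring_1) \<Rightarrow> ('b \<Rightarrow>\<^sub>0 'k) \<Rightarrow> 'k" where
  "sext \<phi> f = (\<Sum>w\<in>Poly_Mapping.keys f. Poly_Mapping.lookup f w * \<phi> w)"

lemma sext_superset:
  assumes "finite S" "Poly_Mapping.keys f \<subseteq> S"
  shows "sext \<phi> f = (\<Sum>w\<in>S. Poly_Mapping.lookup f w * \<phi> w)"
  unfolding sext_def using assms by (intro sum.mono_neutral_left) (auto simp: in_keys_iff)

lemma sext_zero [simp]: "sext \<phi> 0 = 0"
  by (simp add: sext_def)

lemma sext_add: "sext \<phi> (f + g) = sext \<phi> f + sext \<phi> g"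
proof -
  let ?S = "Poly_Mapping.keys f \<union> Poly_Mapping.keys g"
  have "Poly_Mapping.keys (f + g) \<subseteq> ?S" by (rule Poly_Mapping.keys_add)
  then show ?thesis
    by (simp add: sext_superset[of ?S] lookup_add distrib_right sum.distrib)
qed

lemma keys_fscale: "Poly_Mapping.keys (fscale c f) \<subseteq> Poly_Mapping.keys f"
  by (auto simp: in_keys_iff lookup_fscale)

lemma sext_fscale: "sext \<phi> (fscale c f) = c * sext \<phi> f"
  unfolding sext_superset[OF finite_keys keys_fscale]
  by (simp add: lookup_fscale sext_def sum_distrib_left mult.assoc)

lemma fscale_minus_one: "fscale (- 1) f = - f"
  by (rule poly_mapping_eqI) (simp add: lookup_fscale)

lemma sext_diff: "sext \<phi> (f - g) = sext \<phi> f - sext \<phi> g"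
  using sext_add[of \<phi> f "- g"] sext_fscale[of \<phi> "- 1" g] by (simp add: fscale_minus_one)

lemma sext_single [simp]: "sext \<phi> (Poly_Mapping.single w c) = c * \<phi> w"
  by (subst sext_superset[of "{w}"]) auto

lemma sext_sum: "sext \<phi> (sum f S) = (\<Sum>x\<in>S. sext \<phi> (f x))"
  by (induction S rule: infinite_finite_induct) (auto simp: sext_add)

lemma sext_lin_ext: "sext \<phi> (lin_ext \<psi> f) = sext (\<lambda>w. sext \<phi> (\<psi> w)) f"
  by (simp add: lin_ext_def sext_sum sext_fscale) (simp add: sext_def)

lemma sext_cong:
  assumes "\<And>w. w \<in> Poly_Mapping.keys f \<Longrightarrow> \<phi> w = \<psi> w"
  shows "sext \<phi> f = sext \<psi> f"
  using assms by (simp add: sext_def)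

lemma subspace_keys: "fs.subspace {f. Poly_Mapping.keys f \<subseteq> S}"
proof (rule fs.subspaceI)
  fix f g :: "'b \<Rightarrow>\<^sub>0 'k::comm_ring_1" and c
  show "f + g \<in> {f. Poly_Mapping.keys f \<subseteq> S}"
    if "f \<in> {f. Poly_Mapping.keys f \<subseteq> S}" "g \<in> {f. Poly_Mapping.keys f \<subseteq> S}"
    using that Poly_Mapping.keys_add[of f g] by auto
  show "fscale c f \<in> {f. Poly_Mapping.keys f \<subseteq> S}" if "f \<in> {f. Poly_Mapping.keys f \<subseteq> S}"
    using that keys_fscale[of c f] by auto
qed simp

lemma subspace_word_module: "fs.subspace (word_module A n d)"
  unfolding word_module_def by (rule subspace_keys)

lemma lin_ext_in_subspace:
  assumes "fs.subspace V" "\<And>w. w \<in> Poly_Mapping.keys f \<Longrightarrow> \<psi> w \<in> V"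
  shows "lin_ext \<psi> f \<in> V"
  unfolding lin_ext_def using assms by (intro fs.subspace_sum fs.subspace_scale) auto

lemma subspace_sext_kernel: "fs.subspace {f. sext \<phi> f = 0}"
  by (rule fs.subspaceI) (auto simp: sext_add sext_fscale)

lemma finite_parities: "finite (parities d)"
proof -
  have "finite {xs :: bit list. set xs \<subseteq> {0, 1} \<and> length xs = d}"
    by (rule finite_lists_length_eq) simp
  moreover have "parities d \<subseteq> {xs :: bit list. set xs \<subseteq> {0, 1} \<and> length xs = d}"
    by (auto simp: parities_def)
  ultimately show ?thesis by (rule finite_subset[rotated])
qed

lemma word_part_nth:
  assumes "length p = d" "length w = d" "k < d"
  shows "word_part A p w ! k = map_mat (hom_part A (p ! k)) (w ! k)"
  using assms by (simp add: word_part_def)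

lemma length_word_part [simp]: "length (word_part A p w) = min (length p) (length w)"
  by (simp add: word_part_def)

section \<open>Homogeneous components and the quotient defining the tensor power\<close>

context superalgebra
begin

lemma subspace_super_carrier: "subspace (super_carrier A)"
proof -
  have "super_carrier A = span (A 0 \<union> A 1)"
    by (simp add: super_carrier_def span_Un span_eq_iff[THEN iffD2, OF subspace_part])
  then show ?thesis by simp
qed

lemma part_subset_super_carrier: "A i \<subseteq> super_carrier A"
proof -
  have "0 \<in> A j" for j by (rule subspace_0[OF subspace_part])
  then show ?thesis
    by (cases i) (force simp: super_carrier_def)+
qed

lemma hom_part_eqI:
  assumes "y \<in> A i" "x - y \<in> A (i + 1)"
  shows "hom_part A i x = y"
  unfolding hom_part_def
proof (rule the_equality)
  fix z assume z: "z \<in> A i \<and> x - z \<in> A (i + 1)"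
  have "y - z \<in> A i" using assms z subspace_diff[OF subspace_part] by blast
  moreover have "(x - z) - (x - y) \<in> A (i + 1)" using assms z subspace_diff[OF subspace_part] by blast
  ultimately have "y - z \<in> A 0 \<inter> A 1" by (cases i) auto
  then show "z = y" using parts_Int by auto
qed (use assms in auto)

lemma hom_part_in:
  assumes "x \<in> super_carrier A"
  shows "hom_part A i x \<in> A i" "x - hom_part A i x \<in> A (i + 1)"
proof -
  obtain y z where yz: "x = y + z" "y \<in> A 0" "z \<in> A 1" using assms by (auto simp: super_carrier_def)
  have "\<exists>u\<in>A i. x - u \<in> A (i + 1)"
  proof (cases i)
    case zero then show ?thesis using yz by (intro bexI[of _ y]) auto
  next
    case one then show ?thesis using yz by (intro bexI[of _ z]) auto
  qed
  then show "hom_part A i x \<in> A i" "x - hom_part A i x \<in> A (i + 1)"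
    using hom_part_eqI by blast+
qed

lemma hom_part_hom:
  assumes "x \<in> A j"
  shows "hom_part A i x = (if i = j then x else 0)"
proof (rule hom_part_eqI)
  have "0 \<in> A l" for l by (rule subspace_0[OF subspace_part])
  then show "(if i = j then x else 0) \<in> A i" "x - (if i = j then x else 0) \<in> A (i + 1)"
    using assms by (cases i; cases j; simp)+
qed

lemma super_mats_iff:
  "X \<in> super_mats A n \<longleftrightarrow> X \<in> carrier_mat n n \<and> (\<forall>r<n. \<forall>s<n. X $$ (r, s) \<in> super_carrier A)"
proof -
  have "elements_mat X = {X $$ (r, s) | r s. r < n \<and> s < n}" if "X \<in> carrier_mat n n"
    using that by (auto intro: elements_matI dest!: elements_matD)
  then show ?thesis by (auto simp: super_mats_def)
qed

lemma super_mats_add: "X \<in> super_mats A n \<Longrightarrow> Y \<in> super_mats A n \<Longrightarrow> X + Y \<in> super_mats A n"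
  by (auto simp: super_mats_iff intro!: subspace_add[OF subspace_super_carrier])

lemma super_mats_scale: "X \<in> super_mats A n \<Longrightarrow> map_mat (scale c) X \<in> super_mats A n"
  by (auto simp: super_mats_iff intro!: subspace_scale[OF subspace_super_carrier])

lemma super_mats_hom_part: "X \<in> super_mats A n \<Longrightarrow> map_mat (hom_part A i) X \<in> super_mats A n"
  using hom_part_in(1)[THEN subsetD[OF part_subset_super_carrier]] by (auto simp: super_mats_iff)

lemma elem_mat_in_super_mats: "x \<in> super_carrier A \<Longrightarrow> elem_mat n x r s \<in> super_mats A n"
  using subspace_0[OF subspace_super_carrier] by (auto simp: super_mats_iff elem_mat_def)

lemma words_append_iff:
  "u @ X # v \<in> words A n d \<longleftrightarrow> length u + length v + 1 = d \<and> set u \<subseteq> super_mats A n \<and>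
    X \<in> super_mats A n \<and> set v \<subseteq> super_mats A n"
  by (auto simp: words_def)

lemma words_nth: "w \<in> words A n d \<Longrightarrow> k < d \<Longrightarrow> w ! k \<in> super_mats A n"
  by (auto simp: words_def)

lemma words_nthI: "length w = d \<Longrightarrow> (\<And>k. k < d \<Longrightarrow> w ! k \<in> super_mats A n) \<Longrightarrow> w \<in> words A n d"
  by (auto simp: words_def in_set_conv_nth)

lemma word_part_in_words:
  assumes "w \<in> words A n d" "p \<in> parities d"
  shows "word_part A p w \<in> words A n d"
  using assms by (intro words_nthI)
    (auto simp: word_part_nth words_nth super_mats_hom_part words_def parities_def)

lemma single_in_word_module: "w \<in> words A n d \<Longrightarrow> Poly_Mapping.single w c \<in> word_module A n d"
  by (auto simp: word_module_def)

lemma word_module_keys: "f \<in> word_module A n d \<Longrightarrow> w \<in> Poly_Mapping.keys f \<Longrightarrow> w \<in> words A n d"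
  by (auto simp: word_module_def)

lemma multilin_rels_subset: "multilin_rels scale A n d \<subseteq> word_module A n d"
  unfolding multilin_rels_def
proof (rule fs.span_minimal[OF _ subspace_word_module], safe)
  fix u v X Y assume "u @ X # v \<in> words A n d" "u @ Y # v \<in> words A n d"
  then show "Poly_Mapping.single (u @ (X + Y) # v) 1 - Poly_Mapping.single (u @ X # v) 1
      - Poly_Mapping.single (u @ Y # v) 1 \<in> word_module A n d"
    by (intro fs.subspace_diff[OF subspace_word_module] single_in_word_module)
      (auto simp: words_append_iff super_mats_add)
next
  fix u v X c assume "u @ X # v \<in> words A n d"
  then show "Poly_Mapping.single (u @ map_mat (scale c) X # v) 1 - Poly_Mapping.single (u @ X # v) c
      \<in> word_module A n d"
    by (intro fs.subspace_diff[OF subspace_word_module] single_in_word_module)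
      (auto simp: words_append_iff super_mats_scale)
qed

lemma subspace_multilin_rels: "fs.subspace (multilin_rels scale A n d)"
  by (simp add: multilin_rels_def)

text \<open>A product of linear functions of the separate letters is multilinear, hence vanishes on
  the generators of the relations. Every proof that something is well defined on tensors reduces to
  this; the factor \<open>\<psi> k\<close> may depend on the position.\<close>

lemma sext_multilinear_rels:
  assumes f: "f \<in> multilin_rels scale A n d"
    and add: "\<And>k X Y. k < d \<Longrightarrow> X \<in> super_mats A n \<Longrightarrow> Y \<in> super_mats A n \<Longrightarrow>
      \<psi> k (X + Y) = \<psi> k X + \<psi> k Y"
    and scale: "\<And>k X c. k < d \<Longrightarrow> X \<in> super_mats A n \<Longrightarrow> \<psi> k (map_mat (scale c) X) = c * \<psi> k X"
  shows "sext (\<lambda>w. \<Prod>k<d. \<psi> k (w ! k)) f = 0"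
proof -
  define \<Psi> where "\<Psi> w = (\<Prod>k<d. \<psi> k (w ! k))" for w
  \<comment> \<open>The remaining factors do not look at position \<open>length u\<close>. Filling
    that position with \<open>undefined\<close> makes them literally the same for all
    \<open>X\<close>.\<close>
  have split: "\<Psi> (u @ X # v) = \<psi> (length u) X * (\<Prod>k\<in>{..<d} - {length u}. \<psi> k ((u @ undefined # v) ! k))"
    if "length u + length v + 1 = d" for u v X
  proof -
    have "\<Psi> (u @ X # v) = \<psi> (length u) ((u @ X # v) ! length u) *
        (\<Prod>k\<in>{..<d} - {length u}. \<psi> k ((u @ X # v) ! k))"
      unfolding \<Psi>_def using that by (intro prod.remove) auto
    also have "(\<Prod>k\<in>{..<d} - {length u}. \<psi> k ((u @ X # v) ! k)) =
        (\<Prod>k\<in>{..<d} - {length u}. \<psi> k ((u @ undefined # v) ! k))"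
      by (rule prod.cong) (auto simp: nth_append nth_Cons split: nat.splits)
    finally show ?thesis by simp
  qed
  have "multilin_rels scale A n d \<subseteq> {f. sext \<Psi> f = 0}"
    unfolding multilin_rels_def
  proof (rule fs.span_minimal[OF _ subspace_sext_kernel], safe)
    fix u v X Y assume "u @ X # v \<in> words A n d" "u @ Y # v \<in> words A n d"
    then show "sext \<Psi> (Poly_Mapping.single (u @ (X + Y) # v) 1 - Poly_Mapping.single (u @ X # v) 1
      - Poly_Mapping.single (u @ Y # v) 1) = 0"
      by (simp add: words_append_iff sext_diff split add distrib_right)
  next
    fix u v X c assume "u @ X # v \<in> words A n d"
    then show "sext \<Psi> (Poly_Mapping.single (u @ map_mat (scale c) X # v) 1
        - Poly_Mapping.single (u @ X # v) c) = 0"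
      by (simp add: words_append_iff sext_diff split scale mult.assoc)
  qed
  then show ?thesis using f unfolding \<Psi>_def[abs_def] by auto
qed

lemma tensor_class_eq:
  assumes "f \<in> word_module A n d"
  shows "tensor_class scale A n d f = {g \<in> word_module A n d. f - g \<in> multilin_rels scale A n d}"
  using assms by (auto simp: tensor_class_def tensor_rel_def)

lemma tensor_class_eq_iff:
  assumes "f \<in> word_module A n d" "g \<in> word_module A n d"
  shows "tensor_class scale A n d f = tensor_class scale A n d g \<longleftrightarrow> f - g \<in> multilin_rels scale A n d"
proof
  assume "tensor_class scale A n d f = tensor_class scale A n d g"
  then have "g \<in> tensor_class scale A n d f"
    using assms fs.subspace_0[OF subspace_multilin_rels] by (simp add: tensor_class_eq)
  then show "f - g \<in> multilin_rels scale A n d" using assms by (simp add: tensor_class_eq)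
next
  assume fg: "f - g \<in> multilin_rels scale A n d"
  have "f - h \<in> multilin_rels scale A n d \<longleftrightarrow> g - h \<in> multilin_rels scale A n d" for h
    using fs.subspace_add[OF subspace_multilin_rels fg, of "g - h"]
      fs.subspace_diff[OF subspace_multilin_rels _ fg, of "f - h"] by auto
  then show "tensor_class scale A n d f = tensor_class scale A n d g"
    using assms by (simp add: tensor_class_eq)
qed

lemma tensor_power_eq: "tensor_power scale A n d = tensor_class scale A n d ` word_module A n d"
  unfolding tensor_power_def quotient_def tensor_class_def by auto

lemma word_act_in_word_module:
  assumes "w \<in> words A n d" "\<sigma> permutes {..<d}"
  shows "word_act A d \<sigma> w \<in> word_module A n d"
proof -
  have "permute_list \<sigma> (word_part A p w) \<in> words A n d" if "p \<in> parities d" for p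
  proof -
    have "word_part A p w \<in> words A n d" by (rule word_part_in_words[OF assms(1) that])
    then show ?thesis using assms(2) by (auto simp: words_def)
  qed
  then show ?thesis
    unfolding word_act_def by (intro fs.subspace_sum[OF subspace_word_module] single_in_word_module)
qed

lemma lin_ext_word_act_in_word_module:
  assumes "f \<in> word_module A n d" "\<sigma> permutes {..<d}"
  shows "lin_ext (word_act A d \<sigma>) f \<in> word_module A n d"
  using assms word_module_keys
  by (intro lin_ext_in_subspace[OF subspace_word_module] word_act_in_word_module) auto

end

section \<open>Coordinates of tensors\<close>

lemma sum_eq_single:
  assumes "finite S" "a \<in> S" "\<And>x. x \<in> S \<Longrightarrow> x \<noteq> a \<Longrightarrow> f x = 0"
  shows "sum f S = f a"
  using assms by (subst sum.remove[of S a]) (auto intro: sum.neutral)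

text \<open>One list of triples replaces the three parallel lists of \<open>Tri\<close>, so that
  equality, permutation and stabilizers concern a single list.\<close>

definition tword :: "nat \<Rightarrow> ('a::ring \<times> nat \<times> nat) list \<Rightarrow> 'a mat list" where
  "tword n ts = map (\<lambda>(b, r, s). elem_mat n b r s) ts"

locale graded_basis = superalgebra scale A
  for scale :: "'k::comm_ring_1 \<Rightarrow> 'a::ring \<Rightarrow> 'a" and A :: "bit \<Rightarrow> 'a set" +
  fixes Bs :: "bit \<Rightarrow> 'a set"
  assumes indep: "independent (Bs 0 \<union> Bs 1)" and span_Bs: "span (Bs i) = A i"
begin

abbreviation "BB \<equiv> Bs 0 \<union> Bs 1"

definition par :: "'a \<Rightarrow> bit" where
  "par b = (if b \<in> Bs 1 then 1 else 0)"

lemma Bs_subset: "Bs i \<subseteq> A i"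
  using span_superset[of "Bs i"] by (simp add: span_Bs)

lemma Bs_subset_BB: "Bs i \<subseteq> BB"
  by (cases i) auto

lemma Bs_disjoint: "Bs 0 \<inter> Bs 1 = {}"
proof -
  have "0 \<notin> BB" using indep dependent_zero by blast
  moreover have "Bs 0 \<inter> Bs 1 \<subseteq> A 0 \<inter> A 1" using Bs_subset by blast
  ultimately show ?thesis unfolding parts_Int by blast
qed

lemma mem_Bs_iff: "b \<in> BB \<Longrightarrow> b \<in> Bs i \<longleftrightarrow> par b = i"
  using Bs_disjoint by (cases i) (auto simp: par_def)

lemma mem_A_iff:
  assumes "b \<in> BB"
  shows "b \<in> A i \<longleftrightarrow> par b = i"
proof -
  have "b \<noteq> 0" using assms indep dependent_zero by blast
  moreover have "b \<in> Bs (par b)" using assms mem_Bs_iff by blast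
  ultimately show ?thesis
    using Bs_subset[of "par b"] parts_Int by (cases i; cases "par b") auto
qed

lemma super_carrier_eq_span: "super_carrier A = span BB"
  by (simp add: super_carrier_def span_Un span_Bs)

lemma BB_subset: "BB \<subseteq> super_carrier A"
  by (simp add: super_carrier_eq_span span_superset)

definition rep :: "'a \<Rightarrow> 'a \<Rightarrow> 'k" where
  "rep v b = representation BB v b"

lemma rep_add: "x \<in> super_carrier A \<Longrightarrow> y \<in> super_carrier A \<Longrightarrow> rep (x + y) b = rep x b + rep y b"
  by (simp add: rep_def representation_add indep super_carrier_eq_span)

lemma rep_diff: "x \<in> super_carrier A \<Longrightarrow> y \<in> super_carrier A \<Longrightarrow> rep (x - y) b = rep x b - rep y b"
  by (simp add: rep_def representation_diff indep super_carrier_eq_span)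

lemma rep_scale: "x \<in> super_carrier A \<Longrightarrow> rep (scale c x) b = c * rep x b"
  by (simp add: rep_def representation_scale indep super_carrier_eq_span)

lemma rep_zero [simp]: "rep 0 b = 0"
  by (simp add: rep_def representation_zero)

lemma rep_basis: "b \<in> BB \<Longrightarrow> rep b c = (if c = b then 1 else 0)"
  unfolding rep_def by (subst representation_basis[OF indep]) auto

lemma rep_subset:
  assumes "x \<in> span S" "S \<subseteq> BB" "b \<notin> S"
  shows "rep x b = 0"
proof -
  have "representation BB x = representation S x"
    by (rule representation_extend[OF indep assms(1,2)])
  then show ?thesis using representation_ne_zero[of S x b] assms(3) by (auto simp: rep_def)
qed

lemma rep_hom:
  assumes "x \<in> A i" "b \<in> BB" "par b \<noteq> i"
  shows "rep x b = 0"
proof (rule rep_subset)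
  show "x \<in> span (Bs i)" using assms(1) by (simp only: span_Bs)
  show "b \<notin> Bs i" using mem_Bs_iff[OF assms(2)] assms(3) by blast
qed (rule Bs_subset_BB)

lemma rep_hom_part:
  assumes x: "x \<in> super_carrier A" and b: "b \<in> BB"
  shows "rep (hom_part A i x) b = (if par b = i then rep x b else 0)"
proof (cases "par b = i")
  case True
  have "rep (x - hom_part A i x) b = 0"
    using rep_hom[OF hom_part_in(2)[OF x] b, of i] True by simp
  moreover have "hom_part A i x \<in> super_carrier A"
    using hom_part_in(1)[OF x] part_subset_super_carrier by blast
  ultimately show ?thesis using True x by (simp add: rep_diff)
qed (simp add: rep_hom[OF hom_part_in(1)[OF x] b])

section \<open>Coordinate functionals and basis words\<close>

definition ent :: "'a mat \<Rightarrow> 'a \<times> nat \<times> nat \<Rightarrow> 'k" where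
  "ent X = (\<lambda>(b, r, s). rep (X $$ (r, s)) b)"

definition tri_letters :: "nat \<Rightarrow> ('a \<times> nat \<times> nat) set" where
  "tri_letters n = BB \<times> {..<n} \<times> {..<n}"

definition tri_lists :: "nat \<Rightarrow> nat \<Rightarrow> ('a \<times> nat \<times> nat) list set" where
  "tri_lists n d = {ts. length ts = d \<and> set ts \<subseteq> tri_letters n}"

definition coordw :: "nat \<Rightarrow> ('a \<times> nat \<times> nat) list \<Rightarrow> 'a mat list \<Rightarrow> 'k" where
  "coordw d ts w = (\<Prod>k<d. ent (w ! k) (ts ! k))"

definition coord :: "nat \<Rightarrow> ('a \<times> nat \<times> nat) list \<Rightarrow> ('a mat list \<Rightarrow>\<^sub>0 'k) \<Rightarrow> 'k" where
  "coord d ts = sext (coordw d ts)"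

lemma ent_add:
  assumes "X \<in> super_mats A n" "Y \<in> super_mats A n" "t \<in> tri_letters n"
  shows "ent (X + Y) t = ent X t + ent Y t"
  using assms by (auto simp: ent_def tri_letters_def super_mats_iff rep_add)

lemma ent_scale:
  assumes "X \<in> super_mats A n" "t \<in> tri_letters n"
  shows "ent (map_mat (scale c) X) t = c * ent X t"
  using assms by (auto simp: ent_def tri_letters_def super_mats_iff rep_scale)

lemma ent_hom_part:
  assumes "X \<in> super_mats A n" "t \<in> tri_letters n"
  shows "ent (map_mat (hom_part A i) X) t = (if par (fst t) = i then ent X t else 0)"
  using assms by (auto simp: ent_def tri_letters_def super_mats_iff rep_hom_part)

lemma ent_elem_mat:
  assumes "t \<in> tri_letters n" "fst u \<in> super_carrier A"
  shows "ent (case u of (b, r, s) \<Rightarrow> elem_mat n b r s) t =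
    (if snd u = snd t then rep (fst u) (fst t) else 0)"
  using assms by (auto simp: ent_def tri_letters_def elem_mat_def split: prod.splits)

lemma ent_basis:
  assumes "t \<in> tri_letters n" "u \<in> tri_letters n"
  shows "ent (case u of (b, r, s) \<Rightarrow> elem_mat n b r s) t = (if t = u then 1 else 0)"
proof -
  have "fst u \<in> BB" using assms(2) by (auto simp: tri_letters_def)
  then show ?thesis
    using assms(1) BB_subset by (subst ent_elem_mat) (auto simp: rep_basis prod_eq_iff)
qed

lemma tri_lists_nth: "ts \<in> tri_lists n d \<Longrightarrow> k < d \<Longrightarrow> ts ! k \<in> tri_letters n"
  by (auto simp: tri_lists_def)

lemma tri_lists_length: "ts \<in> tri_lists n d \<Longrightarrow> length ts = d"
  by (auto simp: tri_lists_def)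

lemma permute_tri_lists: "ts \<in> tri_lists n d \<Longrightarrow> \<sigma> permutes {..<d} \<Longrightarrow> permute_list \<sigma> ts \<in> tri_lists n d"
  by (auto simp: tri_lists_def)

lemma tword_nth: "length ts = d \<Longrightarrow> k < d \<Longrightarrow> tword n ts ! k = (case ts ! k of (b, r, s) \<Rightarrow> elem_mat n b r s)"
  by (simp add: tword_def)

lemma set_tword_subset:
  assumes "set ts \<subseteq> tri_letters n"
  shows "set (tword n ts) \<subseteq> super_mats A n"
  using assms BB_subset by (auto simp: tword_def tri_letters_def intro!: elem_mat_in_super_mats)

lemma tword_in_words: "ts \<in> tri_lists n d \<Longrightarrow> tword n ts \<in> words A n d"
  using set_tword_subset[of ts n] by (simp add: tri_lists_def words_def) (simp add: tword_def)

text \<open>Basis words and coordinate functionals are dual to each other. This yields injectivity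
  of \<open>tword\<close> and, below, independence of the basis words modulo the relations.\<close>

lemma coordw_tword:
  assumes ts: "ts \<in> tri_lists n d" and us: "us \<in> tri_lists n d"
  shows "coordw d ts (tword n us) = (if ts = us then 1 else 0)"
proof -
  have "coordw d ts (tword n us) = (\<Prod>k<d. if ts ! k = us ! k then 1 else 0)"
    unfolding coordw_def
  proof (rule prod.cong[OF refl])
    fix k assume "k \<in> {..<d}"
    then have k: "k < d" by simp
    show "ent (tword n us ! k) (ts ! k) = (if ts ! k = us ! k then 1 else 0)"
      by (subst tword_nth[OF tri_lists_length[OF us] k])
        (rule ent_basis[OF tri_lists_nth[OF ts k] tri_lists_nth[OF us k]])
  qed
  also have "\<dots> = (if ts = us then 1 else 0)"
  proof (cases "ts = us")
    case False
    then obtain k where "k < d" "ts ! k \<noteq> us ! k"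
      using tri_lists_length[OF ts] tri_lists_length[OF us] by (auto simp: list_eq_iff_nth_eq)
    then show ?thesis using False by (auto intro!: prod_zero)
  qed simp
  finally show ?thesis .
qed

lemma inj_on_tword: "inj_on (tword n) (tri_lists n d)"
proof (rule inj_onI)
  fix ts us assume *: "ts \<in> tri_lists n d" "us \<in> tri_lists n d" "tword n ts = tword n us"
  have "coordw d ts (tword n us) = 1" using coordw_tword[OF *(1,1)] *(3) by simp
  then show "ts = us" using coordw_tword[OF *(1,2)] by (auto split: if_splits)
qed

lemma coord_rels:
  assumes "ts \<in> tri_lists n d" "f \<in> multilin_rels scale A n d"
  shows "coord d ts f = 0"
  unfolding coord_def coordw_def
  using tri_lists_nth[OF assms(1)]
  by (intro sext_multilinear_rels[OF assms(2)]) (auto intro: ent_add ent_scale)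

lemma coord_add: "coord d ts (f + g) = coord d ts f + coord d ts g"
  by (simp add: coord_def sext_add)

lemma coord_diff: "coord d ts (f - g) = coord d ts f - coord d ts g"
  by (simp add: coord_def sext_diff)

lemma coord_fscale: "coord d ts (fscale c f) = c * coord d ts f"
  by (simp add: coord_def sext_fscale)

lemma coord_zero [simp]: "coord d ts 0 = 0"
  by (simp add: coord_def)

lemma coord_sum: "coord d ts (sum f S) = (\<Sum>x\<in>S. coord d ts (f x))"
  by (simp add: coord_def sext_sum)

text \<open>The prefix \<open>us\<close> already consists of basis letters, and the induction runs
  over the suffix \<open>v\<close> still to be expanded. Each step expands one matrix
  \<open>X\<close>, modulo the relations, into basis matrices.\<close>

lemma single_mem_expansion:
  assumes "set us \<subseteq> tri_letters n" "set v \<subseteq> super_mats A n" "length us + length v = d"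
  shows "Poly_Mapping.single (tword n us @ v) 1 \<in>
    {g + h | g h :: 'a mat list \<Rightarrow>\<^sub>0 'k. Poly_Mapping.keys g \<subseteq> tword n ` tri_lists n d \<and> h \<in> multilin_rels scale A n d}"
    (is "_ \<in> ?M")
  using assms
proof (induction v arbitrary: us)
  case Nil
  then have "Poly_Mapping.single (tword n us) 1 + 0 \<in> ?M"
    using fs.subspace_0[OF subspace_multilin_rels] by (intro CollectI exI conjI) (auto simp: tri_lists_def)
  then show ?case by simp
next
  case (Cons X v)
  let ?R = "multilin_rels scale A n d :: ('a mat list \<Rightarrow>\<^sub>0 'k) set"
  have M: "fs.subspace ?M"
  proof -
    have "?M = fs.span ({g. Poly_Mapping.keys g \<subseteq> tword n ` tri_lists n d} \<union> ?R)"
      by (simp add: fs.span_Un fs.span_eq_iff[THEN iffD2, OF subspace_keys]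
          fs.span_eq_iff[THEN iffD2, OF subspace_multilin_rels])
    then show ?thesis by simp
  qed
  have RM: "?R \<subseteq> ?M"
  proof
    fix h assume "h \<in> ?R"
    then have "0 + h \<in> ?M" by (intro CollectI exI conjI) auto
    then show "h \<in> ?M" by simp
  qed
  \<comment> \<open>\<open>P Z\<close> says that the claim holds with \<open>Z\<close> in place of
    \<open>X\<close>. The relations make \<open>P\<close> closed under sums and scalar multiples,
    and the induction hypothesis gives it for basis matrices.\<close>
  define P where "P Z \<longleftrightarrow> Poly_Mapping.single (tword n us @ Z # v) (1::'k) \<in> ?M" for Z
  have word: "tword n us @ Z # v \<in> words A n d" if "Z \<in> super_mats A n" for Z
    using that Cons.prems set_tword_subset[of us n] by (simp add: words_append_iff) (simp add: tword_def)
  have P_add: "P (Y + Z)" if "P Y" "P Z" "Y \<in> super_mats A n" "Z \<in> super_mats A n" for Y Z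
  proof -
    let ?r = "Poly_Mapping.single (tword n us @ (Y + Z) # v) 1 - Poly_Mapping.single (tword n us @ Y # v) 1
      - Poly_Mapping.single (tword n us @ Z # v) (1::'k)"
    have "?r \<in> ?R" unfolding multilin_rels_def
      using word that by (intro fs.span_base UnI1) blast
    then have "?r \<in> ?M" using RM by blast
    then have "?r + Poly_Mapping.single (tword n us @ Y # v) 1 + Poly_Mapping.single (tword n us @ Z # v) 1 \<in> ?M"
      using that unfolding P_def by (intro fs.subspace_add[OF M])
    moreover have "?r + Poly_Mapping.single (tword n us @ Y # v) 1 + Poly_Mapping.single (tword n us @ Z # v) 1 =
        Poly_Mapping.single (tword n us @ (Y + Z) # v) 1" by simp
    ultimately show ?thesis unfolding P_def by (simp only:)
  qed
  have P_scale: "P (map_mat (scale c) Z)" if "P Z" "Z \<in> super_mats A n" for c Z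
  proof -
    let ?r = "Poly_Mapping.single (tword n us @ map_mat (scale c) Z # v) 1 - Poly_Mapping.single (tword n us @ Z # v) c"
    have "?r \<in> ?R" unfolding multilin_rels_def
      using word that by (intro fs.span_base UnI2) blast
    then have "?r \<in> ?M" using RM by blast
    moreover have eq: "Poly_Mapping.single (tword n us @ Z # v) c = fscale c (Poly_Mapping.single (tword n us @ Z # v) 1)"
      by (rule poly_mapping_eqI) (simp add: lookup_fscale lookup_single when_def)
    have "Poly_Mapping.single (tword n us @ Z # v) c \<in> ?M"
      unfolding eq using that(1) unfolding P_def by (rule fs.subspace_scale[OF M])
    ultimately have "?r + Poly_Mapping.single (tword n us @ Z # v) c \<in> ?M"
      by (rule fs.subspace_add[OF M])
    then show ?thesis unfolding P_def by (simp only: diff_add_cancel)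
  qed
  \<comment> \<open>The scalar relation with the scalar 0 puts the word containing a zero matrix
    among the relations.\<close>
  have P_zero: "P (0\<^sub>m n n)"
  proof -
    have "map_mat (scale 0) (0\<^sub>m n n) = (0\<^sub>m n n :: 'a mat)" by (rule eq_matI) auto
    moreover have "0\<^sub>m n n \<in> super_mats A n"
      using subspace_0[OF subspace_super_carrier] by (simp add: super_mats_iff)
    ultimately have "Poly_Mapping.single (tword n us @ 0\<^sub>m n n # v) 1 -
        Poly_Mapping.single (tword n us @ 0\<^sub>m n n # v) 0 \<in> ?R"
      unfolding multilin_rels_def using word
      by (intro fs.span_base UnI2 CollectI exI[of _ "tword n us"] exI[of _ v] exI[of _ "0\<^sub>m n n"] exI[of _ 0])
        simp
    then show ?thesis using RM unfolding P_def by auto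
  qed
  have P_basis: "P (elem_mat n b r s)" if "b \<in> BB" "r < n" "s < n" for b r s
  proof -
    have eq: "tword n us @ elem_mat n b r s # v = tword n (us @ [(b, r, s)]) @ v"
      by (simp add: tword_def)
    show ?thesis unfolding P_def eq
      by (rule Cons.IH) (use Cons.prems that in \<open>auto simp: tri_letters_def\<close>)
  qed
  have P_elem: "P (elem_mat n x r s)" if "x \<in> super_carrier A" "r < n" "s < n" for x r s
  proof -
    have "x \<in> super_carrier A \<and> P (elem_mat n x r s)"
    proof (rule span_induct[of x BB "\<lambda>x. x \<in> super_carrier A \<and> P (elem_mat n x r s)"])
      show "x \<in> span BB" using that by (simp add: super_carrier_eq_span)
      show "subspace {x. x \<in> super_carrier A \<and> P (elem_mat n x r s)}"
      proof (rule subspaceI)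
        have "elem_mat n (0::'a) r s = 0\<^sub>m n n" by (rule eq_matI) (auto simp: elem_mat_def)
        then show "0 \<in> {x. x \<in> super_carrier A \<and> P (elem_mat n x r s)}"
          using P_zero subspace_0[OF subspace_super_carrier] by simp
      next
        fix y z assume "y \<in> {x. x \<in> super_carrier A \<and> P (elem_mat n x r s)}"
          "z \<in> {x. x \<in> super_carrier A \<and> P (elem_mat n x r s)}"
        moreover have "elem_mat n (y + z) r s = elem_mat n y r s + elem_mat n z r s"
          by (rule eq_matI) (auto simp: elem_mat_def)
        ultimately show "y + z \<in> {x. x \<in> super_carrier A \<and> P (elem_mat n x r s)}"
          using subspace_add[OF subspace_super_carrier]
          by (auto intro!: P_add elem_mat_in_super_mats)
      next
        fix c y assume "y \<in> {x. x \<in> super_carrier A \<and> P (elem_mat n x r s)}"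
        moreover have "elem_mat n (scale c y) r s = map_mat (scale c) (elem_mat n y r s)"
          by (rule eq_matI) (auto simp: elem_mat_def)
        ultimately show "scale c y \<in> {x. x \<in> super_carrier A \<and> P (elem_mat n x r s)}"
          using subspace_scale[OF subspace_super_carrier]
          by (auto intro!: P_scale elem_mat_in_super_mats)
      qed
    qed (use P_basis that BB_subset in auto)
    then show ?thesis ..
  qed
  have X: "X \<in> super_mats A n" using Cons.prems by simp
  \<comment> \<open>\<open>X\<close> with the entries outside \<open>S\<close> replaced by 0.
    Enlarging \<open>S\<close> by one index pair adds a single-entry matrix, so additivity of
    \<open>P\<close> leads up to \<open>X\<close>.\<close>
  define cut where "cut S = mat n n (\<lambda>(i, j). if (i, j) \<in> S then X $$ (i, j) else 0)" for S
  have cut_in: "cut S \<in> super_mats A n" for S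
    using X subspace_0[OF subspace_super_carrier] by (auto simp: super_mats_iff cut_def)
  have "P (cut S)" if "finite S" "S \<subseteq> {..<n} \<times> {..<n}" for S
    using that
  proof (induction S rule: finite_induct)
    case empty
    have "cut {} = 0\<^sub>m n n" by (rule eq_matI) (auto simp: cut_def)
    then show ?case using P_zero by simp
  next
    case (insert t S)
    obtain r s where t: "t = (r, s)" by (cases t)
    have rs: "r < n" "s < n" "(r, s) \<notin> S" using insert t by auto
    then have Xrs: "X $$ (r, s) \<in> super_carrier A" using X by (simp add: super_mats_iff)
    have "cut (insert t S) = elem_mat n (X $$ (r, s)) r s + cut S"
      using rs by (intro eq_matI) (auto simp: cut_def elem_mat_def t)
    then show ?case
      using insert P_elem[OF Xrs rs(1,2)] cut_in elem_mat_in_super_mats[OF Xrs] by (auto intro!: P_add)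
  qed
  moreover have "cut ({..<n} \<times> {..<n}) = X"
    using X by (intro eq_matI) (auto simp: cut_def super_mats_iff)
  ultimately have "P X" by (metis finite_SigmaI finite_lessThan order_refl)
  then show ?case by (simp add: P_def)
qed

lemma word_module_expansion:
  assumes "f \<in> word_module A n d"
  obtains g where "Poly_Mapping.keys g \<subseteq> tword n ` tri_lists n d" "f - g \<in> multilin_rels scale A n d"
proof -
  let ?M = "{g + h | g h :: 'a mat list \<Rightarrow>\<^sub>0 'k. Poly_Mapping.keys g \<subseteq> tword n ` tri_lists n d \<and> h \<in> multilin_rels scale A n d}"
  have "?M = fs.span ({g. Poly_Mapping.keys g \<subseteq> tword n ` tri_lists n d} \<union> multilin_rels scale A n d)"
    by (simp add: fs.span_Un fs.span_eq_iff[THEN iffD2, OF subspace_keys]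
        fs.span_eq_iff[THEN iffD2, OF subspace_multilin_rels])
  then have M: "fs.subspace ?M" by simp
  have f: "f = (\<Sum>w\<in>Poly_Mapping.keys f. fscale (Poly_Mapping.lookup f w) (Poly_Mapping.single w 1))"
    by (rule poly_mapping_eqI)
      (simp add: lookup_sum lookup_fscale lookup_single when_def sum.delta' not_in_keys_iff_lookup_eq_zero if_distrib cong: if_cong)
  have "Poly_Mapping.single w 1 \<in> ?M" if "w \<in> Poly_Mapping.keys f" for w
    using single_mem_expansion[of "[]" n w d] word_module_keys[OF assms that]
    by (simp add: tword_def words_def)
  then have "f \<in> ?M"
    by (subst f) (intro fs.subspace_sum[OF M] fs.subspace_scale[OF M])
  then obtain g h where "f = g + h" "Poly_Mapping.keys g \<subseteq> tword n ` tri_lists n d" "h \<in> multilin_rels scale A n d"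
    by blast
  then show thesis by (intro that[of g]) auto
qed

lemma coord_supported:
  assumes "Poly_Mapping.keys g \<subseteq> tword n ` tri_lists n d" "ts \<in> tri_lists n d"
  shows "coord d ts g = Poly_Mapping.lookup g (tword n ts)"
proof -
  let ?S = "insert (tword n ts) (Poly_Mapping.keys g)"
  have "coord d ts g = (\<Sum>w\<in>?S. Poly_Mapping.lookup g w * coordw d ts w)"
    unfolding coord_def by (rule sext_superset) auto
  also have "\<dots> = Poly_Mapping.lookup g (tword n ts) * coordw d ts (tword n ts)"
  proof (rule sum_eq_single)
    fix w assume w: "w \<in> ?S" "w \<noteq> tword n ts"
    then have "w \<in> tword n ` tri_lists n d" using assms(1) by blast
    then obtain us where "us \<in> tri_lists n d" "w = tword n us" by blast
    then show "Poly_Mapping.lookup g w * coordw d ts w = 0"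
      using w assms coordw_tword by auto
  qed auto
  finally show ?thesis using assms coordw_tword by simp
qed

text \<open>Modulo the relations, \<open>f\<close> is a combination \<open>g\<close> of basis words,
  and by duality the coefficients of \<open>g\<close> are the coordinates of \<open>f\<close>. Thus
  the coordinates separate tensors.\<close>

lemma mem_multilin_rels_iff:
  assumes "f \<in> word_module A n d"
  shows "f \<in> multilin_rels scale A n d \<longleftrightarrow> (\<forall>ts\<in>tri_lists n d. coord d ts f = 0)"
proof
  assume z: "\<forall>ts\<in>tri_lists n d. coord d ts f = 0"
  obtain g where g: "Poly_Mapping.keys g \<subseteq> tword n ` tri_lists n d" "f - g \<in> multilin_rels scale A n d"
    using word_module_expansion[OF assms] .
  have "Poly_Mapping.lookup g w = 0" if w: "w \<in> Poly_Mapping.keys g" for w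
  proof -
    obtain ts where ts: "ts \<in> tri_lists n d" "w = tword n ts" using g(1) w by blast
    then show ?thesis using coord_supported[OF g(1) ts(1)] coord_rels[OF ts(1) g(2)] z by (simp add: coord_diff)
  qed
  then have "g = 0" by (metis in_keys_iff keys_eq_empty equals0I)
  then show "f \<in> multilin_rels scale A n d" using g(2) by simp
qed (use coord_rels in blast)

text \<open>The basis may be infinite, and so may \<open>tri_lists n d\<close>; finiteness comes
  from the finitely many basis words in an expansion. It permits sums over coordinates and induction
  on the size of the support.\<close>

lemma finite_coord_support:
  assumes "f \<in> word_module A n d"
  shows "finite {ts \<in> tri_lists n d. coord d ts f \<noteq> 0}"
proof -
  obtain g where g: "Poly_Mapping.keys g \<subseteq> tword n ` tri_lists n d" "f - g \<in> multilin_rels scale A n d"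
    using word_module_expansion[OF assms] .
  have "coord d ts f = Poly_Mapping.lookup g (tword n ts)" if "ts \<in> tri_lists n d" for ts
    using coord_supported[OF g(1) that] coord_rels[OF that g(2)] by (simp add: coord_diff)
  then have "tword n ` {ts \<in> tri_lists n d. coord d ts f \<noteq> 0} \<subseteq> Poly_Mapping.keys g"
    by (auto simp: in_keys_iff)
  then have "finite (tword n ` {ts \<in> tri_lists n d. coord d ts f \<noteq> 0})"
    by (rule finite_subset) simp
  then show ?thesis
    by (rule finite_imageD) (rule inj_on_subset[OF inj_on_tword[of n d]], auto)
qed

text \<open>A functional that vanishes on the relations is determined by its values on basis words.
  Taking for \<open>\<phi>\<close> a coordinate with respect to another basis gives the formula for
  a change of basis.\<close>

lemma sext_expansion:
  assumes f: "f \<in> word_module A n d"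
    and \<phi>: "\<And>g. g \<in> multilin_rels scale A n d \<Longrightarrow> sext \<phi> g = 0"
  shows "sext \<phi> f = (\<Sum>ts | ts \<in> tri_lists n d \<and> coord d ts f \<noteq> 0. coord d ts f * \<phi> (tword n ts))"
proof -
  obtain g where g: "Poly_Mapping.keys g \<subseteq> tword n ` tri_lists n d" "f - g \<in> multilin_rels scale A n d"
    using word_module_expansion[OF f] .
  let ?S = "{ts. ts \<in> tri_lists n d \<and> coord d ts f \<noteq> 0}"
  have c: "coord d ts f = Poly_Mapping.lookup g (tword n ts)" if "ts \<in> tri_lists n d" for ts
    using coord_supported[OF g(1) that] coord_rels[OF that g(2)] by (simp add: coord_diff)
  have "Poly_Mapping.keys g = tword n ` ?S"
  proof
    show "Poly_Mapping.keys g \<subseteq> tword n ` ?S"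
    proof
      fix w assume w: "w \<in> Poly_Mapping.keys g"
      then obtain ts where ts: "ts \<in> tri_lists n d" "w = tword n ts" using g(1) by blast
      then show "w \<in> tword n ` ?S" using c[OF ts(1)] w by (auto simp: in_keys_iff)
    qed
  qed (use c in \<open>auto simp: in_keys_iff\<close>)
  then have "sext \<phi> g = (\<Sum>ts\<in>?S. Poly_Mapping.lookup g (tword n ts) * \<phi> (tword n ts))"
    unfolding sext_def by (simp add: sum.reindex inj_on_subset[OF inj_on_tword[of n d]] subset_iff)
  also have "\<dots> = (\<Sum>ts\<in>?S. coord d ts f * \<phi> (tword n ts))"
    using c by (intro sum.cong) auto
  finally show ?thesis using \<phi>[OF g(2)] by (simp add: sext_diff)
qed

section \<open>Parities and the signed permutation action in coordinates\<close>

definition pars :: "('a \<times> nat \<times> nat) list \<Rightarrow> bit list" where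
  "pars ts = map (\<lambda>t. par (fst t)) ts"

text \<open>A homogeneous component has coefficients only at basis elements of its own parity. Hence
  the sum over all parity choices in \<open>word_act\<close> contributes a single term to each
  coordinate, the one for \<open>pars ts\<close>.\<close>

lemma coordw_word_part:
  assumes w: "w \<in> words A n d" and p: "p \<in> parities d" and ts: "ts \<in> tri_lists n d"
  shows "coordw d ts (word_part A p w) = (if p = pars ts then coordw d ts w else 0)"
proof -
  have len: "length p = d" "length w = d" "length ts = d"
    using w p ts by (auto simp: words_def parities_def tri_lists_def)
  have "coordw d ts (word_part A p w) = (\<Prod>k<d. if pars ts ! k = p ! k then ent (w ! k) (ts ! k) else 0)"
    unfolding coordw_def
    using words_nth[OF w] tri_lists_nth[OF ts] len
    by (intro prod.cong refl) (simp add: word_part_nth ent_hom_part[of _ n] pars_def)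
  also have "\<dots> = (if p = pars ts then coordw d ts w else 0)"
  proof (cases "p = pars ts")
    case False
    then obtain k where "k < d" "p ! k \<noteq> pars ts ! k"
      using len by (auto simp: list_eq_iff_nth_eq pars_def)
    then have "\<exists>k\<in>{..<d}. (if pars ts ! k = p ! k then ent (w ! k) (ts ! k) else 0) = 0"
      by (intro bexI[of _ k]) auto
    then have "(\<Prod>k<d. if pars ts ! k = p ! k then ent (w ! k) (ts ! k) else 0) = 0"
      by (rule prod_zero[OF finite_lessThan])
    then show ?thesis using False by simp
  qed (simp add: coordw_def)
  finally show ?thesis .
qed

lemma coordw_permute:
  assumes "\<sigma> permutes {..<d}" "length w = d" "length ts = d"
  shows "coordw d (permute_list \<sigma> ts) (permute_list \<sigma> w) = coordw d ts w"
proof -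
  have "coordw d (permute_list \<sigma> ts) (permute_list \<sigma> w) = (\<Prod>k<d. ent (w ! \<sigma> k) (ts ! \<sigma> k))"
    unfolding coordw_def using assms by (intro prod.cong) (auto simp: permute_list_nth)
  also have "\<dots> = coordw d ts w"
    unfolding coordw_def using prod.permute[OF assms(1), of "\<lambda>k. ent (w ! k) (ts ! k)"] by (simp add: o_def)
  finally show ?thesis .
qed

lemma coord_word_act:
  assumes w: "w \<in> words A n d" and s: "\<sigma> permutes {..<d}" and ts: "ts \<in> tri_lists n d"
  shows "coord d (permute_list \<sigma> ts) (word_act A d \<sigma> w) =
    (- 1) ^ perm_sign_exp d \<sigma> (pars ts) * coordw d ts w"
proof -
  have len: "length w = d" "length ts = d"
    using w ts by (auto simp: words_def tri_lists_def)
  have "coord d (permute_list \<sigma> ts) (word_act A d \<sigma> w) =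
    (\<Sum>p\<in>parities d. (- 1) ^ perm_sign_exp d \<sigma> p * coordw d ts (word_part A p w))"
    unfolding word_act_def coord_def sext_sum
    using s len by (intro sum.cong refl) (auto simp: coordw_permute parities_def)
  also have "\<dots> = (- 1) ^ perm_sign_exp d \<sigma> (pars ts) * coordw d ts (word_part A (pars ts) w)"
    by (rule sum_eq_single[OF finite_parities])
      (use ts len in \<open>auto simp: parities_def pars_def coordw_word_part[OF w]\<close>)
  also have "\<dots> = (- 1) ^ perm_sign_exp d \<sigma> (pars ts) * coordw d ts w"
    by (subst coordw_word_part[OF w _ ts]) (auto simp: parities_def pars_def len)
  finally show ?thesis .
qed

lemma coord_act:
  assumes f: "f \<in> word_module A n d" and s: "\<sigma> permutes {..<d}" and ts: "ts \<in> tri_lists n d"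
  shows "coord d (permute_list \<sigma> ts) (lin_ext (word_act A d \<sigma>) f) =
    (- 1) ^ perm_sign_exp d \<sigma> (pars ts) * coord d ts f"
proof -
  have "coord d (permute_list \<sigma> ts) (lin_ext (word_act A d \<sigma>) f) =
    sext (\<lambda>w. coord d (permute_list \<sigma> ts) (word_act A d \<sigma> w)) f"
    by (simp add: coord_def sext_lin_ext)
  also have "\<dots> = sext (\<lambda>w. (- 1) ^ perm_sign_exp d \<sigma> (pars ts) * coordw d ts w) f"
    using word_module_keys[OF f] s ts by (intro sext_cong coord_word_act)
  also have "\<dots> = (- 1) ^ perm_sign_exp d \<sigma> (pars ts) * coord d ts f"
    by (simp add: sext_def coord_def sum_distrib_left mult.left_commute)
  finally show ?thesis .
qed

end

section \<open>Action and multiplication in coordinates\<close>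

lemma sext_fun_sum: "sext (\<lambda>w. \<Sum>i\<in>I. \<phi> i w) f = (\<Sum>i\<in>I. sext (\<phi> i) f)"
  unfolding sext_def by (subst sum.swap) (simp add: sum_distrib_left)

lemma sext_fun_scale: "sext (\<lambda>w. c * \<phi> w) f = c * sext \<phi> f"
  by (simp add: sext_def sum_distrib_left mult.left_commute)

lemma sext_swap: "sext (\<lambda>x. sext (\<lambda>y. M x y) g) f = sext (\<lambda>y. sext (\<lambda>x. M x y) f) g"
  unfolding sext_def sum_distrib_left by (subst sum.swap) (simp add: mult.left_commute)

definition diag :: "nat \<Rightarrow> 'a::ring \<Rightarrow> 'a mat" where
  "diag n e = mat n n (\<lambda>(i, j). if i = j then e else 0)"

lemma diag_carrier [simp]: "diag n e \<in> carrier_mat n n"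
  by (simp add: diag_def)

lemma mult_mat_index:
  assumes "X \<in> carrier_mat n n" "Y \<in> carrier_mat n n" "r < n" "s < n"
  shows "(X * Y) $$ (r, s) = (\<Sum>j<n. X $$ (r, j) * Y $$ (j, s))"
  using assms by (auto simp: scalar_prod_def lessThan_atLeast0 intro!: sum.cong)

lemma diag_mult_index:
  assumes "X \<in> carrier_mat n n" "r < n" "s < n"
  shows "(diag n e * X) $$ (r, s) = e * X $$ (r, s)"
proof -
  have "(diag n e * X) $$ (r, s) = (\<Sum>j<n. diag n e $$ (r, j) * X $$ (j, s))"
    by (rule mult_mat_index) (use assms in auto)
  also have "\<dots> = diag n e $$ (r, r) * X $$ (r, s)"
    by (rule sum_eq_single) (use assms in \<open>auto simp: diag_def\<close>)
  finally show ?thesis using assms by (simp add: diag_def)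
qed

lemma mult_diag_index:
  assumes "X \<in> carrier_mat n n" "r < n" "s < n"
  shows "(X * diag n e) $$ (r, s) = X $$ (r, s) * e"
proof -
  have "(X * diag n e) $$ (r, s) = (\<Sum>j<n. X $$ (r, j) * diag n e $$ (j, s))"
    by (rule mult_mat_index) (use assms in auto)
  also have "\<dots> = X $$ (r, s) * diag n e $$ (s, s)"
    by (rule sum_eq_single) (use assms in \<open>auto simp: diag_def\<close>)
  finally show ?thesis using assms by (simp add: diag_def)
qed

definition matmap :: "('a mat \<Rightarrow> 'a mat) \<Rightarrow> ('a mat list \<Rightarrow>\<^sub>0 'k::comm_ring_1) \<Rightarrow> ('a mat list \<Rightarrow>\<^sub>0 'k)" where
  "matmap F = lin_ext (\<lambda>w. Poly_Mapping.single (map F w) 1)"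

definition wmult :: "(bit \<Rightarrow> 'a::ring set) \<Rightarrow> nat \<Rightarrow> ('a mat list \<Rightarrow>\<^sub>0 'k::comm_ring_1) \<Rightarrow>
    ('a mat list \<Rightarrow>\<^sub>0 'k) \<Rightarrow> ('a mat list \<Rightarrow>\<^sub>0 'k)" where
  "wmult A d f g = lin_ext (\<lambda>x. lin_ext (word_mult A d x) g) f"

context superalgebra
begin

lemma super_carrier_mult:
  assumes "x \<in> super_carrier A" "y \<in> super_carrier A"
  shows "x * y \<in> super_carrier A"
proof -
  obtain x0 x1 y0 y1 where xy: "x = x0 + x1" "x0 \<in> A 0" "x1 \<in> A 1" "y = y0 + y1" "y0 \<in> A 0" "y1 \<in> A 1"
    using assms by (auto simp: super_carrier_def)
  have "x * y = (x0 * y0 + x1 * y1) + (x0 * y1 + x1 * y0)"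
    by (simp add: xy algebra_simps)
  moreover have "x0 * y0 + x1 * y1 \<in> A 0" "x0 * y1 + x1 * y0 \<in> A 1"
    using mult_part[OF xy(2,5)] mult_part[OF xy(3,6)] mult_part[OF xy(2,6)] mult_part[OF xy(3,5)]
    by (auto intro!: subspace_add[OF subspace_part])
  ultimately show ?thesis unfolding super_carrier_def by blast
qed

lemma super_mats_mult: "X \<in> super_mats A n \<Longrightarrow> Y \<in> super_mats A n \<Longrightarrow> X * Y \<in> super_mats A n"
  unfolding super_mats_iff
  by (auto simp del: index_mult_mat simp: mult_mat_index
      intro!: subspace_sum[OF subspace_super_carrier] super_carrier_mult)

lemma diag_in_super_mats: "e \<in> super_carrier A \<Longrightarrow> diag n e \<in> super_mats A n"
  using subspace_0[OF subspace_super_carrier] by (auto simp: super_mats_iff diag_def)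

lemma hom_part_add:
  assumes "x \<in> super_carrier A" "y \<in> super_carrier A"
  shows "hom_part A i (x + y) = hom_part A i x + hom_part A i y"
proof (rule hom_part_eqI)
  have "(x - hom_part A i x) + (y - hom_part A i y) \<in> A (i + 1)"
    using hom_part_in(2) assms subspace_add[OF subspace_part] by blast
  then show "x + y - (hom_part A i x + hom_part A i y) \<in> A (i + 1)" by (simp add: algebra_simps)
qed (use hom_part_in(1) assms subspace_add[OF subspace_part] in blast)

lemma hom_part_scale:
  assumes "x \<in> super_carrier A"
  shows "hom_part A i (scale c x) = scale c (hom_part A i x)"
proof (rule hom_part_eqI)
  have "scale c (x - hom_part A i x) \<in> A (i + 1)"
    using hom_part_in(2) assms subspace_scale[OF subspace_part] by blast
  then show "scale c x - scale c (hom_part A i x) \<in> A (i + 1)" by (simp add: scale_right_diff_distrib)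
qed (use hom_part_in(1) assms subspace_scale[OF subspace_part] in blast)

lemma hom_part_even_mult_left:
  assumes "x \<in> super_carrier A" "e \<in> A 0"
  shows "hom_part A i (e * x) = e * hom_part A i x"
proof (rule hom_part_eqI)
  show "e * hom_part A i x \<in> A i"
    using mult_part[OF assms(2) hom_part_in(1)[OF assms(1), of i]] by (simp only: add_0_left)
  show "e * x - e * hom_part A i x \<in> A (i + 1)"
    using mult_part[OF assms(2) hom_part_in(2)[OF assms(1), of i]] by (simp only: add_0_left right_diff_distrib)
qed

lemma hom_part_even_mult_right:
  assumes "x \<in> super_carrier A" "e \<in> A 0"
  shows "hom_part A i (x * e) = hom_part A i x * e"
proof (rule hom_part_eqI)
  show "hom_part A i x * e \<in> A i"
    using mult_part[OF hom_part_in(1)[OF assms(1), of i] assms(2)] by (simp only: add_0_right)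
  show "x * e - hom_part A i x * e \<in> A (i + 1)"
    using mult_part[OF hom_part_in(2)[OF assms(1), of i] assms(2)] by (simp only: add_0_right left_diff_distrib)
qed

lemma map_mat_hom_part_add:
  assumes "X \<in> super_mats A n" "Y \<in> super_mats A n"
  shows "map_mat (hom_part A i) (X + Y) = map_mat (hom_part A i) X + map_mat (hom_part A i) Y"
  using assms by (intro eq_matI) (auto simp: super_mats_iff hom_part_add)

lemma map_mat_hom_part_scale:
  assumes "X \<in> super_mats A n"
  shows "map_mat (hom_part A i) (map_mat (scale c) X) = map_mat (scale c) (map_mat (hom_part A i) X)"
  using assms by (intro eq_matI) (auto simp: super_mats_iff hom_part_scale)

lemma scale_mult_mat_left:
  assumes "X \<in> carrier_mat n n" "Y \<in> carrier_mat n n"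
  shows "map_mat (scale c) X * Y = map_mat (scale c) (X * Y)"
proof (rule eq_matI)
  fix r s assume "r < dim_row (map_mat (scale c) (X * Y))" "s < dim_col (map_mat (scale c) (X * Y))"
  then have rs: "r < n" "s < n" using assms by auto
  have "(map_mat (scale c) X * Y) $$ (r, s) = (\<Sum>j<n. map_mat (scale c) X $$ (r, j) * Y $$ (j, s))"
    using assms rs by (intro mult_mat_index) auto
  also have "\<dots> = scale c (\<Sum>j<n. X $$ (r, j) * Y $$ (j, s))"
    using assms rs by (simp add: scale_mult_left scale_sum_right)
  also have "\<dots> = map_mat (scale c) (X * Y) $$ (r, s)"
    using assms rs mult_mat_index[OF assms rs] by (simp del: index_mult_mat add: index_mult_mat(2,3))
  finally show "(map_mat (scale c) X * Y) $$ (r, s) = map_mat (scale c) (X * Y) $$ (r, s)" .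
qed (use assms in auto)

lemma scale_mult_mat_right:
  assumes "X \<in> carrier_mat n n" "Y \<in> carrier_mat n n"
  shows "X * map_mat (scale c) Y = map_mat (scale c) (X * Y)"
proof (rule eq_matI)
  fix r s assume "r < dim_row (map_mat (scale c) (X * Y))" "s < dim_col (map_mat (scale c) (X * Y))"
  then have rs: "r < n" "s < n" using assms by auto
  have "(X * map_mat (scale c) Y) $$ (r, s) = (\<Sum>j<n. X $$ (r, j) * map_mat (scale c) Y $$ (j, s))"
    using assms rs by (intro mult_mat_index) auto
  also have "\<dots> = scale c (\<Sum>j<n. X $$ (r, j) * Y $$ (j, s))"
    using assms rs by (simp add: scale_mult_right scale_sum_right)
  also have "\<dots> = map_mat (scale c) (X * Y) $$ (r, s)"
    using assms rs mult_mat_index[OF assms rs] by (simp del: index_mult_mat add: index_mult_mat(2,3))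
  finally show "(X * map_mat (scale c) Y) $$ (r, s) = map_mat (scale c) (X * Y) $$ (r, s)" .
qed (use assms in auto)

lemma super_mats_carrier: "X \<in> super_mats A n \<Longrightarrow> X \<in> carrier_mat n n"
  by (simp add: super_mats_iff)

lemma map2_mult_in_words:
  assumes "x \<in> words A n d" "y \<in> words A n d"
  shows "map2 (*) x y \<in> words A n d"
proof (rule words_nthI)
  have len: "length x = d" "length y = d" using assms by (auto simp: words_def)
  then show "length (map2 (*) x y) = d" by simp
  show "map2 (*) x y ! k \<in> super_mats A n" if "k < d" for k
    using that len words_nth[OF assms(1) that] words_nth[OF assms(2) that] by (simp add: super_mats_mult)
qed

lemma word_mult_in_word_module:
  assumes "x \<in> words A n d" "y \<in> words A n d"
  shows "word_mult A d x y \<in> word_module A n d"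
  unfolding word_mult_def
  by (intro fs.subspace_sum[OF subspace_word_module] single_in_word_module map2_mult_in_words
      word_part_in_words[OF assms(1)] word_part_in_words[OF assms(2)])

lemma wmult_in_word_module:
  assumes "f \<in> word_module A n d" "g \<in> word_module A n d"
  shows "wmult A d f g \<in> word_module A n d"
  unfolding wmult_def
  by (intro lin_ext_in_subspace[OF subspace_word_module] word_mult_in_word_module
      word_module_keys[OF assms(1)] word_module_keys[OF assms(2)])

lemma matmap_in_word_module:
  assumes "f \<in> word_module A n d" "\<And>X. X \<in> super_mats A n \<Longrightarrow> F X \<in> super_mats A' n"
  shows "matmap F f \<in> word_module A' n d"
proof -
  have "Poly_Mapping.single (map F w) 1 \<in> word_module A' n d" if "w \<in> Poly_Mapping.keys f" for w
    using word_module_keys[OF assms(1) that] assms(2) by (auto simp: word_module_def words_def)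
  then show ?thesis
    unfolding matmap_def by (intro lin_ext_in_subspace[OF subspace_word_module])
qed

end

section \<open>Action, invariants and product on tensor classes\<close>

context graded_basis
begin

lemma tensor_class_eq_iff_coord:
  assumes "f \<in> word_module A n d" "g \<in> word_module A n d"
  shows "tensor_class scale A n d f = tensor_class scale A n d g \<longleftrightarrow>
    (\<forall>ts\<in>tri_lists n d. coord d ts f = coord d ts g)"
  using mem_multilin_rels_iff[OF fs.subspace_diff[OF subspace_word_module assms]]
  by (simp add: tensor_class_eq_iff[OF assms] coord_diff)

lemma mem_tensor_class_iff_coord:
  assumes "f \<in> word_module A n d"
  shows "g \<in> tensor_class scale A n d f \<longleftrightarrow>
    g \<in> word_module A n d \<and> (\<forall>ts\<in>tri_lists n d. coord d ts f = coord d ts g)"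
proof -
  have "f - g \<in> multilin_rels scale A n d \<longleftrightarrow> (\<forall>ts\<in>tri_lists n d. coord d ts f = coord d ts g)"
    if "g \<in> word_module A n d"
    using mem_multilin_rels_iff[OF fs.subspace_diff[OF subspace_word_module assms that]]
    by (simp add: coord_diff)
  then show ?thesis by (auto simp: tensor_class_eq[OF assms])
qed

lemma tri_list_permuted:
  assumes "us \<in> tri_lists n d" "\<sigma> permutes {..<d}"
  obtains ts where "ts \<in> tri_lists n d" "us = permute_list \<sigma> ts"
proof
  let ?ts = "permute_list (inv_into UNIV \<sigma>) us"
  show "?ts \<in> tri_lists n d" using assms permutes_inv permute_tri_lists by blast
  have "permute_list (inv_into UNIV \<sigma> \<circ> \<sigma>) us = permute_list \<sigma> ?ts"
    using assms by (intro permute_list_compose) (simp add: tri_lists_length)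
  then show "us = permute_list \<sigma> ?ts" using permutes_inv_o(2)[OF assms(2)] by simp
qed

text \<open>The union over representatives collapses: by \<open>coord_act\<close> the coordinates
  after the action depend only on the coordinates before it.\<close>

lemma tensor_act_class:
  assumes f: "f \<in> word_module A n d" and s: "\<sigma> permutes {..<d}"
  shows "tensor_act scale A n d \<sigma> (tensor_class scale A n d f) =
    tensor_class scale A n d (lin_ext (word_act A d \<sigma>) f)"
proof -
  have "tensor_class scale A n d (lin_ext (word_act A d \<sigma>) g) = tensor_class scale A n d (lin_ext (word_act A d \<sigma>) f)"
    if "g \<in> tensor_class scale A n d f" for g
  proof -
    have g: "g \<in> word_module A n d" and c: "\<And>ts. ts \<in> tri_lists n d \<Longrightarrow> coord d ts f = coord d ts g"
      using that mem_tensor_class_iff_coord[OF f] by auto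
    have "coord d us (lin_ext (word_act A d \<sigma>) g) = coord d us (lin_ext (word_act A d \<sigma>) f)"
      if us: "us \<in> tri_lists n d" for us
      by (rule tri_list_permuted[OF us s]) (simp add: coord_act[OF f s] coord_act[OF g s] c)
    then show ?thesis
      using tensor_class_eq_iff_coord[OF lin_ext_word_act_in_word_module[OF g s]
          lin_ext_word_act_in_word_module[OF f s]] by simp
  qed
  moreover have "f \<in> tensor_class scale A n d f"
    using f by (simp add: mem_tensor_class_iff_coord)
  ultimately show ?thesis unfolding tensor_act_def by blast
qed

definition sym_coord :: "nat \<Rightarrow> nat \<Rightarrow> ('a mat list \<Rightarrow>\<^sub>0 'k) \<Rightarrow> bool" where
  "sym_coord n d f \<longleftrightarrow> (\<forall>\<sigma>. \<sigma> permutes {..<d} \<longrightarrow> (\<forall>ts\<in>tri_lists n d.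
    coord d (permute_list \<sigma> ts) f = (- 1) ^ perm_sign_exp d \<sigma> (pars ts) * coord d ts f))"

lemma sym_coordD:
  "sym_coord n d f \<Longrightarrow> \<sigma> permutes {..<d} \<Longrightarrow> ts \<in> tri_lists n d \<Longrightarrow>
    coord d (permute_list \<sigma> ts) f = (- 1) ^ perm_sign_exp d \<sigma> (pars ts) * coord d ts f"
  by (auto simp: sym_coord_def)

text \<open>Every triple list is a permuted one, so comparing coordinates before and after the
  action amounts to the sign rule. The left side mentions no basis; hence \<open>sym_coord\<close>
  passes from one homogeneous basis to any other.\<close>

lemma tensor_class_invariant_iff:
  assumes f: "f \<in> word_module A n d"
  shows "tensor_class scale A n d f \<in> invariant_algebra scale A n d \<longleftrightarrow> sym_coord n d f"
proof -
  have "tensor_act scale A n d \<sigma> (tensor_class scale A n d f) = tensor_class scale A n d f \<longleftrightarrow>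
    (\<forall>ts\<in>tri_lists n d. coord d (permute_list \<sigma> ts) f = (- 1) ^ perm_sign_exp d \<sigma> (pars ts) * coord d ts f)"
    (is "?l \<longleftrightarrow> ?r") if s: "\<sigma> permutes {..<d}" for \<sigma>
  proof -
    have "?l \<longleftrightarrow> (\<forall>us\<in>tri_lists n d. coord d us (lin_ext (word_act A d \<sigma>) f) = coord d us f)"
      unfolding tensor_act_class[OF f s]
      by (rule tensor_class_eq_iff_coord[OF lin_ext_word_act_in_word_module[OF f s] f])
    also have "\<dots> \<longleftrightarrow> (\<forall>ts\<in>tri_lists n d. coord d (permute_list \<sigma> ts) (lin_ext (word_act A d \<sigma>) f) =
        coord d (permute_list \<sigma> ts) f)"
      using tri_list_permuted[OF _ s] permute_tri_lists[OF _ s] by metis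
    also have "\<dots> \<longleftrightarrow> ?r" by (simp add: coord_act[OF f s] eq_commute)
    finally show ?thesis .
  qed
  then show ?thesis
    using f by (auto simp: invariant_algebra_def sym_coord_def tensor_power_eq)
qed

lemma invariant_algebra_eq:
  "invariant_algebra scale A n d = tensor_class scale A n d ` {f \<in> word_module A n d. sym_coord n d f}"
proof -
  have "invariant_algebra scale A n d \<subseteq> tensor_class scale A n d ` word_module A n d"
    by (auto simp: invariant_algebra_def tensor_power_eq)
  then show ?thesis using tensor_class_invariant_iff by blast
qed

lemma coord_word_mult:
  assumes "x \<in> words A n d" "y \<in> words A n d"
  shows "coord d ts (word_mult A d x y) = (\<Sum>p\<in>parities d. \<Sum>q\<in>parities d.
    (- 1) ^ card {(j, k). j < k \<and> k < d \<and> p ! k = 1 \<and> q ! j = 1} *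
      (\<Prod>k<d. ent (map_mat (hom_part A (p ! k)) (x ! k) * map_mat (hom_part A (q ! k)) (y ! k)) (ts ! k)))"
  unfolding coord_def word_mult_def sext_sum sext_single coordw_def
  using assms
  by (intro sum.cong refl arg_cong2[where f = "(*)"] prod.cong)
    (auto simp: words_def parities_def word_part_nth)

text \<open>For fixed \<open>x\<close> and fixed parities the sign is constant and each factor is
  linear in the corresponding letter of \<open>y\<close>, so the coordinate is a combination of
  functionals covered by \<open>sext_multilinear_rels\<close>.\<close>

lemma coord_word_mult_rels_right:
  assumes x: "x \<in> words A n d" and g: "g \<in> multilin_rels scale A n d" and ts: "ts \<in> tri_lists n d"
  shows "sext (\<lambda>y. coord d ts (word_mult A d x y)) g = 0"
proof -
  have gw: "y \<in> words A n d" if "y \<in> Poly_Mapping.keys g" for y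
    using that g multilin_rels_subset word_module_keys by blast
  have "sext (\<lambda>y. \<Prod>k<d. ent (map_mat (hom_part A (p ! k)) (x ! k) * map_mat (hom_part A (q ! k)) (y ! k)) (ts ! k)) g = 0"
    for p q
  proof (rule sext_multilinear_rels[OF g])
    fix k X Y assume k: "k < d" and X: "X \<in> super_mats A n" and Y: "Y \<in> super_mats A n"
    let ?Z = "map_mat (hom_part A (p ! k)) (x ! k)"
    have Z: "?Z \<in> super_mats A n" using words_nth[OF x k] by (rule super_mats_hom_part)
    have "?Z * map_mat (hom_part A (q ! k)) (X + Y) =
        ?Z * map_mat (hom_part A (q ! k)) X + ?Z * map_mat (hom_part A (q ! k)) Y"
      unfolding map_mat_hom_part_add[OF X Y]
      using super_mats_carrier[OF Z] super_mats_carrier[OF X] super_mats_carrier[OF Y]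
      by (intro mult_add_distrib_mat[of _ n n]) auto
    then show "ent (?Z * map_mat (hom_part A (q ! k)) (X + Y)) (ts ! k) =
        ent (?Z * map_mat (hom_part A (q ! k)) X) (ts ! k) + ent (?Z * map_mat (hom_part A (q ! k)) Y) (ts ! k)"
      using ent_add[OF super_mats_mult[OF Z super_mats_hom_part[OF X]]
          super_mats_mult[OF Z super_mats_hom_part[OF Y]] tri_lists_nth[OF ts k]] by simp
  next
    fix k X c assume k: "k < d" and X: "X \<in> super_mats A n"
    let ?Z = "map_mat (hom_part A (p ! k)) (x ! k)"
    have Z: "?Z \<in> super_mats A n" using words_nth[OF x k] by (rule super_mats_hom_part)
    have "?Z * map_mat (hom_part A (q ! k)) (map_mat (scale c) X) =
        map_mat (scale c) (?Z * map_mat (hom_part A (q ! k)) X)"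
      unfolding map_mat_hom_part_scale[OF X]
      using super_mats_carrier[OF Z] super_mats_carrier[OF X] by (intro scale_mult_mat_right[of _ n]) auto
    then show "ent (?Z * map_mat (hom_part A (q ! k)) (map_mat (scale c) X)) (ts ! k) =
        c * ent (?Z * map_mat (hom_part A (q ! k)) X) (ts ! k)"
      using ent_scale[OF super_mats_mult[OF Z super_mats_hom_part[OF X]] tri_lists_nth[OF ts k]] by simp
  qed
  then show ?thesis
    by (subst sext_cong[OF coord_word_mult[OF x gw]]) (simp_all add: sext_fun_sum sext_fun_scale)
qed

lemma coord_word_mult_rels_left:
  assumes y: "y \<in> words A n d" and f: "f \<in> multilin_rels scale A n d" and ts: "ts \<in> tri_lists n d"
  shows "sext (\<lambda>x. coord d ts (word_mult A d x y)) f = 0"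
proof -
  have fw: "x \<in> words A n d" if "x \<in> Poly_Mapping.keys f" for x
    using that f multilin_rels_subset word_module_keys by blast
  have "sext (\<lambda>x. \<Prod>k<d. ent (map_mat (hom_part A (p ! k)) (x ! k) * map_mat (hom_part A (q ! k)) (y ! k)) (ts ! k)) f = 0"
    for p q
  proof (rule sext_multilinear_rels[OF f])
    fix k X Y assume k: "k < d" and X: "X \<in> super_mats A n" and Y: "Y \<in> super_mats A n"
    let ?Z = "map_mat (hom_part A (q ! k)) (y ! k)"
    have Z: "?Z \<in> super_mats A n" using words_nth[OF y k] by (rule super_mats_hom_part)
    have "map_mat (hom_part A (p ! k)) (X + Y) * ?Z =
        map_mat (hom_part A (p ! k)) X * ?Z + map_mat (hom_part A (p ! k)) Y * ?Z"
      unfolding map_mat_hom_part_add[OF X Y]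
      using super_mats_carrier[OF Z] super_mats_carrier[OF X] super_mats_carrier[OF Y]
      by (intro add_mult_distrib_mat[of _ n n]) auto
    then show "ent (map_mat (hom_part A (p ! k)) (X + Y) * ?Z) (ts ! k) =
        ent (map_mat (hom_part A (p ! k)) X * ?Z) (ts ! k) + ent (map_mat (hom_part A (p ! k)) Y * ?Z) (ts ! k)"
      using ent_add[OF super_mats_mult[OF super_mats_hom_part[OF X] Z]
          super_mats_mult[OF super_mats_hom_part[OF Y] Z] tri_lists_nth[OF ts k]] by simp
  next
    fix k X c assume k: "k < d" and X: "X \<in> super_mats A n"
    let ?Z = "map_mat (hom_part A (q ! k)) (y ! k)"
    have Z: "?Z \<in> super_mats A n" using words_nth[OF y k] by (rule super_mats_hom_part)
    have "map_mat (hom_part A (p ! k)) (map_mat (scale c) X) * ?Z =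
        map_mat (scale c) (map_mat (hom_part A (p ! k)) X * ?Z)"
      unfolding map_mat_hom_part_scale[OF X]
      using super_mats_carrier[OF Z] super_mats_carrier[OF X] by (intro scale_mult_mat_left[of _ n]) auto
    then show "ent (map_mat (hom_part A (p ! k)) (map_mat (scale c) X) * ?Z) (ts ! k) =
        c * ent (map_mat (hom_part A (p ! k)) X * ?Z) (ts ! k)"
      using ent_scale[OF super_mats_mult[OF super_mats_hom_part[OF X] Z] tri_lists_nth[OF ts k]] by simp
  qed
  then show ?thesis
    by (subst sext_cong[OF coord_word_mult[OF fw y]]) (simp_all add: sext_fun_sum sext_fun_scale)
qed

lemma coord_wmult: "coord d ts (wmult A d f g) = sext (\<lambda>x. sext (\<lambda>y. coord d ts (word_mult A d x y)) g) f"
  by (simp add: wmult_def coord_def sext_lin_ext)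

text \<open>One factor is exchanged at a time. The iterated extension is written with the right
  factor innermost, and \<open>sext_swap\<close> reverses the order before the left factor is
  replaced.\<close>

lemma coord_wmult_cong:
  assumes f: "f \<in> word_module A n d" "f' \<in> word_module A n d" "f - f' \<in> multilin_rels scale A n d"
    and g: "g \<in> word_module A n d" "g' \<in> word_module A n d" "g - g' \<in> multilin_rels scale A n d"
    and ts: "ts \<in> tri_lists n d"
  shows "coord d ts (wmult A d f g) = coord d ts (wmult A d f' g')"
proof -
  let ?M = "\<lambda>x y. coord d ts (word_mult A d x y)"
  have "sext (\<lambda>x. sext (?M x) g) f = sext (\<lambda>x. sext (?M x) g') f"
  proof (rule sext_cong)
    fix x assume "x \<in> Poly_Mapping.keys f"
    then have "sext (?M x) (g - g') = 0"
      by (intro coord_word_mult_rels_right[OF _ g(3) ts] word_module_keys[OF f(1)])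
    then show "sext (?M x) g = sext (?M x) g'" by (simp add: sext_diff)
  qed
  also have "\<dots> = sext (\<lambda>y. sext (\<lambda>x. ?M x y) f) g'" by (rule sext_swap)
  also have "\<dots> = sext (\<lambda>y. sext (\<lambda>x. ?M x y) f') g'"
  proof (rule sext_cong)
    fix y assume "y \<in> Poly_Mapping.keys g'"
    then have "sext (\<lambda>x. ?M x y) (f - f') = 0"
      by (intro coord_word_mult_rels_left[OF _ f(3) ts] word_module_keys[OF g(2)])
    then show "sext (\<lambda>x. ?M x y) f = sext (\<lambda>x. ?M x y) f'" by (simp add: sext_diff)
  qed
  also have "\<dots> = sext (\<lambda>x. sext (?M x) g') f'" by (rule sext_swap)
  finally show ?thesis by (simp add: coord_wmult)
qed

lemma tensor_mult_class:
  assumes f: "f \<in> word_module A n d" and g: "g \<in> word_module A n d"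
  shows "tensor_mult scale A n d (tensor_class scale A n d f) (tensor_class scale A n d g) =
    tensor_class scale A n d (wmult A d f g)"
proof -
  have "tensor_class scale A n d (wmult A d f' g') = tensor_class scale A n d (wmult A d f g)"
    if "f' \<in> tensor_class scale A n d f" "g' \<in> tensor_class scale A n d g" for f' g'
  proof -
    have f': "f' \<in> word_module A n d" "f - f' \<in> multilin_rels scale A n d"
      and g': "g' \<in> word_module A n d" "g - g' \<in> multilin_rels scale A n d"
      using that by (auto simp: tensor_class_eq f g)
    show ?thesis
      using tensor_class_eq_iff_coord[OF wmult_in_word_module[OF f g] wmult_in_word_module[OF f'(1) g'(1)]]
        coord_wmult_cong[OF f f' g g'] by simp
  qed
  moreover have "f \<in> tensor_class scale A n d f" "g \<in> tensor_class scale A n d g"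
    using f g by (simp_all add: mem_tensor_class_iff_coord)
  ultimately show ?thesis unfolding tensor_mult_def wmult_def[symmetric] by blast
qed

lemma coord_matmap: "coord d ts (matmap F f) = sext (\<lambda>w. coordw d ts (map F w)) f"
  by (simp add: matmap_def coord_def sext_lin_ext)

text \<open>As \<open>e\<close> is even, multiplication by it preserves parity and commutes with
  taking homogeneous components.\<close>

lemma ent_diag_mult_hom_part:
  assumes "X \<in> super_mats A n" "e \<in> A 0"
  shows "diag n e * map_mat (hom_part A i) X = map_mat (hom_part A i) (diag n e * X)"
    "map_mat (hom_part A i) X * diag n e = map_mat (hom_part A i) (X * diag n e)"
proof -
  have X: "X \<in> carrier_mat n n" "map_mat (hom_part A i) X \<in> carrier_mat n n"
    and Xc: "\<And>r s. r < n \<Longrightarrow> s < n \<Longrightarrow> X $$ (r, s) \<in> super_carrier A"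
    using assms(1) by (auto simp: super_mats_iff)
  have dim: "dim_row (diag n e) = n" "dim_col (diag n e) = n" "dim_row X = n" "dim_col X = n"
    using X by (auto simp: diag_def)
  show "diag n e * map_mat (hom_part A i) X = map_mat (hom_part A i) (diag n e * X)"
    by (rule eq_matI)
      (use X Xc assms(2) in \<open>auto simp del: index_mult_mat(1) simp: dim diag_mult_index hom_part_even_mult_left\<close>)
  show "map_mat (hom_part A i) X * diag n e = map_mat (hom_part A i) (X * diag n e)"
    by (rule eq_matI)
      (use X Xc assms(2) in \<open>auto simp del: index_mult_mat(1) simp: dim mult_diag_index hom_part_even_mult_right\<close>)
qed

lemma map_mat_hom_part_diag:
  assumes "e \<in> A 0"
  shows "map_mat (hom_part A i) (diag n e) = (if i = 0 then diag n e else 0\<^sub>m n n)"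
proof -
  have "0 \<in> A 0" by (rule subspace_0[OF subspace_part])
  then show ?thesis using assms
    by (intro eq_matI) (auto simp: diag_def hom_part_hom[of _ 0])
qed

lemma ent_zero: "t \<in> tri_letters n \<Longrightarrow> ent (0\<^sub>m n n) t = 0"
  by (auto simp: ent_def tri_letters_def)

lemma sum_parities_coordw:
  assumes "w \<in> words A n d" "ts \<in> tri_lists n d"
  shows "(\<Sum>q\<in>parities d. coordw d ts (word_part A q w)) = coordw d ts w"
proof -
  have "pars ts \<in> parities d" using assms(2) by (simp add: parities_def pars_def tri_lists_def)
  then have "(\<Sum>q\<in>parities d. coordw d ts (word_part A q w)) = coordw d ts (word_part A (pars ts) w)"
    using assms by (intro sum_eq_single finite_parities) (auto simp: coordw_word_part)
  then show ?thesis using assms \<open>pars ts \<in> parities d\<close> by (simp add: coordw_word_part)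
qed

lemma prod_eq_zero_nth:
  assumes "p \<in> parities d" "p \<noteq> replicate d 0" "\<And>k. k < d \<Longrightarrow> p ! k = 1 \<Longrightarrow> (F k :: 'k) = 0"
  shows "(\<Prod>k<d. F k) = 0"
proof -
  obtain k where k: "k < d" "p ! k \<noteq> 0"
    using assms(1,2) by (auto simp: parities_def list_eq_iff_nth_eq)
  then have "p ! k = 1" by simp
  then have "F k = 0" using assms(3) k by blast
  then show ?thesis using k by (intro prod_zero) auto
qed

text \<open>All letters of the left factor are even, so only its zero parity list contributes; every
  pair counted in the sign exponent would need an odd letter there, so no sign occurs. What remains
  is letterwise multiplication, summed over the parities of \<open>y\<close>.\<close>

lemma coord_word_mult_diag_left:
  assumes y: "y \<in> words A n d" and e: "e \<in> A 0" and ts: "ts \<in> tri_lists n d"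
  shows "coord d ts (word_mult A d (replicate d (diag n e)) y) = coordw d ts (map ((*) (diag n e)) y)"
proof -
  have ec: "e \<in> super_carrier A" using e part_subset_super_carrier by blast
  have E: "replicate d (diag n e) \<in> words A n d"
    using diag_in_super_mats[OF ec] by (auto simp: words_def)
  have len: "length y = d" using y by (simp add: words_def)
  have my: "map ((*) (diag n e)) y \<in> words A n d"
    using len words_nth[OF y] diag_in_super_mats[OF ec] by (intro words_nthI) (auto simp: super_mats_mult)
  let ?P = "\<lambda>p q. \<Prod>k<d. ent (map_mat (hom_part A (p ! k)) (replicate d (diag n e) ! k) *
      map_mat (hom_part A (q ! k)) (y ! k)) (ts ! k)"
  have zero: "?P p q = 0" if "p \<in> parities d" "p \<noteq> replicate d 0" for p q
  proof (rule prod_eq_zero_nth[OF that])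
    fix k assume k: "k < d" "p ! k = 1"
    have "0\<^sub>m n n * map_mat (hom_part A (q ! k)) (y ! k) = 0\<^sub>m n n"
      using super_mats_carrier[OF words_nth[OF y k(1)]] by (intro left_mult_zero_mat) auto
    then show "ent (map_mat (hom_part A (p ! k)) (replicate d (diag n e) ! k) *
      map_mat (hom_part A (q ! k)) (y ! k)) (ts ! k) = 0"
      using k e ent_zero[OF tri_lists_nth[OF ts k(1)]] by (simp add: map_mat_hom_part_diag)
  qed
  have one: "?P (replicate d 0) q = coordw d ts (word_part A q (map ((*) (diag n e)) y))"
    if "q \<in> parities d" for q
    unfolding coordw_def using that len words_nth[OF y] e
    by (intro prod.cong refl)
      (auto simp: parities_def word_part_nth map_mat_hom_part_diag ent_diag_mult_hom_part)
  have sgn: "{(j, k). j < k \<and> k < d \<and> replicate d 0 ! k = (1::bit) \<and> q ! j = (1::bit)} = {}" for q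
    by auto
  have "coord d ts (word_mult A d (replicate d (diag n e)) y) =
    (\<Sum>p\<in>parities d. \<Sum>q\<in>parities d. (- 1) ^ card {(j, k). j < k \<and> k < d \<and> p ! k = 1 \<and> q ! j = 1} * ?P p q)"
    by (rule coord_word_mult[OF E y])
  also have "\<dots> = (\<Sum>q\<in>parities d. (- 1) ^ card {(j, k). j < k \<and> k < d \<and> replicate d 0 ! k = (1::bit) \<and> q ! j = 1} * ?P (replicate d 0) q)"
    using zero by (intro sum_eq_single finite_parities) (auto simp: parities_def)
  also have "\<dots> = (\<Sum>q\<in>parities d. coordw d ts (word_part A q (map ((*) (diag n e)) y)))"
    unfolding sgn using one by simp
  finally show ?thesis using sum_parities_coordw[OF my ts] by simp
qed

lemma coord_word_mult_diag_right:
  assumes x: "x \<in> words A n d" and e: "e \<in> A 0" and ts: "ts \<in> tri_lists n d"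
  shows "coord d ts (word_mult A d x (replicate d (diag n e))) = coordw d ts (map (\<lambda>X. X * diag n e) x)"
proof -
  have ec: "e \<in> super_carrier A" using e part_subset_super_carrier by blast
  have E: "replicate d (diag n e) \<in> words A n d"
    using diag_in_super_mats[OF ec] by (auto simp: words_def)
  have len: "length x = d" using x by (simp add: words_def)
  have mx: "map (\<lambda>X. X * diag n e) x \<in> words A n d"
    using len words_nth[OF x] diag_in_super_mats[OF ec] by (intro words_nthI) (auto simp: super_mats_mult)
  let ?P = "\<lambda>p q. \<Prod>k<d. ent (map_mat (hom_part A (p ! k)) (x ! k) *
      map_mat (hom_part A (q ! k)) (replicate d (diag n e) ! k)) (ts ! k)"
  have zero: "?P p q = 0" if "q \<in> parities d" "q \<noteq> replicate d 0" for p q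
  proof (rule prod_eq_zero_nth[OF that])
    fix k assume k: "k < d" "q ! k = 1"
    have "map_mat (hom_part A (p ! k)) (x ! k) * 0\<^sub>m n n = 0\<^sub>m n n"
      using super_mats_carrier[OF words_nth[OF x k(1)]] by (intro right_mult_zero_mat) auto
    then show "ent (map_mat (hom_part A (p ! k)) (x ! k) *
      map_mat (hom_part A (q ! k)) (replicate d (diag n e) ! k)) (ts ! k) = 0"
      using k e ent_zero[OF tri_lists_nth[OF ts k(1)]] by (simp add: map_mat_hom_part_diag)
  qed
  have one: "?P p (replicate d 0) = coordw d ts (word_part A p (map (\<lambda>X. X * diag n e) x))"
    if "p \<in> parities d" for p
    unfolding coordw_def using that len words_nth[OF x] e
    by (intro prod.cong refl)
      (auto simp: parities_def word_part_nth map_mat_hom_part_diag ent_diag_mult_hom_part)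
  have sgn: "{(j, k). j < k \<and> k < d \<and> p ! k = (1::bit) \<and> replicate d 0 ! j = (1::bit)} = {}" for p
    by auto
  have "coord d ts (word_mult A d x (replicate d (diag n e))) =
    (\<Sum>p\<in>parities d. \<Sum>q\<in>parities d. (- 1) ^ card {(j, k). j < k \<and> k < d \<and> p ! k = 1 \<and> q ! j = 1} * ?P p q)"
    by (rule coord_word_mult[OF x E])
  also have "\<dots> = (\<Sum>p\<in>parities d. (- 1) ^ card {(j, k). j < k \<and> k < d \<and> p ! k = 1 \<and> replicate d 0 ! j = (1::bit)} * ?P p (replicate d 0))"
    using zero by (intro sum.cong refl sum_eq_single finite_parities) (auto simp: parities_def)
  also have "\<dots> = (\<Sum>p\<in>parities d. coordw d ts (word_part A p (map (\<lambda>X. X * diag n e) x)))"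
    unfolding sgn using one by simp
  finally show ?thesis using sum_parities_coordw[OF mx ts] by simp
qed

text \<open>No signs arise on either side, so multiplying by \<open>\<xi>\<close> of
  \<open>e\<close> from both sides conjugates each letter of each word by the diagonal matrix of
  \<open>e\<close>.\<close>

lemma xi_corner_class:
  assumes f: "f \<in> word_module A n d" and e: "e \<in> A 0"
  shows "tensor_mult scale A n d (tensor_mult scale A n d (xi_idem scale A n d e) (tensor_class scale A n d f))
      (xi_idem scale A n d e) =
    tensor_class scale A n d (matmap (\<lambda>X. diag n e * X * diag n e) f)"
proof -
  have ec: "e \<in> super_carrier A" using e part_subset_super_carrier by blast
  note D = diag_in_super_mats[OF ec, of n]
  let ?x = "Poly_Mapping.single (replicate d (diag n e)) (1 :: 'k)"
  let ?l = "matmap ((*) (diag n e)) f"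
  let ?r = "matmap (\<lambda>X. X * diag n e) ?l"
  let ?c = "matmap (\<lambda>X. diag n e * X * diag n e) f"
  have x: "?x \<in> word_module A n d"
    using D by (intro single_in_word_module) (auto simp: words_def)
  have xi: "xi_idem scale A n d e = tensor_class scale A n d ?x"
    by (simp add: xi_idem_def diag_def)
  have l: "?l \<in> word_module A n d" by (intro matmap_in_word_module[OF f] super_mats_mult[OF D])
  have r: "?r \<in> word_module A n d" by (intro matmap_in_word_module[OF l] super_mats_mult[OF _ D])
  have c: "?c \<in> word_module A n d"
    by (intro matmap_in_word_module[OF f] super_mats_mult[OF _ D] super_mats_mult[OF D])
  have "coord d ts (wmult A d ?x f) = coord d ts ?l" if "ts \<in> tri_lists n d" for ts
    unfolding coord_wmult coord_matmap sext_single
    using coord_word_mult_diag_left[OF word_module_keys[OF f] e that] by (simp cong: sext_cong)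
  then have 1: "tensor_class scale A n d (wmult A d ?x f) = tensor_class scale A n d ?l"
    using tensor_class_eq_iff_coord[OF wmult_in_word_module[OF x f] l] by simp
  have "coord d ts (wmult A d ?l ?x) = coord d ts ?r" if "ts \<in> tri_lists n d" for ts
    unfolding coord_wmult coord_matmap[of d ts _ ?l] sext_single
    using coord_word_mult_diag_right[OF word_module_keys[OF l] e that] by (simp cong: sext_cong)
  then have 2: "tensor_class scale A n d (wmult A d ?l ?x) = tensor_class scale A n d ?r"
    using tensor_class_eq_iff_coord[OF wmult_in_word_module[OF l x] r] by simp
  have "coord d ts ?r = coord d ts ?c" for ts
    unfolding coord_matmap unfolding matmap_def sext_lin_ext by (simp add: o_def)
  then have 3: "tensor_class scale A n d ?r = tensor_class scale A n d ?c"
    using tensor_class_eq_iff_coord[OF r c] by simp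
  show ?thesis
    unfolding xi by (simp only: tensor_mult_class x f l 1 2 3)
qed

end

section \<open>Generalized Schur algebras in coordinates\<close>

text \<open>The product of the symmetric groups of the fibers of \<open>f\<close> over
  \<open>W\<close>. For \<open>f = (!) ts\<close> and \<open>W = Bc \<times> UNIV\<close> these are
  the permutations of equal letters of \<open>ts\<close> from \<open>Bc\<close>, a group whose order
  is the product of factorials in the definition of \<open>\<eta>\<close>.\<close>

definition fiberperms :: "'i set \<Rightarrow> ('i \<Rightarrow> 'v) \<Rightarrow> 'v set \<Rightarrow> ('i \<Rightarrow> 'i) set" where
  "fiberperms S f W = {\<sigma>. \<sigma> permutes {k \<in> S. f k \<in> W} \<and> (\<forall>k\<in>S. f (\<sigma> k) = f k)}"

lemma finite_fiberperms: "finite S \<Longrightarrow> finite (fiberperms S f W)"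
  by (rule finite_subset[OF _ finite_permutations[of "{k \<in> S. f k \<in> W}"]]) (auto simp: fiberperms_def)

lemma id_fiberperms: "id \<in> fiberperms S f W"
  by (auto simp: fiberperms_def)

lemma fiberperms_permutes: "\<sigma> \<in> fiberperms S f W \<Longrightarrow> \<sigma> permutes S"
  unfolding fiberperms_def by (auto elim!: permutes_subset)

lemma fiberperms_comp:
  assumes "\<sigma> \<in> fiberperms S f W" "\<tau> \<in> fiberperms S f W"
  shows "\<sigma> \<circ> \<tau> \<in> fiberperms S f W"
  using assms permutes_compose permutes_in_image[OF fiberperms_permutes[OF assms(2)]]
  by (auto simp: fiberperms_def)

lemma fiberperms_inv:
  assumes "\<sigma> \<in> fiberperms S f W"
  shows "inv_into UNIV \<sigma> \<in> fiberperms S f W"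
proof -
  note perm = fiberperms_permutes[OF assms]
  have "f (inv_into UNIV \<sigma> k) = f k" if "k \<in> S" for k
  proof -
    have "inv_into UNIV \<sigma> k \<in> S" using permutes_in_image[OF permutes_inv[OF perm]] that by simp
    then have "f (\<sigma> (inv_into UNIV \<sigma> k)) = f (inv_into UNIV \<sigma> k)" using assms by (simp add: fiberperms_def)
    then show ?thesis using permutes_inverses(1)[OF perm] by simp
  qed
  then show ?thesis using assms permutes_inv by (auto simp: fiberperms_def)
qed

lemma of_nat_dvd_of_nat_mono: "m dvd n \<Longrightarrow> (of_nat m :: 'k::comm_semiring_1) dvd of_nat n"
  by (metis dvd_def of_nat_mult)

text \<open>The integer \<open>tri_fact\<close> for a list of triples. Multiset counts make its
  invariance under permutations evident.\<close>

definition cfact :: "'a set \<Rightarrow> nat \<Rightarrow> ('a \<times> nat \<times> nat) list \<Rightarrow> nat" where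
  "cfact Bc n ts = (\<Prod>t\<in>(Bc \<inter> fst ` set ts) \<times> {..<n} \<times> {..<n}. fact (count (mset ts) t))"

lemma cfact_permute: "\<sigma> permutes {..<length ts} \<Longrightarrow> cfact Bc n (permute_list \<sigma> ts) = cfact Bc n ts"
  by (simp add: cfact_def)

lemma count_mset_card: "count (mset ts) t = card {k. k < length ts \<and> ts ! k = t}"
  by (simp add: count_mset count_list_eq_length_filter length_filter_conv_card eq_commute)

lemma tri_fact_eq_cfact:
  assumes "length ts = d"
  shows "tri_fact Bc n d (map fst ts) (map (fst \<circ> snd) ts) (map (snd \<circ> snd) ts) = cfact Bc n ts"
proof -
  have "tri_count d (map fst ts) (map (fst \<circ> snd) ts) (map (snd \<circ> snd) ts) b r s = count (mset ts) (b, r, s)" for b r s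
    unfolding tri_count_def count_mset_card using assms
    by (intro arg_cong[where f = card] Collect_cong) (auto simp: prod_eq_iff)
  then show ?thesis
    by (simp add: tri_fact_def cfact_def prod.cartesian_product split_def)
qed

text \<open>Counting fibers requires a finite set of values, so \<open>Bc \<times> UNIV\<close> is
  replaced by \<open>?V\<close>, which selects the same positions. Triples of \<open>?V\<close>
  absent from \<open>ts\<close> contribute \<open>0! = 1\<close>.\<close>

lemma card_fiberperms_eq_cfact:
  assumes "length ts = d" "snd ` set ts \<subseteq> {..<n} \<times> {..<n}"
  shows "card (fiberperms {..<d} ((!) ts) (Bc \<times> UNIV)) = cfact Bc n ts"
proof -
  let ?V = "(Bc \<inter> fst ` set ts) \<times> {..<n} \<times> {..<n}"
  have "ts ! k \<in> Bc \<times> UNIV \<longleftrightarrow> ts ! k \<in> ?V" if "k < d" for k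
  proof -
    have "ts ! k \<in> set ts" using that assms(1) by simp
    then show ?thesis using assms(2) by (force simp: mem_Times_iff)
  qed
  then have "{k \<in> {..<d}. ts ! k \<in> Bc \<times> UNIV} = {k \<in> {..<d}. ts ! k \<in> ?V}"
    by (intro Collect_cong conj_cong refl) (simp only: lessThan_iff)
  then have "card (fiberperms {..<d} ((!) ts) (Bc \<times> UNIV)) =
      card {\<sigma>. \<sigma> permutes {k \<in> {..<d}. ts ! k \<in> ?V} \<and> (\<forall>k\<in>{..<d}. ts ! (\<sigma> k) = ts ! k)}"
    by (simp only: fiberperms_def)
  also have "\<dots> = (\<Prod>v\<in>?V. fact (card {k \<in> {..<d}. ts ! k = v}))"
    by (rule card_fiber_preserving_permutations) auto
  also have "\<dots> = cfact Bc n ts"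
    by (simp add: cfact_def count_mset_card assms(1))
  finally show ?thesis .
qed

lemma permute_list_eq_self_iff:
  assumes "length ts = d" "\<sigma> permutes {..<d}"
  shows "permute_list \<sigma> ts = ts \<longleftrightarrow> (\<forall>k<d. ts ! \<sigma> k = ts ! k)"
  using assms by (auto simp: list_eq_iff_nth_eq permute_list_nth)

lemma tri_stab_eq:
  assumes "length ts = d"
  shows "tri_stab d (map fst ts) (map (fst \<circ> snd) ts) (map (snd \<circ> snd) ts) =
    {\<sigma>. \<sigma> permutes {..<d} \<and> permute_list \<sigma> ts = ts}"
proof -
  have "(permute_list \<sigma> (map fst ts) = map fst ts \<and> permute_list \<sigma> (map (fst \<circ> snd) ts) = map (fst \<circ> snd) ts \<and>
      permute_list \<sigma> (map (snd \<circ> snd) ts) = map (snd \<circ> snd) ts) \<longleftrightarrow> permute_list \<sigma> ts = ts"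
    if s: "\<sigma> permutes {..<d}" for \<sigma>
  proof -
    have lt: "\<sigma> k < d" if "k < d" for k using permutes_in_image[OF s, of k] that by simp
    show ?thesis
      using s assms lt by (auto simp: permute_list_eq_self_iff prod_eq_iff)
  qed
  then show ?thesis by (auto simp: tri_stab_def)
qed

lemma tri_word_eq_tword:
  assumes "length ts = d"
  shows "tri_word n d (map fst ts) (map (fst \<circ> snd) ts) (map (snd \<circ> snd) ts) = tword n ts"
  using assms by (intro nth_equalityI) (auto simp: tri_word_def tword_def split_def)

section \<open>Orbit sums, their multiples and the divisibility criterion\<close>

locale graded_pair_basis = graded_basis scale A Bs
  for scale :: "'k::{idom, ring_char_0} \<Rightarrow> 'a::ring \<Rightarrow> 'a" and A :: "bit \<Rightarrow> 'a set" and Bs :: "bit \<Rightarrow> 'a set" +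
  fixes Bc :: "'a set"
  assumes Bc_subset: "Bc \<subseteq> Bs 0"
begin

definition tri_good :: "nat \<Rightarrow> nat \<Rightarrow> ('a \<times> nat \<times> nat) list set" where
  "tri_good n d = {ts \<in> tri_lists n d. \<forall>k<d. \<forall>l<d. k \<noteq> l \<and> ts ! k = ts ! l \<longrightarrow> par (fst (ts ! k)) = 0}"

definition xi_vec :: "nat \<Rightarrow> nat \<Rightarrow> ('a \<times> nat \<times> nat) list \<Rightarrow> ('a mat list \<Rightarrow>\<^sub>0 'k)" where
  "xi_vec n d ts = xi_rep A n d (map fst ts) (map (fst \<circ> snd) ts) (map (snd \<circ> snd) ts)"

definition eta_vec :: "nat \<Rightarrow> nat \<Rightarrow> ('a \<times> nat \<times> nat) list \<Rightarrow> ('a mat list \<Rightarrow>\<^sub>0 'k)" where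
  "eta_vec n d ts = eta_rep A Bc n d (map fst ts) (map (fst \<circ> snd) ts) (map (snd \<circ> snd) ts)"

lemma tri_lists_snd: "ts \<in> tri_lists n d \<Longrightarrow> snd ` set ts \<subseteq> {..<n} \<times> {..<n}"
  by (auto simp: tri_lists_def tri_letters_def)

lemma tri_lists_fst: "ts \<in> tri_lists n d \<Longrightarrow> k < d \<Longrightarrow> fst (ts ! k) \<in> BB"
  using tri_lists_nth by (fastforce simp: tri_letters_def)

lemma Tri_eq: "Tri A BB n d = (\<lambda>ts. (map fst ts, map (fst \<circ> snd) ts, map (snd \<circ> snd) ts)) ` tri_good n d"
proof
  show "Tri A BB n d \<subseteq> (\<lambda>ts. (map fst ts, map (fst \<circ> snd) ts, map (snd \<circ> snd) ts)) ` tri_good n d"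
  proof
    fix t assume t: "t \<in> Tri A BB n d"
    obtain bs rs ss where t_eq: "t = (bs, rs, ss)" by (cases t)
    have len: "length bs = d" "length rs = d" "length ss = d"
      and sets: "set bs \<subseteq> BB" "set rs \<subseteq> {..<n}" "set ss \<subseteq> {..<n}"
      and rpt: "\<And>k l. k < d \<Longrightarrow> l < d \<Longrightarrow> k \<noteq> l \<Longrightarrow> bs ! k = bs ! l \<Longrightarrow> rs ! k = rs ! l \<Longrightarrow> ss ! k = ss ! l \<Longrightarrow> bs ! k \<in> A 0"
      using t unfolding t_eq Tri_def by auto
    let ?ts = "zip bs (zip rs ss)"
    have maps: "map fst ?ts = bs" "map (fst \<circ> snd) ?ts = rs" "map (snd \<circ> snd) ?ts = ss"
      using len by (auto intro!: nth_equalityI)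
    have nth: "?ts ! k = (bs ! k, rs ! k, ss ! k)" if "k < d" for k using that len by simp
    have mem: "bs ! k \<in> BB" "rs ! k < n" "ss ! k < n" if "k < d" for k
      using sets len that nth_mem by (metis lessThan_iff subsetD)+
    have "?ts \<in> tri_lists n d"
      using len mem by (fastforce simp: tri_lists_def tri_letters_def set_zip)
    moreover have "par (fst (?ts ! k)) = 0" if "k < d" "l < d" "k \<noteq> l" "?ts ! k = ?ts ! l" for k l
      using rpt[OF that(1-3)] that(4) nth[OF that(1)] nth[OF that(2)] mem(1)[OF that(1)] mem_A_iff by simp
    ultimately have "?ts \<in> tri_good n d" unfolding tri_good_def by blast
    then show "t \<in> (\<lambda>ts. (map fst ts, map (fst \<circ> snd) ts, map (snd \<circ> snd) ts)) ` tri_good n d"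
      using t_eq maps by (intro image_eqI[of _ _ ?ts]) auto
  qed
  show "(\<lambda>ts. (map fst ts, map (fst \<circ> snd) ts, map (snd \<circ> snd) ts)) ` tri_good n d \<subseteq> Tri A BB n d"
  proof clarify
    fix ts assume ts: "ts \<in> tri_good n d"
    then have tl: "ts \<in> tri_lists n d" by (simp add: tri_good_def)
    have len: "length ts = d" using tl by (rule tri_lists_length)
    have "ts ! k = ts ! l" if "fst (ts ! k) = fst (ts ! l)" "fst (snd (ts ! k)) = fst (snd (ts ! l))"
      "snd (snd (ts ! k)) = snd (snd (ts ! l))" for k l
      using that by (simp add: prod_eq_iff)
    then have "fst (ts ! k) \<in> A 0"
      if "k < d" "l < d" "k \<noteq> l" "fst (ts ! k) = fst (ts ! l)" "fst (snd (ts ! k)) = fst (snd (ts ! l))"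
        "snd (snd (ts ! k)) = snd (snd (ts ! l))" for k l
      using ts that mem_A_iff[OF tri_lists_fst[OF tl that(1)], of 0] unfolding tri_good_def by blast
    moreover have "fst ` set ts \<subseteq> BB" "(fst \<circ> snd) ` set ts \<subseteq> {..<n}" "(snd \<circ> snd) ` set ts \<subseteq> {..<n}"
      using tl by (auto simp: tri_lists_def tri_letters_def)
    ultimately show "(map fst ts, map (fst \<circ> snd) ts, map (snd \<circ> snd) ts) \<in> Tri A BB n d"
      unfolding Tri_def using len by auto
  qed
qed

lemma pars_permute: "\<sigma> permutes {..<length ts} \<Longrightarrow> pars (permute_list \<sigma> ts) = permute_list \<sigma> (pars ts)"
  by (simp add: pars_def permute_list_map)

lemma length_pars [simp]: "length (pars ts) = length ts"
  by (simp add: pars_def)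

text \<open>In a good list no odd letter is repeated, so a permutation preserving the list fixes
  every odd position.\<close>

lemma stab_sign:
  assumes ts: "ts \<in> tri_good n d" and r: "\<rho> permutes {..<d}" "permute_list \<rho> ts = ts"
  shows "perm_sign_exp d \<rho> (pars ts) = 0"
proof (rule perm_sign_exp_eq_0[OF r(1)], rule ccontr)
  fix k assume k: "k < d" "pars ts ! k = 1" "\<rho> k \<noteq> k"
  have len: "length ts = d" using ts by (simp add: tri_good_def tri_lists_def)
  have "\<rho> k < d" using permutes_in_image[OF r(1), of k] k(1) by simp
  moreover have "ts ! \<rho> k = ts ! k" using r permute_list_eq_self_iff[OF len r(1)] k(1) by simp
  ultimately have "par (fst (ts ! k)) = 0" using ts k unfolding tri_good_def by force
  then show False using k len by (simp add: pars_def)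
qed

lemma coord_word_act_tword:
  assumes us: "us \<in> tri_lists n d" and ts: "ts \<in> tri_lists n d" and s: "\<sigma> permutes {..<d}"
  shows "coord d us (word_act A d \<sigma> (tword n ts)) =
    (if us = permute_list \<sigma> ts then (- 1) ^ perm_sign_exp d \<sigma> (pars ts) else 0)"
proof -
  obtain vs where vs: "vs \<in> tri_lists n d" "us = permute_list \<sigma> vs" using tri_list_permuted[OF us s] .
  have inj: "permute_list \<sigma> vs = permute_list \<sigma> ts \<longleftrightarrow> vs = ts"
  proof
    assume eq: "permute_list \<sigma> vs = permute_list \<sigma> ts"
    have "permute_list (\<sigma> \<circ> inv_into UNIV \<sigma>) zs = permute_list (inv_into UNIV \<sigma>) (permute_list \<sigma> zs)"
      if "zs \<in> tri_lists n d" for zs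
      using permutes_inv[OF s] tri_lists_length[OF that] by (intro permute_list_compose) simp
    then show "vs = ts" using eq vs(1) ts permutes_inv_o(1)[OF s] by (metis permute_list_id)
  qed simp
  show ?thesis
    using coord_word_act[OF tword_in_words[OF ts] s vs(1)] vs inj coordw_tword[OF vs(1) ts] by auto
qed

text \<open>
  The sum over cosets has at most one term with nonzero coordinate at a given list, and the sign of
  that term does not depend on the representative: the stabilizer moves even letters only.
\<close>

lemma coord_xi_vec:
  assumes ts: "ts \<in> tri_good n d"
  shows "xi_vec n d ts \<in> word_module A n d"
    and "\<And>\<sigma>. \<sigma> permutes {..<d} \<Longrightarrow>
      coord d (permute_list \<sigma> ts) (xi_vec n d ts) = (- 1) ^ perm_sign_exp d \<sigma> (pars ts)"
    and "\<And>us. us \<in> tri_lists n d \<Longrightarrow> (\<And>\<sigma>. \<sigma> permutes {..<d} \<Longrightarrow> us \<noteq> permute_list \<sigma> ts) \<Longrightarrow>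
      coord d us (xi_vec n d ts) = 0"
proof -
  have tl: "ts \<in> tri_lists n d" using ts by (simp add: tri_good_def)
  have len: "length ts = d" using tl by (rule tri_lists_length)
  \<comment> \<open>The stabilizer, its cosets, and the representatives chosen by
    \<open>SOME\<close> in \<open>xi_rep\<close>. About \<open>rp\<close> only membership in the
    coset is known.\<close>
  define St where "St = {\<sigma>. \<sigma> permutes {..<d} \<and> permute_list \<sigma> ts = ts}"
  define Cs where "Cs = {(\<lambda>\<rho>. \<rho> \<circ> \<sigma>) ` St | \<sigma>. \<sigma> permutes {..<d}}"
  define rp where "rp C = (SOME \<sigma>. \<sigma> \<in> C)" for C :: "(nat \<Rightarrow> nat) set"
  have comp: "permute_list (\<rho> \<circ> \<sigma>) ts = permute_list \<sigma> (permute_list \<rho> ts)" if "\<sigma> permutes {..<d}" for \<rho> \<sigma>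
    using that len by (intro permute_list_compose) simp
  have xi: "xi_vec n d ts = (\<Sum>C\<in>Cs. word_act A d (rp C) (tword n ts))"
    unfolding xi_vec_def xi_rep_def tri_cosets_def Cs_def rp_def
    using tri_stab_eq[OF len] tri_word_eq_tword[OF len] by (simp add: St_def)
  have fin: "finite Cs"
  proof -
    have "Cs = (\<lambda>\<sigma>. (\<lambda>\<rho>. \<rho> \<circ> \<sigma>) ` St) ` {\<sigma>. \<sigma> permutes {..<d}}" by (auto simp: Cs_def)
    then show ?thesis using finite_permutations[of "{..<d}"] by simp
  qed
  have id_St: "id \<in> St" by (simp add: St_def)
  have rp: "\<exists>\<rho>\<in>St. rp ((\<lambda>\<rho>. \<rho> \<circ> \<sigma>) ` St) = \<rho> \<circ> \<sigma>" for \<sigma>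
  proof -
    have "\<exists>x. x \<in> (\<lambda>\<rho>. \<rho> \<circ> \<sigma>) ` St" using id_St by blast
    then have "rp ((\<lambda>\<rho>. \<rho> \<circ> \<sigma>) ` St) \<in> (\<lambda>\<rho>. \<rho> \<circ> \<sigma>) ` St" unfolding rp_def by (rule someI_ex)
    then show ?thesis by auto
  qed
  have rp_perm: "rp C permutes {..<d}" if C: "C \<in> Cs" for C
  proof -
    obtain \<sigma> where \<sigma>: "C = (\<lambda>\<rho>. \<rho> \<circ> \<sigma>) ` St" "\<sigma> permutes {..<d}" using C by (auto simp: Cs_def)
    obtain \<rho> where "\<rho> \<in> St" "rp C = \<rho> \<circ> \<sigma>" using rp[of \<sigma>] \<sigma>(1) by blast
    then show ?thesis using \<sigma>(2) permutes_compose by (auto simp: St_def)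
  qed
  show "xi_vec n d ts \<in> word_module A n d"
    unfolding xi using tword_in_words[OF tl] rp_perm
    by (intro fs.subspace_sum[OF subspace_word_module] word_act_in_word_module)
  have coord: "coord d us (xi_vec n d ts) =
      (\<Sum>C\<in>Cs. if us = permute_list (rp C) ts then (- 1) ^ perm_sign_exp d (rp C) (pars ts) else 0)"
    if "us \<in> tri_lists n d" for us
    unfolding xi coord_sum using coord_word_act_tword[OF that tl rp_perm] by (intro sum.cong) auto
  show "coord d us (xi_vec n d ts) = 0"
    if "us \<in> tri_lists n d" "\<And>\<sigma>. \<sigma> permutes {..<d} \<Longrightarrow> us \<noteq> permute_list \<sigma> ts" for us
    unfolding coord[OF that(1)] using that(2) rp_perm by (intro sum.neutral) auto
  show "coord d (permute_list \<sigma> ts) (xi_vec n d ts) = (- 1) ^ perm_sign_exp d \<sigma> (pars ts)"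
    if s: "\<sigma> permutes {..<d}" for \<sigma>
  proof -
    let ?C = "(\<lambda>\<rho>. \<rho> \<circ> \<sigma>) ` St"
    have C: "?C \<in> Cs" using s by (auto simp: Cs_def)
    obtain \<rho> where \<rho>: "\<rho> \<in> St" "rp ?C = \<rho> \<circ> \<sigma>" using rp by blast
    have \<rho>': "\<rho> permutes {..<d}" "permute_list \<rho> ts = ts" using \<rho>(1) by (auto simp: St_def)
    have "coord d (permute_list \<sigma> ts) (xi_vec n d ts) =
      (if permute_list \<sigma> ts = permute_list (rp ?C) ts then (- 1) ^ perm_sign_exp d (rp ?C) (pars ts) else 0)"
      unfolding coord[OF permute_tri_lists[OF tl s]]
    proof (rule sum_eq_single[OF fin C])
      fix C' assume C': "C' \<in> Cs" "C' \<noteq> ?C"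
      obtain \<tau> where \<tau>: "C' = (\<lambda>\<rho>. \<rho> \<circ> \<tau>) ` St" "\<tau> permutes {..<d}" using C'(1) by (auto simp: Cs_def)
      obtain \<mu> where \<mu>: "\<mu> \<in> St" "rp C' = \<mu> \<circ> \<tau>" using rp[of \<tau>] \<tau>(1) by blast
      have "permute_list \<sigma> ts \<noteq> permute_list (rp C') ts"
      proof
        assume "permute_list \<sigma> ts = permute_list (rp C') ts"
        then have eq: "permute_list \<tau> ts = permute_list \<sigma> ts"
          using comp[OF \<tau>(2), of \<mu>] \<mu> by (simp add: St_def)
        \<comment> \<open>Since \<open>\<tau>\<close> and \<open>\<sigma>\<close> carry
          \<open>ts\<close> to the same list, they differ on the left by the stabilizer element
          \<open>\<nu>\<close>, which forces the two cosets to coincide.\<close>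
        define \<nu> where "\<nu> = \<tau> \<circ> inv_into UNIV \<sigma>"
        have inv: "inv_into UNIV \<sigma> permutes {..<d}" by (rule permutes_inv[OF s])
        have \<nu>_perm: "\<nu> permutes {..<d}" unfolding \<nu>_def by (rule permutes_compose[OF inv \<tau>(2)])
        have "permute_list \<nu> ts = permute_list (\<sigma> \<circ> inv_into UNIV \<sigma>) ts"
          unfolding \<nu>_def using comp[OF inv] eq by simp
        then have \<nu>: "\<nu> \<in> St" using \<nu>_perm permutes_inv_o(1)[OF s] by (simp add: St_def)
        have \<tau>_eq: "\<tau> = \<nu> \<circ> \<sigma>" unfolding \<nu>_def using permutes_inv_o(2)[OF s] by (simp add: comp_assoc)
        have \<nu>i_perm: "inv_into UNIV \<nu> permutes {..<d}" by (rule permutes_inv[OF \<nu>_perm])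
        have "permute_list (\<nu> \<circ> inv_into UNIV \<nu>) ts = permute_list (inv_into UNIV \<nu>) ts"
          using comp[OF \<nu>i_perm, of \<nu>] \<nu> by (simp add: St_def)
        then have \<nu>i: "inv_into UNIV \<nu> \<in> St"
          using \<nu>i_perm permutes_inv_o(1)[OF \<nu>_perm] by (simp add: St_def)
        have St_comp: "\<alpha> \<circ> \<beta> \<in> St" if "\<alpha> \<in> St" "\<beta> \<in> St" for \<alpha> \<beta>
          using that comp[of \<beta> \<alpha>] permutes_compose by (auto simp: St_def)
        have "C' = ?C"
        proof
          show "C' \<subseteq> ?C"
          proof
            fix x assume "x \<in> C'"
            then obtain \<alpha> where "\<alpha> \<in> St" "x = \<alpha> \<circ> \<tau>" unfolding \<tau>(1) by blast
            then show "x \<in> ?C" using St_comp \<nu> \<tau>_eq by (intro image_eqI[of _ _ "\<alpha> \<circ> \<nu>"]) (auto simp: comp_assoc)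
          qed
          show "?C \<subseteq> C'"
          proof
            fix x assume "x \<in> ?C"
            then obtain \<alpha> where \<alpha>: "\<alpha> \<in> St" "x = \<alpha> \<circ> \<sigma>" by blast
            have "inv_into UNIV \<nu> \<circ> \<tau> = \<sigma>"
              unfolding \<tau>_eq using permutes_inv_o(2)[OF \<nu>_perm] by (simp flip: comp_assoc)
            then have "x = (\<alpha> \<circ> inv_into UNIV \<nu>) \<circ> \<tau>" using \<alpha>(2) by (simp add: comp_assoc)
            then show "x \<in> C'" unfolding \<tau>(1) using St_comp \<nu>i \<alpha>(1) by blast
          qed
        qed
        then show False using C'(2) by contradiction
      qed
      then show "(if permute_list \<sigma> ts = permute_list (rp C') ts then (- 1) ^ perm_sign_exp d (rp C') (pars ts) else 0) = 0"
        by simp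
    qed
    also have "permute_list (rp ?C) ts = permute_list \<sigma> ts"
      unfolding \<rho>(2) using comp[OF s] \<rho>' by simp
    \<comment> \<open>The chosen representative is \<open>\<rho> \<circ> \<sigma>\<close> with
      \<open>\<rho>\<close> in the stabilizer. The cocycle identity splits off the sign of
      \<open>\<rho>\<close>, which is trivial.\<close>
    also have "(- 1 :: 'k) ^ perm_sign_exp d (rp ?C) (pars ts) = (- 1) ^ perm_sign_exp d \<sigma> (pars ts)"
      unfolding \<rho>(2) using perm_sign_comp[OF \<rho>'(1) s, of "pars ts"] stab_sign[OF ts \<rho>']
        pars_permute[of \<rho> ts] \<rho>' len by simp
    finally show ?thesis by simp
  qed
qed

lemma eta_vec_eq:
  assumes "ts \<in> tri_lists n d"
  shows "eta_vec n d ts = fscale (of_nat (cfact Bc n ts)) (xi_vec n d ts)"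
  by (simp add: eta_vec_def eta_rep_def xi_vec_def tri_fact_eq_cfact[OF tri_lists_length[OF assms]])

text \<open>Representatives rather than classes, so that they form a submodule of the free module on
  words; \<open>gen_schur\<close> is its image under \<open>tensor_class\<close>.\<close>

definition schur_vectors :: "nat \<Rightarrow> nat \<Rightarrow> ('a mat list \<Rightarrow>\<^sub>0 'k) set" where
  "schur_vectors n d = {f \<in> word_module A n d. sym_coord n d f \<and>
    (\<forall>ts\<in>tri_lists n d. of_nat (cfact Bc n ts) dvd coord d ts f)}"

lemma sym_coord_add: "sym_coord n d f \<Longrightarrow> sym_coord n d g \<Longrightarrow> sym_coord n d (f + g)"
  by (simp add: sym_coord_def coord_add distrib_left)

lemma sym_coord_fscale: "sym_coord n d f \<Longrightarrow> sym_coord n d (fscale c f)"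
  by (simp add: sym_coord_def coord_fscale mult.left_commute)

lemma subspace_schur_vectors: "fs.subspace (schur_vectors n d)"
proof (rule fs.subspaceI)
  show "0 \<in> schur_vectors n d"
    using fs.subspace_0[OF subspace_word_module] by (simp add: schur_vectors_def sym_coord_def)
next
  fix f g assume "f \<in> schur_vectors n d" "g \<in> schur_vectors n d"
  then show "f + g \<in> schur_vectors n d"
    using fs.subspace_add[OF subspace_word_module]
    by (auto simp: schur_vectors_def sym_coord_add coord_add)
next
  fix c f assume "f \<in> schur_vectors n d"
  then show "fscale c f \<in> schur_vectors n d"
    using fs.subspace_scale[OF subspace_word_module]
    by (auto simp: schur_vectors_def sym_coord_fscale coord_fscale)
qed

text \<open>On the orbit of \<open>ts\<close> the sign rule is the cocycle identity. Off the orbit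
  both sides vanish, since the complement of an orbit is stable.\<close>

lemma sym_coord_xi_vec:
  assumes ts: "ts \<in> tri_good n d"
  shows "sym_coord n d (xi_vec n d ts)"
  unfolding sym_coord_def
proof (intro allI impI ballI)
  fix \<sigma> us assume s: "\<sigma> permutes {..<d}" and us: "us \<in> tri_lists n d"
  have tl: "ts \<in> tri_lists n d" using ts by (simp add: tri_good_def)
  have len: "length ts = d" "length us = d" using tl us tri_lists_length by blast+
  show "coord d (permute_list \<sigma> us) (xi_vec n d ts) =
    (- 1) ^ perm_sign_exp d \<sigma> (pars us) * coord d us (xi_vec n d ts)"
  proof (cases "\<exists>\<tau>. \<tau> permutes {..<d} \<and> us = permute_list \<tau> ts")
    case True
    then obtain \<tau> where \<tau>: "\<tau> permutes {..<d}" "us = permute_list \<tau> ts" by blast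
    have eq: "permute_list \<sigma> us = permute_list (\<tau> \<circ> \<sigma>) ts"
      using permute_list_compose[of \<sigma> ts \<tau>] s len \<tau> by simp
    have "pars us = permute_list \<tau> (pars ts)" using \<tau> len by (simp add: pars_permute)
    then show ?thesis
      unfolding eq unfolding \<tau>(2)
      using coord_xi_vec(2)[OF ts permutes_compose[OF s \<tau>(1)]] coord_xi_vec(2)[OF ts \<tau>(1)]
        perm_sign_comp[OF \<tau>(1) s, of "pars ts"] len \<tau>(2) by (simp add: mult.commute)
  next
    case False
    have "permute_list \<sigma> us \<noteq> permute_list \<tau> ts" if t: "\<tau> permutes {..<d}" for \<tau>
    proof
      assume eq: "permute_list \<sigma> us = permute_list \<tau> ts"
      let ?i = "inv_into UNIV \<sigma>"
      have i: "?i permutes {..<d}" by (rule permutes_inv[OF s])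
      have "us = permute_list (\<sigma> \<circ> ?i) us" using permutes_inv_o(1)[OF s] by simp
      also have "\<dots> = permute_list ?i (permute_list \<sigma> us)"
        using i len by (intro permute_list_compose) simp
      also have "\<dots> = permute_list (\<tau> \<circ> ?i) ts"
        unfolding eq using i len by (intro permute_list_compose[symmetric]) simp
      finally show False using False permutes_compose[OF i t] by blast
    qed
    then show ?thesis
      using coord_xi_vec(3)[OF ts us] coord_xi_vec(3)[OF ts permute_tri_lists[OF us s]] False by auto
  qed
qed

text \<open>Nonzero coordinates occur only on the orbit of \<open>ts\<close>, and along an orbit
  \<open>cfact\<close> is constant.\<close>

lemma eta_vec_in_schur_vectors:
  assumes ts: "ts \<in> tri_good n d"
  shows "eta_vec n d ts \<in> schur_vectors n d"
proof -
  have tl: "ts \<in> tri_lists n d" using ts by (simp add: tri_good_def)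
  have len: "length ts = d" using tl by (rule tri_lists_length)
  have "of_nat (cfact Bc n us) dvd coord d us (eta_vec n d ts)" if us: "us \<in> tri_lists n d" for us
  proof (cases "\<exists>\<tau>. \<tau> permutes {..<d} \<and> us = permute_list \<tau> ts")
    case True
    then have "cfact Bc n us = cfact Bc n ts" using len cfact_permute by blast
    then show ?thesis by (simp add: eta_vec_eq[OF tl] coord_fscale)
  next
    case False
    then have "coord d us (xi_vec n d ts) = 0" using coord_xi_vec(3)[OF ts us] by blast
    then show ?thesis by (simp add: eta_vec_eq[OF tl] coord_fscale)
  qed
  moreover have "eta_vec n d ts \<in> word_module A n d"
    unfolding eta_vec_eq[OF tl] by (intro fs.subspace_scale[OF subspace_word_module] coord_xi_vec(1)[OF ts])
  moreover have "sym_coord n d (eta_vec n d ts)"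
    unfolding eta_vec_eq[OF tl] by (intro sym_coord_fscale sym_coord_xi_vec[OF ts])
  ultimately show ?thesis by (simp add: schur_vectors_def)
qed

text \<open>Exchanging two equal odd letters changes the sign, so the coordinate equals its negative.\<close>

lemma tri_good_if_coord_nonzero:
  assumes f: "sym_coord n d f" and ts: "ts \<in> tri_lists n d" and nz: "coord d ts f \<noteq> 0"
  shows "ts \<in> tri_good n d"
proof (rule ccontr)
  assume "ts \<notin> tri_good n d"
  then obtain k l where kl: "k < d" "l < d" "k \<noteq> l" "ts ! k = ts ! l" "par (fst (ts ! k)) \<noteq> 0"
    using ts unfolding tri_good_def by blast
  have len: "length ts = d" using ts by (rule tri_lists_length)
  have "\<exists>k l. k < l \<and> l < d \<and> ts ! k = ts ! l \<and> par (fst (ts ! k)) = 1"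
  proof (cases "k < l")
    case True then show ?thesis using kl by (intro exI[of _ k] exI[of _ l]) simp
  next
    case False then show ?thesis using kl by (intro exI[of _ l] exI[of _ k]) simp
  qed
  then obtain i j where ij: "i < j" "j < d" "ts ! i = ts ! j" "par (fst (ts ! i)) = 1" by blast
  have s: "transpose i j permutes {..<d}" using ij by (intro permutes_swap_id) auto
  have "permute_list (transpose i j) ts = ts"
    using ij by (subst permute_list_eq_self_iff[OF len s]) (auto simp: transpose_def)
  moreover have "odd (perm_sign_exp d (transpose i j) (pars ts))"
    using ij len by (intro odd_perm_sign_exp_transpose) (auto simp: pars_def)
  ultimately have "coord d ts f = - coord d ts f"
    using sym_coordD[OF f s ts] by simp
  then have "coord d ts f + coord d ts f = 0" by (simp only: eq_neg_iff_add_eq_0)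
  then have "2 * coord d ts f = 0" by (simp only: mult_2)
  \<comment> \<open>In a domain of characteristic 0 the element 2 is nonzero and can be
    cancelled.\<close>
  then show False using nz by simp
qed

text \<open>Divisibility supplies the coefficient with which an \<open>\<eta>\<close> must be
  subtracted in order to clear a coordinate. This clears the whole orbit and touches nothing else,
  so the finite support shrinks. Only coordinates are compared, as representatives are determined
  merely modulo the relations.\<close>

lemma schur_vectors_spanned:
  assumes "f \<in> schur_vectors n d"
  shows "\<exists>g\<in>fs.span (eta_vec n d ` tri_good n d). \<forall>ts\<in>tri_lists n d. coord d ts f = coord d ts g"
  using assms
proof (induction "card {ts \<in> tri_lists n d. coord d ts f \<noteq> 0}" arbitrary: f rule: less_induct)
  case less
  let ?supp = "\<lambda>f. {ts \<in> tri_lists n d. coord d ts f \<noteq> 0}"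
  have f: "f \<in> word_module A n d" "sym_coord n d f"
    "\<And>ts. ts \<in> tri_lists n d \<Longrightarrow> of_nat (cfact Bc n ts) dvd coord d ts f"
    using less.prems by (auto simp: schur_vectors_def)
  show ?case
  proof (cases "?supp f = {}")
    case True
    then have "\<forall>ts\<in>tri_lists n d. coord d ts f = coord d ts 0" by auto
    then show ?thesis using fs.span_zero by blast
  next
    case False
    then obtain ts where ts: "ts \<in> tri_lists n d" "coord d ts f \<noteq> 0" by blast
    have good: "ts \<in> tri_good n d" by (rule tri_good_if_coord_nonzero[OF f(2) ts])
    obtain y where y: "coord d ts f = of_nat (cfact Bc n ts) * y" using f(3)[OF ts(1)] by (auto elim: dvdE)
    let ?v = "fscale y (eta_vec n d ts)"
    have v: "?v \<in> schur_vectors n d"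
      by (intro fs.subspace_scale[OF subspace_schur_vectors] eta_vec_in_schur_vectors[OF good])
    have f': "f - ?v \<in> schur_vectors n d"
      by (rule fs.subspace_diff[OF subspace_schur_vectors less.prems v])
    \<comment> \<open>Both vectors obey the same sign rule and agree at \<open>ts\<close>, so they
      agree on the whole orbit.\<close>
    have orbit: "coord d (permute_list \<sigma> ts) (f - ?v) = 0" if s: "\<sigma> permutes {..<d}" for \<sigma>
      using sym_coordD[OF f(2) s ts(1)] coord_xi_vec(2)[OF good s]
      by (simp add: coord_diff coord_fscale eta_vec_eq[OF ts(1)] y mult.commute mult.left_commute)
    have "?supp (f - ?v) \<subseteq> ?supp f"
    proof
      fix us assume us: "us \<in> ?supp (f - ?v)"
      then have "us \<noteq> permute_list \<sigma> ts" if "\<sigma> permutes {..<d}" for \<sigma> using orbit[OF that] by auto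
      then have "coord d us (xi_vec n d ts) = 0" using coord_xi_vec(3)[OF good] us by blast
      then show "us \<in> ?supp f" using us by (simp add: coord_diff coord_fscale eta_vec_eq[OF ts(1)])
    qed
    moreover have "ts \<notin> ?supp (f - ?v)" using orbit[OF permutes_id] by simp
    ultimately have "?supp (f - ?v) \<subset> ?supp f" using ts by blast
    then have "card (?supp (f - ?v)) < card (?supp f)"
      by (rule psubset_card_mono[OF finite_coord_support[OF f(1)]])
    then obtain g where g: "g \<in> fs.span (eta_vec n d ` tri_good n d)"
      "\<forall>ts\<in>tri_lists n d. coord d ts (f - ?v) = coord d ts g"
      using less.hyps[OF _ f'] by blast
    have "g + ?v \<in> fs.span (eta_vec n d ` tri_good n d)"
      using good by (intro fs.span_add[OF g(1)] fs.span_scale fs.span_base imageI)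
    moreover have "\<forall>ts\<in>tri_lists n d. coord d ts f = coord d ts (g + ?v)"
      using g(2) unfolding coord_diff coord_add by (simp add: diff_eq_eq)
    ultimately show ?thesis by blast
  qed
qed

lemma gen_schur_eq:
  assumes "Ba \<union> Bc \<union> B1 = BB"
  shows "gen_schur scale A Ba Bc B1 n d = tensor_class scale A n d ` schur_vectors n d"
proof -
  let ?span = "fs.span (eta_vec n d ` tri_good n d)"
  have "{eta_rep A Bc n d bs rs ss | bs rs ss. (bs, rs, ss) \<in> Tri A (Ba \<union> Bc \<union> B1) n d} =
      eta_vec n d ` tri_good n d"
    unfolding assms Tri_eq eta_vec_def by blast
  then have gs: "gen_schur scale A Ba Bc B1 n d = tensor_class scale A n d ` ?span"
    by (simp add: gen_schur_def)
  have sub: "?span \<subseteq> schur_vectors n d"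
    using eta_vec_in_schur_vectors by (intro fs.span_minimal[OF _ subspace_schur_vectors]) auto
  have "tensor_class scale A n d f \<in> tensor_class scale A n d ` ?span" if f: "f \<in> schur_vectors n d" for f
  proof -
    obtain g where g: "g \<in> ?span" "\<forall>ts\<in>tri_lists n d. coord d ts f = coord d ts g"
      using schur_vectors_spanned[OF f] by blast
    have "f \<in> word_module A n d" "g \<in> word_module A n d"
      using f g(1) sub by (auto simp: schur_vectors_def)
    then have "tensor_class scale A n d f = tensor_class scale A n d g"
      using tensor_class_eq_iff_coord g(2) by blast
    then show ?thesis using g(1) by blast
  qed
  then show ?thesis unfolding gs using sub by blast
qed

end

text \<open>The sets \<open>Bs 0 - Bc\<close> and \<open>Bs' 0 - Bc'\<close> play the roles of the
  two bases of \<open>\<aa>\<close>, so \<open>even_part\<close> expresses the triangularity of the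
  change of basis. Nothing is required of the elements of \<open>Bc\<close>. The inclusion is
  one-sided; equality results from applying it in both directions.\<close>

lemma schur_vectors_basis_change:
  fixes scale :: "'k::{idom, ring_char_0} \<Rightarrow> 'a::ring \<Rightarrow> 'a"
  assumes G: "graded_pair_basis scale A Bs Bc" and H: "graded_pair_basis scale A Bs' Bc'"
    and even_part: "Bs 0 - Bc \<subseteq> Modules.module.span scale (Bs' 0 - Bc')"
  shows "graded_pair_basis.schur_vectors scale A Bs Bc n d \<subseteq> graded_pair_basis.schur_vectors scale A Bs' Bc' n d"
proof
  interpret G: graded_pair_basis scale A Bs Bc by (rule G)
  interpret H: graded_pair_basis scale A Bs' Bc' by (rule H)
  fix f assume "f \<in> G.schur_vectors n d"
  then have f: "f \<in> word_module A n d" "G.sym_coord n d f"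
    "\<And>ts. ts \<in> G.tri_lists n d \<Longrightarrow> of_nat (cfact Bc n ts) dvd G.coord d ts f"
    by (auto simp: G.schur_vectors_def)
  have sym: "H.sym_coord n d f"
    using G.tensor_class_invariant_iff[OF f(1)] H.tensor_class_invariant_iff[OF f(1)] f(2) by simp
  have "of_nat (cfact Bc' n us) dvd H.coord d us f" if us: "us \<in> H.tri_lists n d" for us
  proof -
    \<comment> \<open>The transition coefficient: the coordinate at \<open>us\<close> in the new
      basis of the basis word of \<open>ts\<close> in the old one.\<close>
    define P where "P ts = H.coordw d us (tword n ts)" for ts
    define S where "S = {ts \<in> G.tri_lists n d. G.coord d ts f \<noteq> 0}"
    \<comment> \<open>The lists that can contribute at \<open>us\<close>. This condition also
      guarantees that permutations moving only letters of \<open>us\<close> from \<open>Bc'\<close>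
      move only letters of \<open>ts\<close> from \<open>Bc\<close>.\<close>
    define X where "X = {ts \<in> S. \<forall>k<d. fst (us ! k) \<in> Bc' \<longrightarrow> fst (ts ! k) \<in> Bc}"
    define Q where "Q = fiberperms {..<d} ((!) us) (Bc' \<times> UNIV)"
    have lenu: "length us = d" using us by (rule H.tri_lists_length)
    have finS: "finite S" unfolding S_def by (rule G.finite_coord_support[OF f(1)])
    have coord_us: "H.coord d us f = (\<Sum>ts\<in>S. G.coord d ts f * P ts)"
      unfolding H.coord_def P_def S_def
      by (rule G.sext_expansion[OF f(1)]) (use H.coord_rels[OF us] in \<open>simp add: H.coord_def\<close>)
    have P_zero: "P ts = 0" if ts: "ts \<in> S" "ts \<notin> X" for ts
    proof -
      have tl: "ts \<in> G.tri_lists n d" using ts by (simp add: S_def)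
      obtain k where k: "k < d" "fst (us ! k) \<in> Bc'" "fst (ts ! k) \<notin> Bc" using ts by (auto simp: X_def)
      let ?b = "fst (ts ! k)" and ?b' = "fst (us ! k)"
      have b: "?b \<in> Bs 0 \<union> Bs 1" by (rule G.tri_lists_fst[OF tl k(1)])
      have b': "?b' \<in> Bs' 0 \<union> Bs' 1" by (rule H.tri_lists_fst[OF us k(1)])
      \<comment> \<open>A basis element outside \<open>Bc\<close> is either in the basis of
        \<open>\<aa>\<close>, hence in the span of the new basis of \<open>\<aa>\<close>, or odd. In
        both cases it has no component at an element of \<open>Bc'\<close>.\<close>
      have "H.rep ?b ?b' = 0"
      proof (cases "?b \<in> Bs 0")
        case True
        then have "?b \<in> Modules.module.span scale (Bs' 0 - Bc')" using even_part k(3) by blast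
        then show ?thesis by (rule H.rep_subset) (use k(2) in auto)
      next
        case False
        then have "?b \<in> A 1" using b G.Bs_subset by blast
        moreover have "H.par ?b' = 0" using k(2) H.Bc_subset H.mem_Bs_iff[OF b'] by blast
        ultimately show ?thesis using b' by (intro H.rep_hom[of _ 1]) auto
      qed
      moreover have "?b \<in> super_carrier A" using b G.BB_subset by blast
      ultimately have "H.ent (tword n ts ! k) (us ! k) = 0"
        using H.ent_elem_mat[OF H.tri_lists_nth[OF us k(1)], of "ts ! k"]
        by (simp add: H.tword_nth[OF G.tri_lists_length[OF tl] k(1)])
      then show ?thesis unfolding P_def H.coordw_def using k(1) by (intro prod_zero) auto
    qed
    have Q_perm: "\<sigma> permutes {..<d}" if "\<sigma> \<in> Q" for \<sigma>
      using that fiberperms_permutes unfolding Q_def by blast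
    have Q_us: "us ! \<sigma> k = us ! k" if "\<sigma> \<in> Q" "k < d" for \<sigma> k
      using that by (auto simp: Q_def fiberperms_def)
    have Q_lt: "\<sigma> k < d" if "\<sigma> \<in> Q" "k < d" for \<sigma> k
      using permutes_in_image[OF Q_perm[OF that(1)], of k] that(2) by simp
    have Q_move: "fst (us ! k) \<in> Bc'" if "\<sigma> \<in> Q" "\<sigma> k \<noteq> k" for \<sigma> k
    proof -
      have p: "\<sigma> permutes {k \<in> {..<d}. us ! k \<in> Bc' \<times> UNIV}"
        using that(1) unfolding Q_def fiberperms_def by blast
      have "k \<in> {k \<in> {..<d}. us ! k \<in> Bc' \<times> UNIV}"
        using that(2) permutes_not_in[OF p, of k] by (rule contrapos_np)
      then have "us ! k \<in> Bc' \<times> UNIV" by simp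
      then show ?thesis by (simp only: mem_Times_iff)
    qed
    \<comment> \<open>Positions moved by \<open>Q\<close> carry letters of \<open>ts\<close> from
      \<open>Bc\<close>, and these are even.\<close>
    have sign: "perm_sign_exp d \<sigma> (G.pars ts) = 0" if "\<sigma> \<in> Q" "ts \<in> X" for \<sigma> ts
    proof (rule perm_sign_exp_eq_0[OF Q_perm[OF that(1)]], rule ccontr)
      fix k assume k: "k < d" "G.pars ts ! k = 1" "\<sigma> k \<noteq> k"
      have tl: "ts \<in> G.tri_lists n d" using that(2) by (simp add: X_def S_def)
      have "fst (ts ! k) \<in> Bc" using that(2) k(1) Q_move[OF that(1) k(3)] by (auto simp: X_def)
      then have "G.par (fst (ts ! k)) = 0"
        using G.Bc_subset G.mem_Bs_iff[OF G.tri_lists_fst[OF tl k(1)]] by blast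
      then show False using k G.tri_lists_length[OF tl] by (simp add: G.pars_def)
    qed
    have coord_inv: "G.coord d (permute_list \<sigma> ts) f = G.coord d ts f" if "\<sigma> \<in> Q" "ts \<in> X" for \<sigma> ts
      using G.sym_coordD[OF f(2) Q_perm[OF that(1)], of ts] sign[OF that] that(2) by (simp add: X_def S_def)
    have "of_nat (card Q) dvd (\<Sum>ts\<in>X. G.coord d ts f * P ts)"
    proof (rule card_group_dvd_sum[where act = permute_list])
      show "finite Q" unfolding Q_def by (rule finite_fiberperms) simp
      show "id \<in> Q" unfolding Q_def by (rule id_fiberperms)
      show "\<sigma> \<circ> \<tau> \<in> Q" if "\<sigma> \<in> Q" "\<tau> \<in> Q" for \<sigma> \<tau>
        using that unfolding Q_def by (rule fiberperms_comp)
      show "\<exists>\<tau>\<in>Q. \<sigma> \<circ> \<tau> = id \<and> \<tau> \<circ> \<sigma> = id" if "\<sigma> \<in> Q" for \<sigma>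
        using that fiberperms_inv permutes_inv_o[OF Q_perm[OF that]] unfolding Q_def by blast
      show "finite X" using finS by (simp add: X_def)
    next
      fix \<sigma> ts assume s: "\<sigma> \<in> Q" and ts: "ts \<in> X"
      have tl: "ts \<in> G.tri_lists n d" using ts by (simp add: X_def S_def)
      have len: "length ts = d" by (rule G.tri_lists_length[OF tl])
      have "fst (permute_list \<sigma> ts ! k) \<in> Bc" if "k < d" "fst (us ! k) \<in> Bc'" for k
        using that ts Q_us[OF s that(1)] Q_lt[OF s that(1)] Q_perm[OF s] len
        by (simp add: permute_list_nth X_def)
      then show "permute_list \<sigma> ts \<in> X"
        using coord_inv[OF s ts] ts G.permute_tri_lists[OF tl Q_perm[OF s]] by (simp add: X_def S_def)
      \<comment> \<open>As \<open>\<sigma>\<close> preserves \<open>us\<close>, permuting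
        \<open>ts\<close> alone has the same effect on the transition coefficient as permuting both
        lists, which only reorders the factors of the product.\<close>
      have "permute_list \<sigma> us = us"
        using permute_list_eq_self_iff[OF lenu Q_perm[OF s]] Q_us[OF s] by blast
      then have "P (permute_list \<sigma> ts) = P ts"
        unfolding P_def using H.coordw_permute[OF Q_perm[OF s], of "tword n ts" us] Q_perm[OF s] lenu len
        by (simp add: tword_def permute_list_map)
      then show "G.coord d (permute_list \<sigma> ts) f * P (permute_list \<sigma> ts) = G.coord d ts f * P ts"
        using coord_inv[OF s ts] by simp
    next
      fix \<sigma> \<tau> ts assume "\<sigma> \<in> Q" "\<tau> \<in> Q" "ts \<in> X"
      then show "permute_list (\<sigma> \<circ> \<tau>) ts = permute_list \<tau> (permute_list \<sigma> ts)"
        using Q_perm G.tri_lists_length[of ts n d] by (intro permute_list_compose) (simp add: X_def S_def)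
    next
      fix ts assume ts: "ts \<in> X"
      have tl: "ts \<in> G.tri_lists n d" using ts by (simp add: X_def S_def)
      have len: "length ts = d" by (rule G.tri_lists_length[OF tl])
      \<comment> \<open>All permutations of equal letters of \<open>ts\<close> from
        \<open>Bc\<close>. Their number is \<open>cfact Bc n ts\<close>, which divides the
        coordinate of \<open>f\<close> at \<open>ts\<close>; so it suffices that the stabilizer of
        \<open>ts\<close> in \<open>Q\<close> is a subgroup of \<open>R\<close>.\<close>
      define R where "R = fiberperms {..<d} ((!) ts) (Bc \<times> UNIV)"
      have "card {\<sigma> \<in> Q. permute_list \<sigma> ts = ts} dvd card R"
      proof (rule card_subgroup_dvd)
        show "finite R" unfolding R_def by (rule finite_fiberperms) simp
        show "finite {\<sigma> \<in> Q. permute_list \<sigma> ts = ts}" 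
          unfolding Q_def by (rule finite_subset[OF _ finite_fiberperms[OF finite_lessThan]]) blast
        show "{\<sigma> \<in> Q. permute_list \<sigma> ts = ts} \<subseteq> R"
        proof clarify
          fix \<sigma> assume s: "\<sigma> \<in> Q" "permute_list \<sigma> ts = ts"
          have "\<sigma> permutes {k \<in> {..<d}. us ! k \<in> Bc' \<times> UNIV}"
            using s(1) unfolding Q_def fiberperms_def by blast
          moreover have "{k \<in> {..<d}. us ! k \<in> Bc' \<times> UNIV} \<subseteq> {k \<in> {..<d}. ts ! k \<in> Bc \<times> UNIV}"
            using ts by (auto simp: X_def mem_Times_iff)
          ultimately have "\<sigma> permutes {k \<in> {..<d}. ts ! k \<in> Bc \<times> UNIV}" by (rule permutes_subset)
          then show "\<sigma> \<in> R"
            using s permute_list_eq_self_iff[OF len Q_perm[OF s(1)]] by (auto simp: R_def fiberperms_def)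
        qed
        show "id \<in> {\<sigma> \<in> Q. permute_list \<sigma> ts = ts}" using id_fiberperms by (auto simp: Q_def)
        show "\<sigma> \<circ> \<tau> \<in> R" if "\<sigma> \<in> R" "\<tau> \<in> R" for \<sigma> \<tau>
          using that unfolding R_def by (rule fiberperms_comp)
        show "bij \<sigma>" if "\<sigma> \<in> R" for \<sigma>
          using fiberperms_permutes that unfolding R_def by (blast intro: permutes_bij)
      next
        fix \<sigma> \<tau> assume st: "\<sigma> \<in> {\<sigma> \<in> Q. permute_list \<sigma> ts = ts}" "\<tau> \<in> {\<sigma> \<in> Q. permute_list \<sigma> ts = ts}"
        have "permute_list (\<sigma> \<circ> \<tau>) ts = permute_list \<tau> (permute_list \<sigma> ts)"
          using Q_perm st len by (intro permute_list_compose) auto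
        then show "\<sigma> \<circ> \<tau> \<in> {\<sigma> \<in> Q. permute_list \<sigma> ts = ts}"
          using st fiberperms_comp[of \<sigma> "{..<d}" "(!) us" "Bc' \<times> UNIV" \<tau>] by (auto simp: Q_def)
      next
        fix \<sigma> assume st: "\<sigma> \<in> {\<sigma> \<in> Q. permute_list \<sigma> ts = ts}"
        then have s: "\<sigma> permutes {..<d}" using Q_perm by blast
        have "permute_list (\<sigma> \<circ> inv_into UNIV \<sigma>) ts = permute_list (inv_into UNIV \<sigma>) (permute_list \<sigma> ts)"
          using permutes_inv[OF s] len by (intro permute_list_compose) simp
        then have "permute_list (inv_into UNIV \<sigma>) ts = ts"
          using st permutes_inv_o(1)[OF s] by simp
        then show "inv_into UNIV \<sigma> \<in> {\<sigma> \<in> Q. permute_list \<sigma> ts = ts}"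
          using st fiberperms_inv[of \<sigma> "{..<d}" "(!) us" "Bc' \<times> UNIV"] by (auto simp: Q_def)
      qed
      then have "card {\<sigma> \<in> Q. permute_list \<sigma> ts = ts} dvd cfact Bc n ts"
        using card_fiberperms_eq_cfact[OF len G.tri_lists_snd[OF tl]] by (simp add: R_def)
      then have "of_nat (card {\<sigma> \<in> Q. permute_list \<sigma> ts = ts}) dvd G.coord d ts f"
        using f(3)[OF tl] of_nat_dvd_of_nat_mono dvd_trans by blast
      then show "of_nat (card {\<sigma> \<in> Q. permute_list \<sigma> ts = ts}) dvd G.coord d ts f * P ts" by simp
    qed (simp_all)
    moreover have "(\<Sum>ts\<in>X. G.coord d ts f * P ts) = (\<Sum>ts\<in>S. G.coord d ts f * P ts)"
      using finS P_zero by (intro sum.mono_neutral_left) (auto simp: X_def)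
    moreover have "card Q = cfact Bc' n us"
      unfolding Q_def by (rule card_fiberperms_eq_cfact[OF lenu H.tri_lists_snd[OF us]])
    ultimately show ?thesis by (simp add: coord_us)
  qed
  then show "f \<in> H.schur_vectors n d" using f(1) sym by (simp add: H.schur_vectors_def)
qed

section \<open>Idempotent corners\<close>

context Modules.module
begin

text \<open>A linear relation splits into its part over \<open>S\<close> and the rest, which lies in
  the span of \<open>T\<close>. The two are negatives of each other, so they lie in the trivial
  intersection and vanish separately.\<close>

lemma independent_Un:
  assumes S: "independent S" and T: "independent T" and int: "span S \<inter> span T \<subseteq> {0}"
  shows "independent (S \<union> T)"
  unfolding independent_explicit_module
proof (intro allI impI)
  fix t u v assume t: "finite t" "t \<subseteq> S \<union> T" "(\<Sum>v\<in>t. scale (u v) v) = 0" "v \<in> t"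
  let ?s = "\<Sum>v\<in>t \<inter> S. scale (u v) v" and ?r = "\<Sum>v\<in>t - S. scale (u v) v"
  have sum: "?s + ?r = 0"
    using t(1,3) sum.Int_Diff[of t "\<lambda>v. scale (u v) v" S] by simp
  have s: "?s \<in> span S" by (intro span_sum span_scale span_base) auto
  have r: "?r \<in> span T" using t(2) by (intro span_sum span_scale span_base) auto
  have "?s = - ?r" using sum by (rule eq_neg_iff_add_eq_0[THEN iffD2])
  then have "?s \<in> span S \<inter> span T" using s span_neg[OF r] by simp
  then have s0: "?s = 0" using int by blast
  then have r0: "?r = 0" using sum by simp
  show "u v = 0"
  proof (cases "v \<in> S")
    case True
    then show ?thesis using independentD[OF S _ _ s0, of v] t by auto
  next
    case False
    then show ?thesis using independentD[OF T _ _ r0, of v] t by auto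
  qed
qed

text \<open>The unique representation over \<open>S \<union> T\<close> is supported both in
  \<open>S\<close> and in \<open>T\<close>, hence nowhere.\<close>

lemma span_Int_independent:
  assumes ST: "independent (S \<union> T)" "S \<inter> T = {}" and x: "x \<in> span S" "x \<in> span T"
  shows "x = 0"
proof -
  have 1: "representation (S \<union> T) x = representation S x"
    using ST(1) x(1) by (intro representation_extend) auto
  have 2: "representation (S \<union> T) x = representation T x"
    using ST(1) x(2) by (intro representation_extend) auto
  have zero: "representation S x b = 0" for b
    using representation_ne_zero[of S x b] representation_ne_zero[of T x b] 1 2 ST(2) by auto
  have "independent S" using independent_mono[OF ST(1)] by blast
  from sum_nonzero_representation_eq[OF this x(1)] show ?thesis by (simp add: zero)
qed

text \<open>The set \<open>T\<close> represents a basis of the quotient: existence comes from the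
  component of \<open>x\<close> in the span of \<open>T\<close>, uniqueness from the trivial
  intersection of the two spans.\<close>

lemma free_quotient_span:
  assumes ST: "independent (S \<union> T)" "S \<inter> T = {}"
  shows "free_quotient scale (span (S \<union> T)) (span S)"
  unfolding free_quotient_def
proof (intro exI[of _ T] conjI ballI)
  have T: "independent T" using independent_mono[OF ST(1)] by blast
  show "T \<subseteq> span (S \<union> T)" using span_superset by blast
  fix x assume "x \<in> span (S \<union> T)"
  then obtain s t where st: "x = s + t" "s \<in> span S" "t \<in> span T" by (auto simp: span_Un)
  let ?sum = "\<lambda>f :: 'b \<Rightarrow>\<^sub>0 'a. \<Sum>c\<in>Poly_Mapping.keys f. scale (Poly_Mapping.lookup f c) c"
  have in_T: "?sum f \<in> span T" if "Poly_Mapping.keys f \<subseteq> T" for f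
    using that by (intro span_sum span_scale span_base) auto
  show "\<exists>!f. Poly_Mapping.keys f \<subseteq> T \<and> x - ?sum f \<in> span S"
  proof (rule ex_ex1I)
    let ?f = "Abs_poly_mapping (representation T t)"
    have l: "Poly_Mapping.lookup ?f = representation T t"
      by (rule lookup_Abs_poly_mapping) (rule finite_representation)
    have k: "Poly_Mapping.keys ?f = {b. representation T t b \<noteq> 0}"
      by (simp add: set_eq_iff in_keys_iff l)
    have "?sum ?f = t"
      unfolding k l by (rule sum_nonzero_representation_eq[OF T st(3)])
    then have "x - ?sum ?f \<in> span S" using st by simp
    moreover have "Poly_Mapping.keys ?f \<subseteq> T" unfolding k using representation_ne_zero by blast
    ultimately show "\<exists>f. Poly_Mapping.keys f \<subseteq> T \<and> x - ?sum f \<in> span S" by blast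
  next
    fix f g assume f: "Poly_Mapping.keys f \<subseteq> T \<and> x - ?sum f \<in> span S"
      and g: "Poly_Mapping.keys g \<subseteq> T \<and> x - ?sum g \<in> span S"
    have "(x - ?sum g) - (x - ?sum f) \<in> span S"
      by (rule span_diff[OF conjunct2[OF g] conjunct2[OF f]])
    then have "?sum f - ?sum g \<in> span S" by simp
    moreover have "?sum f - ?sum g \<in> span T" using f g in_T by (intro span_diff) auto
    ultimately have "?sum f - ?sum g = 0" by (rule span_Int_independent[OF ST])
    then have "?sum f = ?sum g" by simp
    then have "Poly_Mapping.lookup f = Poly_Mapping.lookup g"
      using f g by (intro unique_representation[OF T]) (auto simp: in_keys_iff simp flip: keys.rep_eq)
    then show "f = g" by (rule lookup_inject[THEN iffD1])
  qed
qed

end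

text \<open>The two direct sums, of \<open>\<aa>\<close> and \<open>\<cc>\<close> and of the even
  and the odd part, make the three bases jointly independent. A common element of \<open>Ba\<close>
  and \<open>Bc\<close> would be 0, which no independent set contains.\<close>

lemma pair_basis_imp_graded:
  fixes scale :: "'k::{idom, ring_char_0} \<Rightarrow> 'a::ring \<Rightarrow> 'a"
  assumes "superalgebra scale A" and pb: "pair_basis scale A \<aa> Ba Bc B1"
  shows "graded_pair_basis scale A (\<lambda>i. if i = 0 then Ba \<union> Bc else B1) Bc" "Ba \<inter> Bc = {}"
proof -
  interpret superalgebra scale A by fact
  obtain \<cc> where c: "subspace \<cc>" "\<aa> \<inter> \<cc> = {0}" "{x + y | x y. x \<in> \<aa> \<and> y \<in> \<cc>} = A 0"
    "independent Bc" "span Bc = \<cc>"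
    using pb by (auto simp: pair_basis_def basis_of_def)
  have a: "independent Ba" "span Ba = \<aa>" and o: "independent B1" "span B1 = A 1"
    using pb by (auto simp: pair_basis_def basis_of_def)
  have sp0: "span (Ba \<union> Bc) = A 0" using c(3) by (simp add: span_Un a(2) c(5))
  have "independent (Ba \<union> Bc)" using c(2) by (intro independent_Un a(1) c(4)) (simp add: a(2) c(5))
  then have "independent ((Ba \<union> Bc) \<union> B1)"
    using parts_Int by (intro independent_Un[OF _ o(1)]) (simp_all add: sp0 o(2))
  then show "graded_pair_basis scale A (\<lambda>i. if i = 0 then Ba \<union> Bc else B1) Bc"
    by unfold_locales (auto simp: sp0 o(2))
  have "0 \<notin> Ba" using a(1) dependent_zero by blast
  moreover have "Ba \<inter> Bc \<subseteq> {0}"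
    using span_superset[of Ba] span_superset[of Bc] c(2) by (auto simp: a(2) c(5))
  ultimately show "Ba \<inter> Bc = {}" by blast
qed

section \<open>The corner of an admissible basis and restriction of coordinates\<close>

locale idempotent_corner = graded_pair_basis scale A Bs Bc
  for scale :: "'k::{idom, ring_char_0} \<Rightarrow> 'a::ring \<Rightarrow> 'a" and A Bs Bc +
  fixes e :: 'a
  assumes e_even: "e \<in> A 0" and e_idem: "e * e = e"
    and admissible: "b \<in> Bs 0 \<union> Bs 1 \<Longrightarrow> e * b * e = b \<or> e * b * e = 0"
begin

text \<open>By admissibility, conjugation by \<open>e\<close> fixes the elements of
  \<open>bar S\<close> and kills all other elements of a set \<open>S\<close> of basis elements. It
  is thus a projection along the basis.\<close>

definition bar :: "'a set \<Rightarrow> 'a set" where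
  "bar S = {b \<in> S. e * b * e = b}"

lemma mem_bar_iff: "b \<in> bar S \<longleftrightarrow> b \<in> S \<and> e * b * e = b"
  by (simp add: bar_def)

abbreviation "Ae \<equiv> \<lambda>i. corner e (A i)"

lemma e_e_mult: "e * (e * x) = e * x"
  by (simp add: e_idem flip: mult.assoc)

lemma corner_fixed: "x \<in> corner e V \<Longrightarrow> e * x * e = x"
  by (auto simp: corner_def mult.assoc e_idem e_e_mult)

lemma corner_eq: "(\<And>x. x \<in> V \<Longrightarrow> e * x * e \<in> V) \<Longrightarrow> corner e V = {x \<in> V. e * x * e = x}"
  using corner_fixed by (auto simp: corner_def image_iff) metis

lemma e_mult_in: "x \<in> A i \<Longrightarrow> e * x * e \<in> A i"
  using mult_part[OF mult_part[OF e_even] e_even, of x i] by (simp only: add_0_left add_0_right)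

lemma Ae_eq: "Ae i = {x \<in> A i. e * x * e = x}"
  by (rule corner_eq[OF e_mult_in])

text \<open>Stated for arbitrary sets of basis elements so as to cover \<open>A 0\<close>,
  \<open>A 1\<close>, \<open>\<aa>\<close> and the complement alike.\<close>

lemma corner_span:
  assumes "S \<subseteq> BB"
  shows "corner e (span S) = span (bar S)"
proof
  show "corner e (span S) \<subseteq> span (bar S)"
  proof
    fix x assume "x \<in> corner e (span S)"
    then obtain y where y: "x = e * y * e" "y \<in> span S" by (auto simp: corner_def)
    have "e * y * e \<in> span (bar S)"
      using y(2)
    proof (induction rule: span_induct)
      case base
      show ?case
        by (rule subspaceI)
          (auto simp: distrib_left distrib_right scale_mult_left scale_mult_right span_zero span_add span_scale)
    next
      case (step b)
      then consider "e * b * e = b" | "e * b * e = 0" using admissible[of b] assms by blast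
      then show ?case
      proof cases
        case 1
        then have "b \<in> bar S" using step by (simp add: mem_bar_iff)
        then show ?thesis using 1 by (simp add: span_base)
      qed (simp add: span_zero)
    qed
    then show "x \<in> span (bar S)" by (simp add: y)
  qed
  show "span (bar S) \<subseteq> corner e (span S)"
  proof
    fix x assume x: "x \<in> span (bar S)"
    have "e * x * e = x"
      using x
    proof (induction rule: span_induct)
      case base
      show ?case
        by (rule subspaceI) (auto simp: distrib_left distrib_right scale_mult_left scale_mult_right)
    qed (simp add: bar_def)
    moreover have "x \<in> span S" using x span_mono[of "bar S" S] by (auto simp: bar_def)
    ultimately show "x \<in> corner e (span S)" unfolding corner_def by (metis imageI)
  qed
qed

lemma superalgebra_corner: "superalgebra scale Ae"
proof
  show "scale c x * y = scale c (x * y)" for c x y by (rule scale_mult_left)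
  show "x * scale c y = scale c (x * y)" for c x y by (rule scale_mult_right)
  show "subspace (Ae i)" for i
    using corner_span[OF Bs_subset_BB[of i]] by (simp add: span_Bs)
  show "Ae 0 \<inter> Ae 1 = {0}"
    using parts_Int subspace_0[OF subspace_part] by (auto simp: Ae_eq)
  show "x * y \<in> Ae (i + j)" if "x \<in> Ae i" "y \<in> Ae j" for x y i j
  proof -
    have x: "x \<in> A i" "e * x * e = x" and y: "y \<in> A j" "e * y * e = y" using that by (auto simp: Ae_eq)
    have "e * x = x" "y * e = y" using x(2) y(2) e_idem by (metis mult.assoc)+
    then have "e * (x * y) * e = x * y" by (metis mult.assoc)
    then show ?thesis using mult_part[OF x(1) y(1)] by (simp add: Ae_eq)
  qed
qed

text \<open>All results on coordinates and Schur algebras become available for the corner, computed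
  inside the same ambient algebra and with the fixed basis elements as basis.\<close>

sublocale bar: graded_pair_basis scale Ae "\<lambda>i. bar (Bs i)" "bar Bc"
proof -
  interpret superalgebra scale Ae by (rule superalgebra_corner)
  show "graded_pair_basis scale Ae (\<lambda>i. bar (Bs i)) (bar Bc)"
  proof
    show "independent (bar (Bs 0) \<union> bar (Bs 1))"
      by (rule independent_mono[OF indep]) (auto simp: bar_def)
    show "span (bar (Bs i)) = Ae i" for i
      using corner_span[OF Bs_subset_BB[of i]] by (simp add: span_Bs)
    show "bar Bc \<subseteq> bar (Bs 0)" using Bc_subset by (auto simp: bar_def)
  qed
qed

lemma Ae_subset: "Ae i \<subseteq> A i"
  by (auto simp: Ae_eq)

lemma super_carrier_Ae_subset: "super_carrier Ae \<subseteq> super_carrier A"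
  using Ae_subset by (fastforce simp: super_carrier_def)

lemma super_carrier_Ae_fixed: "x \<in> super_carrier Ae \<Longrightarrow> e * x * e = x"
  using corner_fixed by (auto simp: super_carrier_def distrib_left distrib_right)

lemma e_mult_super_carrier: "x \<in> super_carrier A \<Longrightarrow> e * x * e \<in> super_carrier Ae"
  by (fastforce simp: super_carrier_def corner_def distrib_left distrib_right)

lemma super_mats_Ae_subset: "super_mats Ae n \<subseteq> super_mats A n"
  using super_carrier_Ae_subset by (auto simp: super_mats_def)

lemma words_Ae_subset: "words Ae n d \<subseteq> words A n d"
  using super_mats_Ae_subset by (auto simp: words_def)

lemma word_module_Ae_subset: "word_module Ae n d \<subseteq> word_module A n d"
  using words_Ae_subset by (auto simp: word_module_def)

lemma tri_lists_Ae_iff: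
  "ts \<in> bar.tri_lists n d \<longleftrightarrow> ts \<in> tri_lists n d \<and> (\<forall>t\<in>set ts. e * fst t * e = fst t)"
  by (force simp: bar.tri_lists_def tri_lists_def bar.tri_letters_def tri_letters_def mem_bar_iff)

lemma pars_Ae: "ts \<in> bar.tri_lists n d \<Longrightarrow> bar.pars ts = pars ts"
  by (auto simp: tri_lists_Ae_iff bar.pars_def pars_def bar.par_def par_def mem_bar_iff)

text \<open>Both sides are linear in \<open>x\<close>, so basis elements suffice. One that is killed
  by conjugation differs from \<open>b\<close>, because \<open>e * b * e = b\<close> is
  nonzero.\<close>

lemma rep_corner:
  assumes x: "x \<in> super_carrier A" and b: "b \<in> bar BB"
  shows "bar.rep (e * x * e) b = rep x b"
proof -
  have b': "b \<in> BB" "e * b * e = b" using b by (auto simp: mem_bar_iff)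
  have nz: "b \<noteq> 0" using b' indep dependent_zero by blast
  \<comment> \<open>Membership in the carrier is carried along because additivity of
    \<open>rep\<close> is known only there.\<close>
  let ?P = "\<lambda>x. x \<in> super_carrier A \<and> bar.rep (e * x * e) b = rep x b"
  have "x \<in> span BB" using x by (simp add: super_carrier_eq_span)
  then have "?P x"
  proof (induction rule: span_induct)
    case base
    show ?case
    proof (rule subspaceI)
      show "0 \<in> Collect ?P" using subspace_0[OF subspace_super_carrier] by simp
    next
      fix y z assume "y \<in> Collect ?P" "z \<in> Collect ?P"
      then show "y + z \<in> Collect ?P"
        using subspace_add[OF subspace_super_carrier] e_mult_super_carrier
        by (simp add: distrib_left distrib_right rep_add bar.rep_add)
    next
      fix c y assume "y \<in> Collect ?P"
      then show "scale c y \<in> Collect ?P"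
        using subspace_scale[OF subspace_super_carrier] e_mult_super_carrier
        by (simp add: scale_mult_left scale_mult_right rep_scale bar.rep_scale)
    qed
  next
    case (step c)
    consider "e * c * e = c" | "e * c * e = 0" using admissible[OF step] by blast
    then show ?case
    proof cases
      case 1
      then have "c \<in> bar (Bs 0) \<union> bar (Bs 1)" using step by (auto simp: mem_bar_iff)
      then show ?thesis using 1 bar.rep_basis rep_basis[OF step] BB_subset step by auto
    next
      case 2
      then have "b \<noteq> c" using b' nz by auto
      then show ?thesis using 2 rep_basis[OF step] BB_subset step by auto
    qed
  qed
  then show ?thesis ..
qed

lemma rep_outside_corner:
  assumes "x \<in> super_carrier Ae" "e * b * e \<noteq> b"
  shows "rep x b = 0"
  using assms by (intro rep_subset[of x "bar (Bs 0) \<union> bar (Bs 1)"])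
    (auto simp: bar.super_carrier_eq_span mem_bar_iff)

definition conj_mat :: "nat \<Rightarrow> 'a mat \<Rightarrow> 'a mat" where
  "conj_mat n X = diag n e * X * diag n e"

lemma conj_mat_index:
  assumes "X \<in> carrier_mat n n" "r < n" "s < n"
  shows "conj_mat n X $$ (r, s) = e * X $$ (r, s) * e"
proof -
  have "diag n e * X \<in> carrier_mat n n" using assms(1) by (intro mult_carrier_mat[of _ n n]) auto
  then show ?thesis unfolding conj_mat_def using assms by (simp only: mult_diag_index diag_mult_index)
qed

lemma conj_mat_carrier: "X \<in> carrier_mat n n \<Longrightarrow> conj_mat n X \<in> carrier_mat n n"
  unfolding conj_mat_def by (intro mult_carrier_mat[of _ n n]) auto

lemma conj_mat_in_Ae: "X \<in> super_mats A n \<Longrightarrow> conj_mat n X \<in> super_mats Ae n"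
  using e_mult_super_carrier by (simp add: super_mats_iff bar.super_mats_iff conj_mat_carrier conj_mat_index)

lemma conj_mat_fixed:
  assumes "X \<in> super_mats Ae n"
  shows "conj_mat n X = X"
proof (rule eq_matI)
  have X: "X \<in> carrier_mat n n" using assms by (simp add: bar.super_mats_iff)
  note XC = conj_mat_carrier[OF X]
  show "dim_row (conj_mat n X) = dim_row X" "dim_col (conj_mat n X) = dim_col X" using X XC by auto
  fix r s assume "r < dim_row X" "s < dim_col X"
  then show "conj_mat n X $$ (r, s) = X $$ (r, s)"
    using X assms super_carrier_Ae_fixed by (simp add: conj_mat_index bar.super_mats_iff)
qed

lemma matmap_conj_in_Ae: "f \<in> word_module A n d \<Longrightarrow> matmap (conj_mat n) f \<in> word_module Ae n d"
  by (rule matmap_in_word_module[OF _ conj_mat_in_Ae])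

lemma matmap_conj_fixed:
  fixes f :: "'a mat list \<Rightarrow>\<^sub>0 'k"
  assumes "f \<in> word_module Ae n d"
  shows "matmap (conj_mat n) f = f"
proof -
  have "map (conj_mat n) w = w" if "w \<in> Poly_Mapping.keys f" for w
    using bar.word_module_keys[OF assms that] conj_mat_fixed
    by (intro map_idI) (auto simp: words_def)
  then have "matmap (conj_mat n) f = (\<Sum>w\<in>Poly_Mapping.keys f. fscale (Poly_Mapping.lookup f w) (Poly_Mapping.single w 1))"
    unfolding matmap_def lin_ext_def by (intro sum.cong) auto
  also have "\<dots> = f"
    by (rule poly_mapping_eqI)
      (simp add: lookup_sum lookup_fscale lookup_single when_def sum.delta' not_in_keys_iff_lookup_eq_zero if_distrib cong: if_cong)
  finally show ?thesis .
qed

text \<open>The coordinate is a product over the letters of coefficients of matrix entries, and by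
  \<open>rep_corner\<close> conjugation leaves each of these coefficients unchanged.\<close>

lemma coord_matmap_conj:
  assumes f: "f \<in> word_module A n d" and ts: "ts \<in> bar.tri_lists n d"
  shows "bar.coord d ts (matmap (conj_mat n) f) = coord d ts f"
proof -
  have "bar.coordw d ts (map (conj_mat n) w) = coordw d ts w" if w: "w \<in> words A n d" for w
    unfolding bar.coordw_def coordw_def
  proof (rule prod.cong[OF refl])
    fix k assume "k \<in> {..<d}"
    then have k: "k < d" by simp
    obtain b r s where t: "ts ! k = (b, r, s)" by (cases "ts ! k")
    have brs: "b \<in> bar BB" "r < n" "s < n"
      using bar.tri_lists_nth[OF ts k] by (auto simp: t bar.tri_letters_def mem_bar_iff)
    have X: "w ! k \<in> super_mats A n" by (rule words_nth[OF w k])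
    then have "conj_mat n (w ! k) $$ (r, s) = e * (w ! k) $$ (r, s) * e"
      using brs by (intro conj_mat_index) (auto simp: super_mats_iff)
    moreover have "(w ! k) $$ (r, s) \<in> super_carrier A" using X brs by (simp add: super_mats_iff)
    ultimately show "bar.ent (map (conj_mat n) w ! k) (ts ! k) = ent (w ! k) (ts ! k)"
      using w k brs(1) by (simp add: bar.ent_def ent_def t words_def rep_corner)
  qed
  then show ?thesis
    unfolding bar.coord_matmap coord_def by (intro sext_cong) (blast intro: word_module_keys[OF f])
qed

text \<open>Words over the corner are fixed by conjugation, so this is
  \<open>coord_matmap_conj\<close> applied to \<open>f\<close> itself.\<close>

lemma coord_Ae:
  assumes f: "f \<in> word_module Ae n d" and ts: "ts \<in> bar.tri_lists n d"
  shows "bar.coord d ts f = coord d ts f"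
  using coord_matmap_conj[OF subsetD[OF word_module_Ae_subset f] ts] by (simp add: matmap_conj_fixed[OF f])

lemma coord_outside_Ae:
  assumes f: "f \<in> word_module Ae n d" and ts: "ts \<in> tri_lists n d" "ts \<notin> bar.tri_lists n d"
  shows "coord d ts f = 0"
proof -
  obtain t where "t \<in> set ts" "e * fst t * e \<noteq> fst t" using ts by (auto simp: tri_lists_Ae_iff)
  then obtain k where k: "k < d" "e * fst (ts ! k) * e \<noteq> fst (ts ! k)"
    using tri_lists_length[OF ts(1)] by (auto simp: in_set_conv_nth)
  have "coordw d ts w = 0" if w: "w \<in> words Ae n d" for w
  proof -
    obtain b r s where t: "ts ! k = (b, r, s)" by (cases "ts ! k")
    have "r < n" "s < n" using tri_lists_nth[OF ts(1) k(1)] by (auto simp: t tri_letters_def)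
    then have "(w ! k) $$ (r, s) \<in> super_carrier Ae"
      using bar.words_nth[OF w k(1)] by (simp add: bar.super_mats_iff)
    then have "ent (w ! k) (ts ! k) = 0" using k(2) rep_outside_corner by (simp add: ent_def t)
    then show ?thesis unfolding coordw_def using k(1) by (intro prod_zero) auto
  qed
  then show ?thesis
    unfolding coord_def sext_def using bar.word_module_keys[OF f] by (intro sum.neutral) auto
qed

lemma permute_tri_lists_Ae_iff:
  assumes "ts \<in> tri_lists n d" "\<sigma> permutes {..<d}"
  shows "permute_list \<sigma> ts \<in> bar.tri_lists n d \<longleftrightarrow> ts \<in> bar.tri_lists n d"
  using assms permute_tri_lists[OF assms] tri_lists_length[OF assms(1)] by (simp add: tri_lists_Ae_iff)

text \<open>Permuting a list does not change its set of letters, so coordinates inside and outside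
  the corner are never mixed; those outside vanish.\<close>

lemma sym_coord_Ae:
  assumes f: "f \<in> word_module Ae n d" and sym: "bar.sym_coord n d f"
  shows "sym_coord n d f"
  unfolding sym_coord_def
proof (intro allI impI ballI)
  fix \<sigma> ts assume s: "\<sigma> permutes {..<d}" and ts: "ts \<in> tri_lists n d"
  note p = permute_tri_lists[OF ts s] and iff = permute_tri_lists_Ae_iff[OF ts s]
  show "coord d (permute_list \<sigma> ts) f = (- 1) ^ perm_sign_exp d \<sigma> (pars ts) * coord d ts f"
  proof (cases "ts \<in> bar.tri_lists n d")
    case True
    then show ?thesis
      using bar.sym_coordD[OF sym s True] coord_Ae[OF f] iff pars_Ae[OF True] by simp
  next
    case False
    then show ?thesis
      using coord_outside_Ae[OF f ts] coord_outside_Ae[OF f p] iff by simp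
  qed
qed

lemma sym_coord_matmap_conj:
  assumes f: "f \<in> word_module A n d" and sym: "sym_coord n d f"
  shows "bar.sym_coord n d (matmap (conj_mat n) f)"
  unfolding bar.sym_coord_def
proof (intro allI impI ballI)
  fix \<sigma> ts assume s: "\<sigma> permutes {..<d}" and ts: "ts \<in> bar.tri_lists n d"
  have tl: "ts \<in> tri_lists n d" using ts by (simp add: tri_lists_Ae_iff)
  show "bar.coord d (permute_list \<sigma> ts) (matmap (conj_mat n) f) =
    (- 1) ^ perm_sign_exp d \<sigma> (bar.pars ts) * bar.coord d ts (matmap (conj_mat n) f)"
    using sym_coordD[OF sym s tl] coord_matmap_conj[OF f ts]
      coord_matmap_conj[OF f bar.permute_tri_lists[OF ts s]] pars_Ae[OF ts] by simp
qed

lemma cfact_Ae: "ts \<in> bar.tri_lists n d \<Longrightarrow> cfact (bar Bc) n ts = cfact Bc n ts"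
proof -
  assume "ts \<in> bar.tri_lists n d"
  then have "bar Bc \<inter> fst ` set ts = Bc \<inter> fst ` set ts" by (auto simp: tri_lists_Ae_iff mem_bar_iff)
  then show ?thesis by (simp add: cfact_def)
qed

text \<open>Inside the corner the coordinates and the factorials are the same for both algebras;
  outside, the coordinates are 0 and divisible by anything.\<close>

lemma schur_vectors_Ae: "bar.schur_vectors n d \<subseteq> schur_vectors n d"
proof
  fix f assume f: "f \<in> bar.schur_vectors n d"
  then have f': "f \<in> word_module Ae n d" by (simp add: bar.schur_vectors_def)
  have "of_nat (cfact Bc n ts) dvd coord d ts f" if ts: "ts \<in> tri_lists n d" for ts
  proof (cases "ts \<in> bar.tri_lists n d")
    case True
    then show ?thesis using f coord_Ae[OF f' True] cfact_Ae[OF True] by (auto simp: bar.schur_vectors_def)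
  qed (simp add: coord_outside_Ae[OF f' ts])
  then show "f \<in> schur_vectors n d"
    using f sym_coord_Ae[OF f'] word_module_Ae_subset by (auto simp: schur_vectors_def bar.schur_vectors_def)
qed

lemma schur_vectors_matmap_conj:
  assumes "f \<in> schur_vectors n d"
  shows "matmap (conj_mat n) f \<in> bar.schur_vectors n d"
proof -
  have f: "f \<in> word_module A n d" using assms by (simp add: schur_vectors_def)
  have "of_nat (cfact (bar Bc) n ts) dvd bar.coord d ts (matmap (conj_mat n) f)"
    if ts: "ts \<in> bar.tri_lists n d" for ts
  proof -
    have "ts \<in> tri_lists n d" using ts by (simp add: tri_lists_Ae_iff)
    then show ?thesis
      using assms coord_matmap_conj[OF f ts] cfact_Ae[OF ts] by (auto simp: schur_vectors_def)
  qed
  then show ?thesis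
    using assms sym_coord_matmap_conj[OF f] matmap_conj_in_Ae[OF f]
    by (auto simp: schur_vectors_def bar.schur_vectors_def)
qed

text \<open>Over a ring, tensor powers of an inclusion need not be injective. Here the coordinates
  over \<open>A\<close> extend those over the corner by zero, so the larger algebra identifies no
  further tensors.\<close>

lemma tensor_class_Ae_eq_iff:
  assumes "f \<in> word_module Ae n d" "g \<in> word_module Ae n d"
  shows "tensor_class scale Ae n d f = tensor_class scale Ae n d g \<longleftrightarrow>
    tensor_class scale A n d f = tensor_class scale A n d g"
proof -
  have fg: "f \<in> word_module A n d" "g \<in> word_module A n d" using assms word_module_Ae_subset by auto
  have "coord d ts f = coord d ts g" if "\<forall>ts\<in>bar.tri_lists n d. bar.coord d ts f = bar.coord d ts g"
    "ts \<in> tri_lists n d" for ts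
    using that coord_Ae assms coord_outside_Ae by (cases "ts \<in> bar.tri_lists n d") auto
  moreover have "bar.coord d ts f = bar.coord d ts g" if "\<forall>ts\<in>tri_lists n d. coord d ts f = coord d ts g"
    "ts \<in> bar.tri_lists n d" for ts
    using that coord_Ae[OF assms(1) that(2)] coord_Ae[OF assms(2) that(2)] tri_lists_Ae_iff by simp
  ultimately show ?thesis
    unfolding tensor_class_eq_iff_coord[OF fg] bar.tensor_class_eq_iff_coord[OF assms] by blast
qed

text \<open>All members of a class over the corner have the same class over \<open>A\<close>, so the
  union in \<open>tensor_incl\<close> collapses.\<close>

lemma tensor_incl_class:
  assumes f: "f \<in> word_module Ae n d"
  shows "tensor_incl scale A n d (tensor_class scale Ae n d f) = tensor_class scale A n d f"
proof -
  have "tensor_class scale A n d g = tensor_class scale A n d f" if "g \<in> tensor_class scale Ae n d f" for g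
  proof -
    have "g \<in> word_module Ae n d" "f - g \<in> multilin_rels scale Ae n d"
      using that by (auto simp: bar.tensor_class_eq[OF f])
    then show ?thesis
      using tensor_class_Ae_eq_iff[OF f, of g] bar.tensor_class_eq_iff[OF f, of g] by auto
  qed
  moreover have "f \<in> tensor_class scale Ae n d f" using f by (simp add: bar.mem_tensor_class_iff_coord)
  ultimately show ?thesis unfolding tensor_incl_def by blast
qed

lemma inj_on_tensor_incl: "inj_on (tensor_incl scale A n d) (invariant_algebra scale Ae n d)"
proof (rule inj_onI)
  fix t u assume "t \<in> invariant_algebra scale Ae n d" "u \<in> invariant_algebra scale Ae n d"
    and eq: "tensor_incl scale A n d t = tensor_incl scale A n d u"
  then obtain f g where "t = tensor_class scale Ae n d f" "f \<in> word_module Ae n d"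
    "u = tensor_class scale Ae n d g" "g \<in> word_module Ae n d"
    by (auto simp: bar.invariant_algebra_eq)
  then show "t = u" using eq by (simp add: tensor_incl_class tensor_class_Ae_eq_iff)
qed

text \<open>The pattern common to both claims, with \<open>V\<close> and \<open>V'\<close> the
  representatives of invariants or of Schur algebras. Conjugation maps \<open>V\<close> into
  \<open>V'\<close> and is the identity on \<open>V' \<subseteq> V\<close>, so its image is all of
  \<open>V'\<close>.\<close>

lemma tensor_incl_eq_xi_corner:
  assumes "V' \<subseteq> word_module Ae n d" "V \<subseteq> word_module A n d" "V' \<subseteq> V"
    and "\<And>f. f \<in> V \<Longrightarrow> matmap (conj_mat n) f \<in> V'"
  shows "tensor_incl scale A n d ` tensor_class scale Ae n d ` V' =
    xi_corner scale A n d e (tensor_class scale A n d ` V)"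
proof -
  have "xi_corner scale A n d e (tensor_class scale A n d ` V) =
      (\<lambda>f. tensor_class scale A n d (matmap (conj_mat n) f)) ` V"
    unfolding xi_corner_def image_image using assms(2) xi_corner_class[OF _ e_even]
    by (intro image_cong) (auto simp: conj_mat_def[abs_def])
  also have "\<dots> = tensor_class scale A n d ` V'"
  proof
    show "tensor_class scale A n d ` V' \<subseteq> (\<lambda>f. tensor_class scale A n d (matmap (conj_mat n) f)) ` V"
    proof
      fix t assume "t \<in> tensor_class scale A n d ` V'"
      then obtain f where f: "f \<in> V'" "t = tensor_class scale A n d f" by blast
      then have "t = tensor_class scale A n d (matmap (conj_mat n) f)"
        using assms(1) matmap_conj_fixed by auto
      then show "t \<in> (\<lambda>f. tensor_class scale A n d (matmap (conj_mat n) f)) ` V" using f(1) assms(3) by blast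
    qed
  qed (use assms(4) in blast)
  also have "\<dots> = tensor_incl scale A n d ` tensor_class scale Ae n d ` V'"
    unfolding image_image using assms(1) tensor_incl_class by (intro image_cong) auto
  finally show ?thesis ..
qed

lemma invariant_algebra_corner:
  "tensor_incl scale A n d ` invariant_algebra scale Ae n d =
    xi_corner scale A n d e (invariant_algebra scale A n d)"
  unfolding invariant_algebra_eq bar.invariant_algebra_eq
  using word_module_Ae_subset
  by (intro tensor_incl_eq_xi_corner)
    (auto intro: sym_coord_Ae sym_coord_matmap_conj matmap_conj_in_Ae)

lemma schur_vectors_corner:
  "tensor_incl scale A n d ` tensor_class scale Ae n d ` bar.schur_vectors n d =
    xi_corner scale A n d e (tensor_class scale A n d ` schur_vectors n d)"
  using schur_vectors_matmap_conj schur_vectors_Ae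
  by (intro tensor_incl_eq_xi_corner) (auto simp: schur_vectors_def bar.schur_vectors_def)

end

text \<open>The first two conjuncts give (ii) its meaning: the corner is a good pair, and it has
  pair bases, so the last quantifier is not vacuous. Injectivity of \<open>tensor_incl\<close> on
  the invariants justifies regarding the algebras over the corner as parts of those over
  \<open>A\<close>.\<close>

theorem lemma5p12:
  fixes scale :: "'k::{idom, ring_char_0} \<Rightarrow> 'a::ring \<Rightarrow> 'a"
    and A Abar :: "bit \<Rightarrow> 'a set" and \<aa> abar Ba Bc B1 :: "'a set"
    and n d :: nat and e :: 'a
  assumes "good_pair scale A \<aa>"
    and "pair_basis scale A \<aa> Ba Bc B1"
    and "n \<ge> 1"
    and "e \<in> \<aa>" and "e * e = e"
    and "\<forall>b \<in> Ba \<union> Bc \<union> B1. e * b * e = b \<or> e * b * e = 0"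
  defines "Abar \<equiv> \<lambda>i. corner e (A i)" and "abar \<equiv> corner e \<aa>"
  shows "good_pair scale Abar abar \<and>
    (\<exists>Ba' Bc' B1'. pair_basis scale Abar abar Ba' Bc' B1') \<and>
    inj_on (tensor_incl scale A n d) (invariant_algebra scale Abar n d) \<and>
    tensor_incl scale A n d ` invariant_algebra scale Abar n d =
      xi_corner scale A n d e (invariant_algebra scale A n d) \<and>
    (\<forall>Ba' Bc' B1'. pair_basis scale Abar abar Ba' Bc' B1' \<longrightarrow>
      tensor_incl scale A n d ` gen_schur scale Abar Ba' Bc' B1' n d =
        xi_corner scale A n d e (gen_schur scale A Ba Bc B1 n d))"
proof -
  have sA: "superalgebra scale A" and aa: "\<aa> \<subseteq> A 0" "\<And>x y. x \<in> \<aa> \<Longrightarrow> y \<in> \<aa> \<Longrightarrow> x * y \<in> \<aa>"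
    using assms(1) by (auto simp: good_pair_def)
  define Bs where "Bs = (\<lambda>i::bit. if i = 0 then Ba \<union> Bc else B1)"
  interpret G: graded_pair_basis scale A Bs Bc
    unfolding Bs_def by (rule pair_basis_imp_graded[OF sA assms(2)])
  interpret C: idempotent_corner scale A Bs Bc e
    by unfold_locales (use assms(4,5,6) aa(1) in \<open>auto simp: Bs_def\<close>)
  have Ba: "G.span Ba = \<aa>" using assms(2) by (simp add: pair_basis_def basis_of_def)
  obtain \<cc> where c: "\<aa> \<inter> \<cc> = {0}" "G.span Bc = \<cc>"
    using assms(2) by (auto simp: pair_basis_def basis_of_def)
  have BB: "Bs 0 \<union> Bs 1 = Ba \<union> Bc \<union> B1" by (simp add: Bs_def)
  have span_bar: "G.span (C.bar S) = corner e (G.span S)" if "S \<subseteq> Ba \<union> Bc \<union> B1" for S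
    using C.corner_span[of S] that BB by simp
  have indep: "G.independent (C.bar S)" if "S \<subseteq> Ba \<union> Bc \<union> B1" for S
    by (rule G.independent_mono[OF G.indep]) (use that BB in \<open>auto simp: C.mem_bar_iff\<close>)
  have bar_Un: "C.bar (S \<union> T) = C.bar S \<union> C.bar T" for S T by (auto simp: C.mem_bar_iff)
  have basis_a: "basis_of scale abar (C.bar Ba)"
    unfolding basis_of_def abar_def using indep[of Ba] span_bar[of Ba] Ba by auto
  have basis_0: "basis_of scale (Abar 0) (C.bar (Ba \<union> Bc))"
    unfolding basis_of_def Abar_def using indep[of "Ba \<union> Bc"] span_bar[of "Ba \<union> Bc"] G.span_Bs[of 0]
    by (auto simp: Bs_def)
  have basis_1: "basis_of scale (Abar 1) (C.bar B1)"
    unfolding basis_of_def Abar_def using indep[of B1] span_bar[of B1] G.span_Bs[of 1]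
    by (auto simp: Bs_def)
  \<comment> \<open>The chosen complement is the span of \<open>C.bar Bc\<close>. It lies in the old
    complement \<open>\<cc>\<close>, as \<open>abar\<close> lies in \<open>\<aa>\<close>, so the
    intersection is trivial.\<close>
  have pb: "pair_basis scale Abar abar (C.bar Ba) (C.bar Bc) (C.bar B1)"
    unfolding pair_basis_def
  proof (intro conjI exI[of _ "G.span (C.bar Bc)"])
    show "basis_of scale (G.span (C.bar Bc)) (C.bar Bc)"
      unfolding basis_of_def using indep[of Bc] by auto
    have "G.span (C.bar Ba) \<subseteq> G.span Ba" "G.span (C.bar Bc) \<subseteq> G.span Bc"
      by (rule G.span_mono; auto simp: C.mem_bar_iff)+
    then have "G.span (C.bar Ba) \<inter> G.span (C.bar Bc) \<subseteq> {0}" using c Ba by blast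
    then show "abar \<inter> G.span (C.bar Bc) = {0}"
      using basis_a G.span_zero by (auto simp: basis_of_def)
    show "{x + y | x y. x \<in> abar \<and> y \<in> G.span (C.bar Bc)} = Abar 0"
      using basis_a basis_0 by (simp add: basis_of_def bar_Un G.span_Un)
  qed (use basis_a basis_1 in simp_all)
  have disj: "Ba \<inter> (Bc \<union> B1) = {}"
    using pair_basis_imp_graded(2)[OF sA assms(2)] G.Bs_disjoint by (auto simp: Bs_def)
  have gp: "good_pair scale Abar abar"
    unfolding good_pair_def
  proof (intro conjI ballI)
    show "superalgebra scale Abar" unfolding Abar_def by (rule C.superalgebra_corner)
    show "free_module scale (Abar 0)" "free_module scale (Abar 1)" "free_module scale abar"
      using basis_0 basis_1 basis_a unfolding free_module_def by blast+
    show "abar \<subseteq> Abar 0" unfolding abar_def Abar_def corner_def using aa(1) by blast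
    have "G.span (C.bar Ba) = abar" using basis_a by (simp add: basis_of_def)
    then show "G.subspace abar" using G.subspace_span by metis
    show "x * y \<in> abar" if xy: "x \<in> abar" "y \<in> abar" for x y
    proof -
      obtain x' y' where *: "x = e * x' * e" "y = e * y' * e" "x' \<in> \<aa>" "y' \<in> \<aa>"
        using xy by (auto simp: abar_def corner_def)
      \<comment> \<open>Since \<open>e\<close> itself belongs to \<open>\<aa>\<close>, so does the
        inner factor \<open>x' * e * e * y'\<close>.\<close>
      have "x * y = e * (x' * e * e * y') * e" by (simp add: * mult.assoc)
      then show ?thesis unfolding abar_def corner_def using * aa(2) assms(4) by blast
    qed
    \<comment> \<open>Modulo \<open>abar\<close> the remaining basis elements, from the even
      complement and from the odd part, form a basis.\<close>
    have "G.independent (C.bar Ba \<union> C.bar (Bc \<union> B1))" using indep[of "Ba \<union> (Bc \<union> B1)"] bar_Un by (simp add: Un_assoc)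
    moreover have "C.bar Ba \<inter> C.bar (Bc \<union> B1) = {}" using disj by (auto simp: C.mem_bar_iff)
    moreover have "super_carrier Abar = G.span (C.bar Ba \<union> C.bar (Bc \<union> B1))"
      using C.bar.super_carrier_eq_span by (simp add: Abar_def Bs_def bar_Un Un_assoc)
    ultimately show "free_quotient scale (super_carrier Abar) abar"
      using G.free_quotient_span \<open>G.span (C.bar Ba) = abar\<close> by metis
  qed
  have schur: "tensor_incl scale A n d ` gen_schur scale Abar Ba' Bc' B1' n d =
      xi_corner scale A n d e (gen_schur scale A Ba Bc B1 n d)"
    if pb': "pair_basis scale Abar abar Ba' Bc' B1'" for Ba' Bc' B1'
  proof -
    define Bs' where "Bs' = (\<lambda>i::bit. if i = 0 then Ba' \<union> Bc' else B1')"
    note sAb = C.superalgebra_corner[folded Abar_def]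
    interpret K: graded_pair_basis scale Abar Bs' Bc'
      unfolding Bs'_def by (rule pair_basis_imp_graded[OF sAb pb'])
    have "Ba' \<inter> Bc' = {}" by (rule pair_basis_imp_graded[OF sAb pb'])
    then have Ba': "Bs' 0 - Bc' = Ba'" "G.span Ba' = abar"
      using pb' by (auto simp: Bs'_def pair_basis_def basis_of_def)
    have bBa: "C.bar (Bs 0) - C.bar Bc = C.bar Ba"
      using disj by (auto simp: Bs_def C.mem_bar_iff)
    have spa: "G.span (C.bar Ba) = abar" using basis_a by (simp add: basis_of_def)
    have "C.bar.schur_vectors n d = K.schur_vectors n d"
    proof
      note gpb = C.bar.graded_pair_basis_axioms[folded Abar_def]
      \<comment> \<open>Both \<open>C.bar Ba\<close> and \<open>Ba'\<close> span
        \<open>abar\<close>, so each lies in the span of the other, and the change of basis can be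
        applied in both directions.\<close>
      have "C.bar (Bs 0) - C.bar Bc \<subseteq> G.span (Bs' 0 - Bc')"
        unfolding bBa Ba' using spa G.span_superset by blast
      from schur_vectors_basis_change[OF gpb K.graded_pair_basis_axioms this]
      show "C.bar.schur_vectors n d \<subseteq> K.schur_vectors n d" by (simp add: Abar_def)
      have "Bs' 0 - Bc' \<subseteq> G.span (C.bar (Bs 0) - C.bar Bc)"
        unfolding bBa unfolding Ba'(1) spa using Ba'(2) G.span_superset by blast
      from schur_vectors_basis_change[OF K.graded_pair_basis_axioms gpb this]
      show "K.schur_vectors n d \<subseteq> C.bar.schur_vectors n d" by (simp add: Abar_def)
    qed
    note eq = this
    have gs': "gen_schur scale Abar Ba' Bc' B1' n d = tensor_class scale Abar n d ` K.schur_vectors n d"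
      by (rule K.gen_schur_eq) (simp add: Bs'_def)
    have gs: "gen_schur scale A Ba Bc B1 n d = tensor_class scale A n d ` G.schur_vectors n d"
      by (rule G.gen_schur_eq) (simp add: Bs_def)
    show ?thesis unfolding gs gs' eq[symmetric] unfolding Abar_def by (rule C.schur_vectors_corner)
  qed
  show ?thesis
  proof (intro conjI allI impI)
    show "inj_on (tensor_incl scale A n d) (invariant_algebra scale Abar n d)"
      unfolding Abar_def by (rule C.inj_on_tensor_incl)
    show "tensor_incl scale A n d ` invariant_algebra scale Abar n d =
        xi_corner scale A n d e (invariant_algebra scale A n d)"
      unfolding Abar_def by (rule C.invariant_algebra_corner)
    show "\<exists>Ba' Bc' B1'. pair_basis scale Abar abar Ba' Bc' B1'" by (intro exI) (rule pb)
  qed (rule gp, rule schur)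
qed

end
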